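(* Let $$X=\Big\{(z_1,z_2)\in\mathbb{C}^2 : |z_1|>4,\ |z_2|<\tfrac{1}{2|z_1|\log_4|z_1|}\Big\},\qquad Y=\Big\{(z_1,z_2)\in\mathbb{C}^2 : |z_2|>4,\ \Big||z_1|-\tfrac{1}{|z_2|}\Big|<\tfrac{1}{|z_2|^3}\Big\},$$ $$X'=\Big\{(z_1,z_2)\in\mathbb{C}^2 : |z_1|>4,\ \Big||z_2|-\tfrac{1}{|z_1|}\Big|<\tfrac{1}{|z_1|^3}\Big\},\qquad Y'=\Big\{(z_1,z_2)\in\mathbb{C}^2 : |z_2|>4,\ |z_1|<\tfrac{1}{2|z_2|\log_4|z_2|}\Big\},$$ $$Z=\{(z_1,z_2)\in\mathbb{C}^2 : |z_1|\le 4,\ |z_2|\le 4\},$$ and let $\Omega$ be the interior of $X\cup Y\cup Z$ and $\Omega'$ the interior of $X'\cup Y'\cup Z$. Then the Hankel operator $H_{\overline{z}_1\overline{z}_2}$ is Hilbert-Schmidt on $A^2(\Omega)$ and on $A^2(\Omega')$. However, $H_{\overline{z}_1\overline{z}_2}$ is not Hilbert-Schmidt on $A^2(\Omega\cap\Omega')$.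
   Context: For a domain $U\subset\mathbb{C}^2$, the Bergman space $A^2(U)$ is the Hilbert space of holomorphic functions on $U$ that are square-integrable with respect to Lebesgue measure, and $P:L^2(U)\to A^2(U)$ is the orthogonal (Bergman) projection. For a symbol $\phi$, the Hankel operator $H_\phi$ on $A^2(U)$ is $H_\phi f=\phi f-P(\phi f)$, with values in $L^2(U)$. Here $\phi(z_1,z_2)=\overline{z}_1\overline{z}_2$; although this symbol is unbounded on $\Omega$ and $\Omega'$, $H_\phi$ is a bounded operator on both Bergman spaces. A bounded linear operator $T$ on a Hilbert space $H$ is Hilbert-Schmidt if there is an orthonormal basis $\{\xi_j\}$ of $H$ such that $\sum_j\|T(\xi_j)\|^2<\infty$. $\log_4$ is the logarithm in base $4$. *)

theory Defs
  imports "HOL-Analysis.Analysis"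
begin

text \<open>
  Elements of \<open>L\<^sup>2(U)\<close> are represented by functions, so equality in \<open>L\<^sup>2(U)\<close> is equality almost
  everywhere on \<open>U\<close>. The measure on \<open>\<complex>\<^sup>2\<close> is the four-dimensional Lebesgue measure.
\<close>

definition L2_on :: "(complex \<times> complex) set \<Rightarrow> (complex \<times> complex \<Rightarrow> complex) set" where
  "L2_on U = {f. f \<in> borel_measurable (lebesgue_on U) \<and>
                 integrable (lebesgue_on U) (\<lambda>z. (norm (f z))\<^sup>2)}"

definition L2_inner_on ::
  "(complex \<times> complex) set \<Rightarrow> (complex \<times> complex \<Rightarrow> complex) \<Rightarrow> (complex \<times> complex \<Rightarrow> complex) \<Rightarrow> complex"
where
  "L2_inner_on U f g = (\<integral>z. f z * cnj (g z) \<partial>(lebesgue_on U))"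

definition L2_norm_on :: "(complex \<times> complex) set \<Rightarrow> (complex \<times> complex \<Rightarrow> complex) \<Rightarrow> real" where
  "L2_norm_on U f = sqrt (\<integral>z. (norm (f z))\<^sup>2 \<partial>(lebesgue_on U))"

text \<open>Holomorphy on an open subset of \<open>\<complex>\<^sup>2\<close>: the total derivative exists and is complex linear.\<close>

definition holomorphic2_on :: "(complex \<times> complex \<Rightarrow> complex) \<Rightarrow> (complex \<times> complex) set \<Rightarrow> bool" where
  "holomorphic2_on f U \<longleftrightarrow>
     (\<forall>z\<in>U. \<exists>a b. (f has_derivative (\<lambda>h. a * fst h + b * snd h)) (at z))"

text \<open>
  The values off \<open>U\<close> are normalised to \<open>0\<close>, so that a holomorphic function on \<open>U\<close> has exactly
  one representative; the description in \<open>bergman_proj\<close> relies on this for uniqueness.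
\<close>

definition bergman_space :: "(complex \<times> complex) set \<Rightarrow> (complex \<times> complex \<Rightarrow> complex) set" where
  "bergman_space U = {f. holomorphic2_on f U \<and> f \<in> L2_on U \<and> (\<forall>z. z \<notin> U \<longrightarrow> f z = 0)}"

definition bergman_proj ::
  "(complex \<times> complex) set \<Rightarrow> (complex \<times> complex \<Rightarrow> complex) \<Rightarrow> (complex \<times> complex \<Rightarrow> complex)"
where
  "bergman_proj U g = (THE h. h \<in> bergman_space U \<and>
     (\<forall>k\<in>bergman_space U. L2_inner_on U (\<lambda>z. g z - h z) k = 0))"

definition hankel ::
  "(complex \<times> complex) set \<Rightarrow> (complex \<times> complex \<Rightarrow> complex) \<Rightarrow>
   (complex \<times> complex \<Rightarrow> complex) \<Rightarrow> (complex \<times> complex \<Rightarrow> complex)"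
where
  "hankel U \<phi> f = (\<lambda>z. \<phi> z * f z - bergman_proj U (\<lambda>w. \<phi> w * f w) z)"

definition bounded_linear_bergman ::
  "(complex \<times> complex) set \<Rightarrow> ((complex \<times> complex \<Rightarrow> complex) \<Rightarrow> (complex \<times> complex \<Rightarrow> complex)) \<Rightarrow> bool"
where
  "bounded_linear_bergman U T \<longleftrightarrow>
     (\<forall>f\<in>bergman_space U. T f \<in> L2_on U) \<and>
     (\<forall>f\<in>bergman_space U. \<forall>g\<in>bergman_space U.
        AE z in lebesgue_on U. T (\<lambda>w. f w + g w) z = T f z + T g z) \<and>
     (\<forall>c. \<forall>f\<in>bergman_space U. AE z in lebesgue_on U. T (\<lambda>w. c * f w) z = c * T f z) \<and>
     (\<exists>C. \<forall>f\<in>bergman_space U. L2_norm_on U (T f) \<le> C * L2_norm_on U f)"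

definition bergman_orthonormal_basis ::
  "(complex \<times> complex) set \<Rightarrow> (complex \<times> complex \<Rightarrow> complex) set \<Rightarrow> bool"
where
  "bergman_orthonormal_basis U B \<longleftrightarrow>
     B \<subseteq> bergman_space U \<and>
     (\<forall>\<xi>\<in>B. \<forall>\<eta>\<in>B. L2_inner_on U \<xi> \<eta> = (if \<xi> = \<eta> then 1 else 0)) \<and>
     (\<forall>f\<in>bergman_space U. \<forall>\<epsilon>>0. \<exists>S c. finite S \<and> S \<subseteq> B \<and>
        L2_norm_on U (\<lambda>z. f z - (\<Sum>\<xi>\<in>S. c \<xi> * \<xi> z)) < \<epsilon>)"

definition hilbert_schmidt_bergman ::
  "(complex \<times> complex) set \<Rightarrow> ((complex \<times> complex \<Rightarrow> complex) \<Rightarrow> (complex \<times> complex \<Rightarrow> complex)) \<Rightarrow> bool"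
where
  "hilbert_schmidt_bergman U T \<longleftrightarrow>
     bounded_linear_bergman U T \<and>
     (\<exists>B. bergman_orthonormal_basis U B \<and> (\<lambda>\<xi>. (L2_norm_on U (T \<xi>))\<^sup>2) summable_on B)"

definition set_X :: "(complex \<times> complex) set" where
  "set_X = {(z1, z2). norm z1 > 4 \<and> norm z2 < 1 / (2 * norm z1 * log 4 (norm z1))}"

definition set_Y :: "(complex \<times> complex) set" where
  "set_Y = {(z1, z2). norm z2 > 4 \<and> \<bar>norm z1 - 1 / norm z2\<bar> < 1 / norm z2 ^ 3}"

definition set_X' :: "(complex \<times> complex) set" where
  "set_X' = {(z1, z2). norm z1 > 4 \<and> \<bar>norm z2 - 1 / norm z1\<bar> < 1 / norm z1 ^ 3}"

definition set_Y' :: "(complex \<times> complex) set" where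
  "set_Y' = {(z1, z2). norm z2 > 4 \<and> norm z1 < 1 / (2 * norm z2 * log 4 (norm z2))}"

definition set_Z :: "(complex \<times> complex) set" where
  "set_Z = {(z1, z2). norm z1 \<le> 4 \<and> norm z2 \<le> 4}"

definition Omega :: "(complex \<times> complex) set" where
  "Omega = interior (set_X \<union> set_Y \<union> set_Z)"

definition Omega' :: "(complex \<times> complex) set" where
  "Omega' = interior (set_X' \<union> set_Y' \<union> set_Z)"

definition conj_symbol :: "complex \<times> complex \<Rightarrow> complex" where
  "conj_symbol = (\<lambda>(z1, z2). cnj z1 * cnj z2)"

end

theory Submission
  imports Defs "HOL-Complex_Analysis.Complex_Analysis"
begin

text \<open>
  All domains are Reinhardt, and the symbol is bounded by 16 on each of them. Torus means show that
  the Laurent coefficients of \<open>f\<close> in the Bergman space of \<open>Omega\<close> do not depend on the torus, and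
  that the coefficient of \<open>z1^n z2^m\<close> vanishes unless this monomial is square integrable on the
  tails of \<open>Omega\<close>. The tail \<open>set_X\<close> rules out \<open>n > m\<close> and the tail \<open>set_Y\<close> rules out
  \<open>m > n\<close>, so the Bergman space is spanned by the powers of \<open>w = z1 z2\<close>. Writing \<open>c k\<close> for the
  squared norm of \<open>w^k\<close>, the normalised \<open>w^k\<close> is mapped by the Hankel operator to a function of
  squared norm at most \<open>c (k+1) / c k - c k / c (k-1)\<close>; this telescopes, and the ratios
  \<open>c (k+1) / c k\<close> are at most \<open>16^2\<close>. Exchanging the coordinates turns \<open>Omega\<close> into \<open>Omega'\<close>.
  The tails of the two domains are disjoint, so \<open>Omega \<inter> Omega'\<close> is a bidisc. There \<open>z1^n\<close> is
  mapped to \<open>cnj z1 cnj z2 z1^n\<close>, whose norm is at least that of \<open>z1^n\<close>, so the operator is not even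
  compact.
\<close>

section \<open>Invariance of Lebesgue measure under linear isometries\<close>

text \<open>The widths of the tails are critical. Write \<open>z1^n z2^m\<close> as
  \<open>z1^(n-m) (z1 z2)^m\<close>. Over \<open>set_X\<close> the fibre at \<open>r = |z1|\<close>
  has area of order \<open>1/(r log r)^2\<close>, so for \<open>n = m \<ge> 0\<close> the squared
  monomial integrates like \<open>1/(r (log r)^(2n+2))\<close>: it converges thanks to the logarithm
  alone, and one more power of \<open>z1\<close> destroys this. Over \<open>set_Y\<close> the
  product stays near 1 and the fibre at \<open>s = |z2|\<close> has area of order
  \<open>s^(-4)\<close>, so the diagonal integrand is of order \<open>s^(-3)\<close>, and one more
  power of \<open>z2\<close> produces the harmonic \<open>1/s\<close>. Laurent coefficients are
  taken as torus means, so their independence of the torus is local constancy on a connected set;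
  negative powers force the axes out of the domain, at no cost since they are null. Rotations and
  the exchange of coordinates are linear isometries, whence the opening section. The definition of
  Hilbert-Schmidt asks for one suitable basis. The positive half may therefore choose normalised
  powers, but the negative half must refute every basis; compactness, which involves no choice of
  basis, does this.\<close>

lemma lborel_distr_uminus_euclidean:
  "distr lborel borel uminus = (lborel :: 'a::euclidean_space measure)"
  using lborel_affine[of "-1" "0 :: 'a"] by (simp add: density_1)

text \<open>The image measure \<open>\<mu>\<close> is translation invariant. Evaluating the double integral of
  \<open>indicator A x * indicator B (x + y)\<close> in both orders gives \<open>\<mu> A * lborel B = lborel A * \<mu> B\<close>, and the
  two measures agree on the unit ball \<open>B\<close>.\<close>

lemma lborel_distr_linear_isometry:
  fixes T :: "'a::euclidean_space \<Rightarrow> 'a"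
  assumes lin: "linear T" and iso: "\<And>x. norm (T x) = norm x"
  shows "distr lborel borel T = lborel"
proof -
  define \<mu> where "\<mu> = distr lborel borel T"
  have Tm[measurable]: "T \<in> borel_measurable borel"
    using lin linear_continuous_on linear_conv_bounded_linear
      borel_measurable_continuous_onI by blast
  have inj: "inj T"
    using lin iso by (metis linear_injective_0 norm_eq_zero)
  then have surj: "surj T" using lin linear_injective_imp_surjective by blast
  have sets[simp, measurable_cong]: "sets \<mu> = sets borel" and space[simp]: "space \<mu> = UNIV"
    by (simp_all add: \<mu>_def)
  have meas[simp]: "measurable \<mu> = measurable borel"
    by (rule ext, rule measurable_cong_sets) auto
  have emu: "emeasure \<mu> A = emeasure lborel (T -` A)" if "A \<in> sets borel" for A
    unfolding \<mu>_def using that by (simp add: emeasure_distr)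
  have trans: "distr \<mu> borel (\<lambda>x. c + x) = \<mu>" for c
  proof -
    obtain d where d: "T d = c" using surj by (metis surjD)
    have "distr \<mu> borel (\<lambda>x. c + x) = distr lborel borel (\<lambda>x. c + T x)"
      unfolding \<mu>_def by (subst distr_distr) (auto simp: o_def)
    also have "(\<lambda>x. c + T x) = T \<circ> (\<lambda>x. d + x)"
      using d lin by (auto simp: linear_add)
    also have "distr lborel borel (T \<circ> (\<lambda>x. d + x)) = distr (distr lborel borel (\<lambda>x. d + x)) borel T"
      by (subst distr_distr) auto
    also have "distr lborel borel (\<lambda>x. d + x) = (lborel :: 'a measure)"
      using lborel_distr_plus[of d] by simp
    finally show ?thesis unfolding \<mu>_def .
  qed
  \<comment> \<open>Balls about 0 are their own preimages. This yields both sigma-finiteness of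
    \<open>\<mu>\<close> and its normalisation on the unit ball.\<close>
  have preball: "T -` ball 0 r = ball 0 r" for r
    by (auto simp: iso)
  have sf: "sigma_finite_measure \<mu>"
  proof
    show "\<exists>A. countable A \<and> A \<subseteq> sets \<mu> \<and> \<Union> A = space \<mu> \<and> (\<forall>a\<in>A. emeasure \<mu> a \<noteq> \<infinity>)"
    proof (intro exI[of _ "range (\<lambda>n::nat. ball 0 (real n))"] conjI ballI)
      show "\<Union> (range (\<lambda>n::nat. ball 0 (real n))) = space \<mu>"
        by (auto simp: reals_Archimedean2)
    next
      fix a assume "a \<in> range (\<lambda>n::nat. ball 0 (real n) :: 'a set)"
      then obtain n where "a = ball 0 (real n)" by auto
      then have "emeasure \<mu> a = emeasure lborel (ball (0 :: 'a) (real n))" by (simp add: emu preball)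
      then show "emeasure \<mu> a \<noteq> \<infinity>"
        using emeasure_lborel_ball_finite[of "0 :: 'a" "real n"] by simp
    qed auto
  qed
  interpret sf: sigma_finite_measure \<mu> by fact
  interpret pair_sigma_finite \<mu> lborel ..
  show ?thesis
    unfolding \<mu>_def[symmetric]
  proof (rule measure_eqI)
    fix A assume "A \<in> sets \<mu>"
    then have A[measurable]: "A \<in> sets borel" by simp
    define B where "B = ball (0::'a) 1"
    have B[measurable]: "B \<in> sets borel" by (simp add: B_def)
    have eqB: "emeasure \<mu> B = emeasure lborel B" by (simp add: B_def emu preball)
    have "(\<integral>\<^sup>+y. \<integral>\<^sup>+x. indicator A x * indicator B (x + y) \<partial>\<mu> \<partial>lborel)
        = (\<integral>\<^sup>+x. \<integral>\<^sup>+y. indicator A x * indicator B (x + y) \<partial>lborel \<partial>\<mu>)"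
      by (rule Fubini') measurable
    also have "\<dots> = (\<integral>\<^sup>+x. indicator A x * emeasure lborel B \<partial>\<mu>)"
    proof (rule nn_integral_cong)
      fix x
      have "(\<integral>\<^sup>+y. indicator A x * indicator B (x + y) \<partial>lborel)
          = indicator A x * (\<integral>\<^sup>+y. indicator B (x + y) \<partial>lborel)"
        by (subst nn_integral_cmult) auto
      also have "(\<integral>\<^sup>+y. indicator B (x + y) \<partial>lborel) = (\<integral>\<^sup>+y. indicator B y \<partial>distr lborel borel ((+) x))"
        by (subst nn_integral_distr) auto
      also have "\<dots> = emeasure lborel B" by (simp add: lborel_distr_plus)
      finally show "(\<integral>\<^sup>+y. indicator A x * indicator B (x + y) \<partial>lborel) = indicator A x * emeasure lborel B" .
    qed
    also have "\<dots> = emeasure \<mu> A * emeasure lborel B"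
      by (subst nn_integral_multc) auto
    finally have 1: "(\<integral>\<^sup>+y. \<integral>\<^sup>+x. indicator A x * indicator B (x + y) \<partial>\<mu> \<partial>lborel)
      = emeasure \<mu> A * emeasure lborel B" .
    have "(\<integral>\<^sup>+y. \<integral>\<^sup>+x. indicator A x * indicator B (x + y) \<partial>\<mu> \<partial>lborel)
        = (\<integral>\<^sup>+y. \<integral>\<^sup>+x. indicator A (x - y) * indicator B x \<partial>\<mu> \<partial>lborel)"
    proof (rule nn_integral_cong)
      fix y
      have "(\<integral>\<^sup>+x. indicator A x * indicator B (x + y) \<partial>\<mu>)
          = (\<integral>\<^sup>+x. indicator A x * indicator B (x + y) \<partial>(distr \<mu> borel (\<lambda>x. - y + x)))"
        by (simp only: trans)
      also have "\<dots> = (\<integral>\<^sup>+x. indicator A (x - y) * indicator B x \<partial>\<mu>)"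
        by (subst nn_integral_distr) (auto simp: algebra_simps)
      finally show "(\<integral>\<^sup>+x. indicator A x * indicator B (x + y) \<partial>\<mu>)
          = (\<integral>\<^sup>+x. indicator A (x - y) * indicator B x \<partial>\<mu>)" .
    qed
    also have "\<dots> = (\<integral>\<^sup>+x. \<integral>\<^sup>+y. indicator A (x - y) * indicator B x \<partial>lborel \<partial>\<mu>)"
      by (rule Fubini') measurable
    also have "\<dots> = (\<integral>\<^sup>+x. emeasure lborel A * indicator B x \<partial>\<mu>)"
    proof (rule nn_integral_cong)
      fix x
      have "(\<integral>\<^sup>+y. indicator A (x - y) * indicator B x \<partial>lborel)
          = (\<integral>\<^sup>+y. indicator A (x - y) \<partial>lborel) * indicator B x"
        by (subst nn_integral_multc) auto
      also have "(\<integral>\<^sup>+y. indicator A (x - y) \<partial>lborel) = (\<integral>\<^sup>+y. indicator A (x + y) \<partial>distr lborel borel uminus)"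
        by (subst nn_integral_distr) auto
      also have "\<dots> = (\<integral>\<^sup>+y. indicator A y \<partial>distr lborel borel ((+) x))"
        by (subst nn_integral_distr) (auto simp: lborel_distr_uminus_euclidean)
      also have "\<dots> = emeasure lborel A" by (simp add: lborel_distr_plus)
      finally show "(\<integral>\<^sup>+y. indicator A (x - y) * indicator B x \<partial>lborel) = emeasure lborel A * indicator B x" .
    qed
    also have "\<dots> = emeasure lborel A * emeasure lborel B"
      by (subst nn_integral_cmult) (auto simp: eqB)
    finally have "emeasure \<mu> A * emeasure lborel B = emeasure lborel A * emeasure lborel B"
      using 1 by simp
    moreover have "emeasure lborel B \<noteq> 0" "emeasure lborel B \<noteq> top"
      using emeasure_lborel_ball_finite[of "0::'a" 1] content_ball_pos[of 1 "0::'a"]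
      by (auto simp: B_def measure_def)
    ultimately show "emeasure \<mu> A = emeasure lborel A"
      by (metis ennreal_mult_cancel_left mult.commute)
  qed simp
qed

section \<open>Inner product and norm on square-integrable functions\<close>

lemma L2_norm_nonneg [simp]: "0 \<le> L2_norm_on U f"
  unfolding L2_norm_on_def by (simp add: integral_nonneg_AE)

lemma L2_norm_sq: "(L2_norm_on U f)\<^sup>2 = (\<integral>z. (norm (f z))\<^sup>2 \<partial>(lebesgue_on U))"
  unfolding L2_norm_on_def by (simp add: integral_nonneg_AE)

lemma L2_inner_self: "L2_inner_on U f f = of_real ((L2_norm_on U f)\<^sup>2)"
proof -
  have "L2_inner_on U f f = (\<integral>z. complex_of_real ((norm (f z))\<^sup>2) \<partial>(lebesgue_on U))"
    unfolding L2_inner_on_def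
    by (intro Bochner_Integration.integral_cong refl) (simp only: complex_norm_square)
  then show ?thesis
    by (simp only: L2_norm_sq integral_complex_of_real)
qed

lemma L2_onD:
  assumes "f \<in> L2_on U"
  shows "f \<in> borel_measurable (lebesgue_on U)" "integrable (lebesgue_on U) (\<lambda>z. (norm (f z))\<^sup>2)"
  using assms by (auto simp: L2_on_def)

lemma L2_onI_bound:
  assumes "f \<in> borel_measurable (lebesgue_on U)" "integrable (lebesgue_on U) g"
    and "\<And>z. z \<in> U \<Longrightarrow> (norm (f z))\<^sup>2 \<le> g z"
  shows "f \<in> L2_on U"
  unfolding L2_on_def
proof (safe intro!: assms(1))
  show "integrable (lebesgue_on U) (\<lambda>z. (norm (f z))\<^sup>2)"
  proof (rule Bochner_Integration.integrable_bound[OF assms(2)])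
    show "(\<lambda>z. (norm (f z))\<^sup>2) \<in> borel_measurable (lebesgue_on U)" using assms(1) by measurable
    have "norm ((norm (f z))\<^sup>2) \<le> norm (g z)" if "z \<in> U" for z
      using assms(3)[OF that] by simp
    then show "AE z in lebesgue_on U. norm ((norm (f z))\<^sup>2) \<le> norm (g z)"
      by (intro AE_I2) (auto simp: space_restrict_space)
  qed
qed

lemma L2_on_zero: "(\<lambda>z. 0) \<in> L2_on U"
  by (simp add: L2_on_def)

lemma L2_on_scale:
  assumes "f \<in> L2_on U" shows "(\<lambda>z. c * f z) \<in> L2_on U"
proof (rule L2_onI_bound)
  show "(\<lambda>z. c * f z) \<in> borel_measurable (lebesgue_on U)" using L2_onD[OF assms] by measurable
  show "integrable (lebesgue_on U) (\<lambda>z. (norm c)\<^sup>2 * (norm (f z))\<^sup>2)" using L2_onD[OF assms] by simp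
qed (simp add: norm_mult power_mult_distrib)

lemma L2_on_add:
  assumes "f \<in> L2_on U" "g \<in> L2_on U" shows "(\<lambda>z. f z + g z) \<in> L2_on U"
proof (rule L2_onI_bound)
  show "(\<lambda>z. f z + g z) \<in> borel_measurable (lebesgue_on U)"
    using L2_onD[OF assms(1)] L2_onD[OF assms(2)] by measurable
  show "integrable (lebesgue_on U) (\<lambda>z. 2 * (norm (f z))\<^sup>2 + 2 * (norm (g z))\<^sup>2)"
    using L2_onD[OF assms(1)] L2_onD[OF assms(2)] by simp
  fix z
  have "(norm (f z + g z))\<^sup>2 \<le> (norm (f z) + norm (g z))\<^sup>2"
    by (intro power_mono norm_triangle_ineq) auto
  also have "\<dots> \<le> 2 * (norm (f z))\<^sup>2 + 2 * (norm (g z))\<^sup>2"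
    using zero_le_power2[of "norm (f z) - norm (g z)"] by (simp add: power2_eq_square algebra_simps)
  finally show "(norm (f z + g z))\<^sup>2 \<le> 2 * (norm (f z))\<^sup>2 + 2 * (norm (g z))\<^sup>2" .
qed

lemma L2_on_diff:
  assumes "f \<in> L2_on U" "g \<in> L2_on U" shows "(\<lambda>z. f z - g z) \<in> L2_on U"
  using L2_on_add[OF assms(1) L2_on_scale[OF assms(2), of "-1"]] by simp

lemma L2_on_sum:
  assumes "\<And>i. i \<in> S \<Longrightarrow> f i \<in> L2_on U"
  shows "(\<lambda>z. \<Sum>i\<in>S. f i z) \<in> L2_on U"
  using assms
proof (induction S rule: infinite_finite_induct)
  case (insert x F)
  then show ?case using L2_on_add[of "f x" U "\<lambda>z. \<Sum>i\<in>F. f i z"] by simp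
qed (auto simp: L2_on_zero)

lemma L2_on_mult_bounded:
  assumes "f \<in> L2_on U" "\<phi> \<in> borel_measurable (lebesgue_on U)" "\<And>z. z \<in> U \<Longrightarrow> norm (\<phi> z) \<le> C"
  shows "(\<lambda>z. \<phi> z * f z) \<in> L2_on U"
proof (rule L2_onI_bound)
  show "(\<lambda>z. \<phi> z * f z) \<in> borel_measurable (lebesgue_on U)" using L2_onD[OF assms(1)] assms(2) by measurable
  show "integrable (lebesgue_on U) (\<lambda>z. C\<^sup>2 * (norm (f z))\<^sup>2)" using L2_onD[OF assms(1)] by simp
  show "(norm (\<phi> z * f z))\<^sup>2 \<le> C\<^sup>2 * (norm (f z))\<^sup>2" if "z \<in> U" for z
    using assms(3)[OF that] by (simp add: norm_mult power_mult_distrib mult_right_mono power_mono)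
qed

lemma L2_norm_mult_bounded:
  assumes "f \<in> L2_on U" "\<phi> \<in> borel_measurable (lebesgue_on U)"
    and C: "\<And>z. z \<in> U \<Longrightarrow> norm (\<phi> z) \<le> C" "C \<ge> 0"
  shows "L2_norm_on U (\<lambda>z. \<phi> z * f z) \<le> C * L2_norm_on U f"
proof (rule power2_le_imp_le)
  have "(L2_norm_on U (\<lambda>z. \<phi> z * f z))\<^sup>2 \<le> (\<integral>z. C\<^sup>2 * (norm (f z))\<^sup>2 \<partial>(lebesgue_on U))"
    unfolding L2_norm_sq
  proof (rule integral_mono)
    show "integrable (lebesgue_on U) (\<lambda>z. (norm (\<phi> z * f z))\<^sup>2)"
      using L2_on_mult_bounded[OF assms(1-3)] L2_onD by blast
    show "integrable (lebesgue_on U) (\<lambda>z. C\<^sup>2 * (norm (f z))\<^sup>2)" using L2_onD[OF assms(1)] by simp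
    show "(norm (\<phi> z * f z))\<^sup>2 \<le> C\<^sup>2 * (norm (f z))\<^sup>2" if "z \<in> space (lebesgue_on U)" for z
      using C(1)[of z] that by (simp add: norm_mult power_mult_distrib mult_right_mono power_mono space_restrict_space)
  qed
  also have "\<dots> = (C * L2_norm_on U f)\<^sup>2" by (simp add: L2_norm_sq power_mult_distrib)
  finally show "(L2_norm_on U (\<lambda>z. \<phi> z * f z))\<^sup>2 \<le> (C * L2_norm_on U f)\<^sup>2" .
qed (use C(2) in simp)

lemma L2_on_cnj: "f \<in> L2_on U \<Longrightarrow> (\<lambda>z. cnj (f z)) \<in> L2_on U"
  unfolding L2_on_def
  using borel_measurable_continuous_onI[of cnj] continuous_on_cnj[OF continuous_on_id]
  by (auto intro: measurable_compose[of f])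

lemma L2_integrable_mult:
  assumes "f \<in> L2_on U" "g \<in> L2_on U"
  shows "integrable (lebesgue_on U) (\<lambda>z. f z * g z)"
proof (rule Bochner_Integration.integrable_bound)
  show "(\<lambda>z. f z * g z) \<in> borel_measurable (lebesgue_on U)"
    using L2_onD[OF assms(1)] L2_onD[OF assms(2)] by measurable
  show "integrable (lebesgue_on U) (\<lambda>z. (norm (f z))\<^sup>2 + (norm (g z))\<^sup>2)"
    using L2_onD[OF assms(1)] L2_onD[OF assms(2)] by simp
  have "norm (f z * g z) \<le> norm ((norm (f z))\<^sup>2 + (norm (g z))\<^sup>2)" for z
    using sum_squares_bound[of "norm (f z)" "norm (g z)"]
      mult_nonneg_nonneg[OF norm_ge_zero[of "f z"] norm_ge_zero[of "g z"]]
    unfolding norm_mult real_norm_def by linarith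
  then show "AE z in lebesgue_on U. norm (f z * g z) \<le> norm ((norm (f z))\<^sup>2 + (norm (g z))\<^sup>2)"
    by simp
qed

lemma L2_inner_integrable:
  assumes "f \<in> L2_on U" "g \<in> L2_on U"
  shows "integrable (lebesgue_on U) (\<lambda>z. f z * cnj (g z))"
  using L2_integrable_mult[OF assms(1) L2_on_cnj[OF assms(2)]] .

lemma L2_inner_add_left:
  assumes "f \<in> L2_on U" "g \<in> L2_on U" "h \<in> L2_on U"
  shows "L2_inner_on U (\<lambda>z. f z + g z) h = L2_inner_on U f h + L2_inner_on U g h"
  unfolding L2_inner_on_def
  using L2_inner_integrable[OF assms(1,3)] L2_inner_integrable[OF assms(2,3)]
  by (simp add: distrib_right)

lemma L2_inner_diff_left:
  assumes "f \<in> L2_on U" "g \<in> L2_on U" "h \<in> L2_on U"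
  shows "L2_inner_on U (\<lambda>z. f z - g z) h = L2_inner_on U f h - L2_inner_on U g h"
  unfolding L2_inner_on_def
  using L2_inner_integrable[OF assms(1,3)] L2_inner_integrable[OF assms(2,3)]
  by (simp add: left_diff_distrib)

lemma L2_inner_scale_left: "L2_inner_on U (\<lambda>z. c * f z) h = c * L2_inner_on U f h"
  unfolding L2_inner_on_def by (simp add: mult.assoc)

lemma L2_inner_cnj: "L2_inner_on U g f = cnj (L2_inner_on U f g)"
proof -
  have "cnj (L2_inner_on U f g) = (\<integral>z. cnj (f z * cnj (g z)) \<partial>(lebesgue_on U))"
    unfolding L2_inner_on_def by (simp only: Bochner_Integration.integral_cnj)
  then show ?thesis unfolding L2_inner_on_def by (simp add: mult.commute)
qed

lemma L2_inner_scale_right: "L2_inner_on U f (\<lambda>z. c * h z) = cnj c * L2_inner_on U f h"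
  by (metis L2_inner_cnj L2_inner_scale_left complex_cnj_mult)

lemma L2_inner_add_right:
  assumes "f \<in> L2_on U" "g \<in> L2_on U" "h \<in> L2_on U"
  shows "L2_inner_on U h (\<lambda>z. f z + g z) = L2_inner_on U h f + L2_inner_on U h g"
  using L2_inner_add_left[OF assms] by (metis L2_inner_cnj complex_cnj_add)

lemma L2_inner_sum_left:
  assumes "\<And>i. i \<in> S \<Longrightarrow> f i \<in> L2_on U" "h \<in> L2_on U"
  shows "L2_inner_on U (\<lambda>z. \<Sum>i\<in>S. f i z) h = (\<Sum>i\<in>S. L2_inner_on U (f i) h)"
  unfolding L2_inner_on_def sum_distrib_right
  by (rule Bochner_Integration.integral_sum) (use assms L2_inner_integrable in blast)

lemma L2_inner_sum_right:
  assumes "\<And>i. i \<in> S \<Longrightarrow> f i \<in> L2_on U" "h \<in> L2_on U"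
  shows "L2_inner_on U h (\<lambda>z. \<Sum>i\<in>S. f i z) = (\<Sum>i\<in>S. L2_inner_on U h (f i))"
  by (simp only: L2_inner_cnj[of U h] L2_inner_sum_left[of S f U h, OF assms] cnj_sum)

lemma L2_norm_scale: "L2_norm_on U (\<lambda>z. c * f z) = norm c * L2_norm_on U f"
  unfolding L2_norm_on_def by (simp add: norm_mult power_mult_distrib real_sqrt_mult)

lemma L2_norm_diff_commute: "L2_norm_on U (\<lambda>z. f z - g z) = L2_norm_on U (\<lambda>z. g z - f z)"
  unfolding L2_norm_on_def by (simp add: norm_minus_commute)

lemma L2_norm_add_sq:
  assumes "f \<in> L2_on U" "g \<in> L2_on U"
  shows "(L2_norm_on U (\<lambda>z. f z + g z))\<^sup>2
    = (L2_norm_on U f)\<^sup>2 + 2 * Re (L2_inner_on U f g) + (L2_norm_on U g)\<^sup>2"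
proof -
  have "complex_of_real ((L2_norm_on U (\<lambda>z. f z + g z))\<^sup>2)
    = L2_inner_on U (\<lambda>z. f z + g z) (\<lambda>z. f z + g z)"
    by (simp add: L2_inner_self)
  also have "\<dots> = L2_inner_on U f f + (L2_inner_on U f g + L2_inner_on U g f) + L2_inner_on U g g"
    using assms by (simp add: L2_inner_add_left L2_inner_add_right L2_on_add)
  also have "L2_inner_on U f g + L2_inner_on U g f = of_real (2 * Re (L2_inner_on U f g))"
    by (subst L2_inner_cnj[of U g f]) (simp add: complex_add_cnj)
  finally show ?thesis
    unfolding L2_inner_self of_real_add[symmetric] of_real_eq_iff by simp
qed

lemma L2_norm_diff_sq:
  assumes "f \<in> L2_on U" "g \<in> L2_on U"
  shows "(L2_norm_on U (\<lambda>z. f z - g z))\<^sup>2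
    = (L2_norm_on U f)\<^sup>2 - 2 * Re (L2_inner_on U f g) + (L2_norm_on U g)\<^sup>2"
  using L2_norm_add_sq[OF assms(1) L2_on_scale[OF assms(2), of "-1"]]
  by (simp only: L2_inner_scale_right L2_norm_scale) simp

lemma L2_norm_cong: "(\<And>z. z \<in> U \<Longrightarrow> f z = g z) \<Longrightarrow> L2_norm_on U f = L2_norm_on U g"
  unfolding L2_norm_on_def
  by (intro arg_cong[where f=sqrt] Bochner_Integration.integral_cong) (auto simp: space_restrict_space)

lemma L2_norm_zero_AE:
  assumes "f \<in> L2_on U" "L2_norm_on U f = 0"
  shows "AE z in lebesgue_on U. f z = 0"
proof -
  have "(\<integral>z. (norm (f z))\<^sup>2 \<partial>(lebesgue_on U)) = 0" using assms(2) by (metis L2_norm_sq zero_power2)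
  then have "AE z in lebesgue_on U. (norm (f z))\<^sup>2 = 0"
    using integral_nonneg_eq_0_iff_AE[OF L2_onD(2)[OF assms(1)]] by simp
  then show ?thesis by simp
qed

lemma L2_Cauchy_Schwarz:
  assumes f: "f \<in> L2_on U" and g: "g \<in> L2_on U"
  shows "norm (L2_inner_on U f g) \<le> L2_norm_on U f * L2_norm_on U g"
proof (cases "L2_norm_on U g = 0")
  case True
  have "AE z in lebesgue_on U. f z * cnj (g z) = 0"
    using L2_norm_zero_AE[OF g True] by auto
  then have "L2_inner_on U f g = 0"
    unfolding L2_inner_on_def by (rule integral_eq_zero_AE)
  then show ?thesis by simp
next
  case False
  define n where "n = L2_norm_on U g"
  define a where "a = L2_inner_on U f g"
  \<comment> \<open>\<open>c * g\<close> is the orthogonal projection of \<open>f\<close> onto the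
    line of \<open>g\<close>; that the squared distance to it is nonnegative is the
    inequality.\<close>
  define c where "c = a / of_real (n\<^sup>2)"
  have n: "n > 0" using False L2_norm_nonneg[of U g] unfolding n_def by linarith
  have "0 \<le> (L2_norm_on U (\<lambda>z. f z - c * g z))\<^sup>2" by simp
  also have "\<dots> = (L2_norm_on U f)\<^sup>2 - 2 * Re (cnj c * a) + (norm c * n)\<^sup>2"
    using L2_norm_diff_sq[OF f L2_on_scale[OF g, of c]]
    by (simp add: L2_inner_scale_right L2_norm_scale n_def a_def)
  also have "cnj c * a = of_real ((norm a)\<^sup>2 / n\<^sup>2)"
    unfolding c_def using complex_norm_square[of a] by (simp add: mult.commute)
  also have "(norm c * n)\<^sup>2 = (norm a)\<^sup>2 / n\<^sup>2"
    using n by (simp add: c_def norm_divide power_mult_distrib power_divide field_simps norm_power)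
  finally have "(norm a)\<^sup>2 / n\<^sup>2 \<le> (L2_norm_on U f)\<^sup>2" by simp
  then have "(norm a)\<^sup>2 \<le> (L2_norm_on U f * n)\<^sup>2"
    using n by (simp add: field_simps power_mult_distrib)
  then show ?thesis
    unfolding a_def n_def by (rule power2_le_imp_le) simp
qed

lemma L2_norm_triangle:
  assumes f: "f \<in> L2_on U" and g: "g \<in> L2_on U"
  shows "L2_norm_on U (\<lambda>z. f z + g z) \<le> L2_norm_on U f + L2_norm_on U g"
proof (rule power2_le_imp_le)
  have "Re (L2_inner_on U f g) \<le> L2_norm_on U f * L2_norm_on U g"
    using L2_Cauchy_Schwarz[OF f g] complex_Re_le_cmod order_trans by blast
  then show "(L2_norm_on U (\<lambda>z. f z + g z))\<^sup>2 \<le> (L2_norm_on U f + L2_norm_on U g)\<^sup>2"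
    unfolding L2_norm_add_sq[OF f g] by (simp add: power2_eq_square algebra_simps)
qed simp

lemma L2_norm_triangle_diff:
  assumes f: "f \<in> L2_on U" and g: "g \<in> L2_on U" and h: "h \<in> L2_on U"
  shows "L2_norm_on U (\<lambda>z. f z - h z) \<le> L2_norm_on U (\<lambda>z. f z - g z) + L2_norm_on U (\<lambda>z. g z - h z)"
  using L2_norm_triangle[OF L2_on_diff[OF f g] L2_on_diff[OF g h]] by simp

lemma L2_norm_sum_le:
  assumes "\<And>i. i \<in> S \<Longrightarrow> f i \<in> L2_on U"
  shows "L2_norm_on U (\<lambda>z. \<Sum>i\<in>S. f i z) \<le> (\<Sum>i\<in>S. L2_norm_on U (f i))"
  using assms
proof (induction S rule: infinite_finite_induct)
  case (insert x F)
  then show ?case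
    using L2_norm_triangle[of "f x" U "\<lambda>z. \<Sum>i\<in>F. f i z"] L2_on_sum[of F f U] by simp
qed (auto simp: L2_norm_on_def)

lemma L2_norm_orthogonal_sum_sq:
  assumes "finite S" "\<And>i. i \<in> S \<Longrightarrow> f i \<in> L2_on U"
    and "\<And>i j. i \<in> S \<Longrightarrow> j \<in> S \<Longrightarrow> L2_inner_on U (f i) (f j) = (if i = j then 1 else 0)"
  shows "(L2_norm_on U (\<lambda>z. \<Sum>i\<in>S. c i * f i z))\<^sup>2 = (\<Sum>i\<in>S. (norm (c i))\<^sup>2)"
proof -
  have L: "(\<lambda>z. c i * f i z) \<in> L2_on U" if "i \<in> S" for i using that assms(2) L2_on_scale by blast
  have "complex_of_real ((L2_norm_on U (\<lambda>z. \<Sum>i\<in>S. c i * f i z))\<^sup>2)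
    = L2_inner_on U (\<lambda>z. \<Sum>i\<in>S. c i * f i z) (\<lambda>z. \<Sum>i\<in>S. c i * f i z)" by (simp add: L2_inner_self)
  also have "\<dots> = (\<Sum>i\<in>S. L2_inner_on U (\<lambda>z. c i * f i z) (\<lambda>z. \<Sum>i\<in>S. c i * f i z))"
    by (rule L2_inner_sum_left[OF L L2_on_sum[OF L]])
  also have "\<dots> = (\<Sum>i\<in>S. \<Sum>j\<in>S. L2_inner_on U (\<lambda>z. c i * f i z) (\<lambda>z. c j * f j z))"
    by (intro sum.cong refl L2_inner_sum_right L)
  also have "\<dots> = (\<Sum>i\<in>S. \<Sum>j\<in>S. if i = j then c i * cnj (c i) else 0)"
    using assms(3) by (intro sum.cong refl) (simp add: L2_inner_scale_left L2_inner_scale_right)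
  also have "\<dots> = of_real (\<Sum>i\<in>S. (norm (c i))\<^sup>2)"
    using assms(1) by (simp only: sum.delta' sum.delta of_real_sum complex_norm_square if_True cong: if_cong sum.cong)
  finally show ?thesis unfolding of_real_eq_iff .
qed

text \<open>Completing the square in each coefficient: the choice
  \<open>c i = L2_inner_on U f (e i)\<close> is optimal. That choice gives Bessel's inequality,
  while a general \<open>c\<close> shows that passing from any approximant to the Fourier sum does
  not increase the error.\<close>

lemma L2_orthonormal_residual_sq:
  assumes "finite S" "\<And>i. i \<in> S \<Longrightarrow> e i \<in> L2_on U" "f \<in> L2_on U"
    and "\<And>i j. i \<in> S \<Longrightarrow> j \<in> S \<Longrightarrow> L2_inner_on U (e i) (e j) = (if i = j then 1 else 0)"
  shows "(L2_norm_on U (\<lambda>z. f z - (\<Sum>i\<in>S. c i * e i z)))\<^sup>2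
    = (L2_norm_on U f)\<^sup>2 - (\<Sum>i\<in>S. (norm (L2_inner_on U f (e i)))\<^sup>2)
      + (\<Sum>i\<in>S. (norm (L2_inner_on U f (e i) - c i))\<^sup>2)"
proof -
  have L: "(\<lambda>z. c i * e i z) \<in> L2_on U" if "i \<in> S" for i using that assms(2) L2_on_scale by blast
  have "L2_inner_on U f (\<lambda>z. \<Sum>i\<in>S. c i * e i z) = (\<Sum>i\<in>S. cnj (c i) * L2_inner_on U f (e i))"
    using L2_inner_sum_right[OF L assms(3)] by (simp add: L2_inner_scale_right)
  then have "(L2_norm_on U (\<lambda>z. f z - (\<Sum>i\<in>S. c i * e i z)))\<^sup>2
    = (L2_norm_on U f)\<^sup>2 - 2 * Re (\<Sum>i\<in>S. cnj (c i) * L2_inner_on U f (e i)) + (\<Sum>i\<in>S. (norm (c i))\<^sup>2)"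
    using L2_norm_diff_sq[OF assms(3) L2_on_sum[of S "\<lambda>i z. c i * e i z", OF L]]
      L2_norm_orthogonal_sum_sq[of S e U c, OF assms(1,2,4)] by simp
  moreover
  have "(norm (L2_inner_on U f (e i) - c i))\<^sup>2 = (norm (L2_inner_on U f (e i)))\<^sup>2
     - 2 * Re (cnj (c i) * L2_inner_on U f (e i)) + (norm (c i))\<^sup>2" for i
    unfolding cmod_power2 minus_complex.sel times_complex.sel complex_cnj power2_diff by simp
  then have "(\<Sum>i\<in>S. (norm (L2_inner_on U f (e i) - c i))\<^sup>2) = (\<Sum>i\<in>S. (norm (L2_inner_on U f (e i)))\<^sup>2)
     - 2 * Re (\<Sum>i\<in>S. cnj (c i) * L2_inner_on U f (e i)) + (\<Sum>i\<in>S. (norm (c i))\<^sup>2)"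
    by (simp only: sum.distrib sum_subtractf sum_distrib_left Re_sum)
  ultimately show ?thesis by linarith
qed

lemma L2_Bessel:
  assumes "finite S" "\<And>i. i \<in> S \<Longrightarrow> e i \<in> L2_on U" "f \<in> L2_on U"
    and "\<And>i j. i \<in> S \<Longrightarrow> j \<in> S \<Longrightarrow> L2_inner_on U (e i) (e j) = (if i = j then 1 else 0)"
  shows "(\<Sum>i\<in>S. (norm (L2_inner_on U f (e i)))\<^sup>2) \<le> (L2_norm_on U f)\<^sup>2"
proof -
  have "0 \<le> (L2_norm_on U (\<lambda>z. f z - (\<Sum>i\<in>S. L2_inner_on U f (e i) * e i z)))\<^sup>2" by simp
  also have "\<dots> = (L2_norm_on U f)\<^sup>2 - (\<Sum>i\<in>S. (norm (L2_inner_on U f (e i)))\<^sup>2)"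
    using L2_orthonormal_residual_sq[of S e U f "\<lambda>i. L2_inner_on U f (e i)", OF assms]
    by simp
  finally show ?thesis by simp
qed

section \<open>Torus means of holomorphic functions\<close>

definition rot :: "complex \<times> complex \<Rightarrow> complex \<times> complex \<Rightarrow> complex \<times> complex" where
  "rot u z = (fst u * fst z, snd u * snd z)"

definition reinhardt :: "(complex \<times> complex) set \<Rightarrow> bool" where
  "reinhardt W \<longleftrightarrow> (\<forall>u z. z \<in> W \<longrightarrow> norm (fst u) = 1 \<longrightarrow> norm (snd u) = 1 \<longrightarrow> rot u z \<in> W)"

definition circ :: "real \<Rightarrow> complex" where
  "circ s = cis (2 * pi * s)"

text \<open>Mean for the normalised Haar measure of the torus: with period 1 in each angle the
  parameter square has volume 1, so constants are their own means and Cauchy-Schwarz costs no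
  factor.\<close>

definition torus_mean :: "(complex \<times> complex \<Rightarrow> complex) \<Rightarrow> complex" where
  "torus_mean F = integral (cbox (0,0) (1,1)) (\<lambda>p. F (circ (fst p), circ (snd p)))"

lemma norm_circ [simp]: "norm (circ s) = 1"
  by (simp add: circ_def)

lemma circ_01 [simp]: "circ 0 = 1" "circ 1 = 1"
  by (simp_all add: circ_def cis.ctr complex_eq_iff)

lemma continuous_on_circ [continuous_intros]:
  "continuous_on S f \<Longrightarrow> continuous_on S (\<lambda>x. circ (f x))"
  unfolding circ_def by (intro continuous_intros)

lemma circ_has_vector_derivative [derivative_intros]:
  "(circ has_vector_derivative (2 * pi * \<i> * circ s)) (at s within A)"
proof -
  have eq: "circ = (\<lambda>s. exp (2 * pi * \<i> * complex_of_real s))"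
    by (auto simp: circ_def cis_conv_exp mult_ac)
  have "((\<lambda>z. exp (2 * pi * \<i> * z)) has_field_derivative (2 * pi * \<i> * exp (2 * pi * \<i> * complex_of_real s)))
      (at (complex_of_real s))"
    by (auto intro!: derivative_eq_intros)
  then show ?thesis
    unfolding eq by (rule has_vector_derivative_real_field)
qed

lemma integral_circ: "integral {0..1} circ = 0"
proof -
  have "((\<lambda>s. 2 * pi * \<i> * circ s) has_integral (circ 1 - circ 0)) {0..1}"
    by (rule fundamental_theorem_of_calculus[OF _ circ_has_vector_derivative]) simp
  then have "2 * pi * \<i> * integral {0..1} circ = 0"
    by (simp add: has_integral_iff)
  then show ?thesis by simp
qed

text \<open>Differentiating under the integral gives the mean of
  \<open>deriv g (circ s * x0) * circ s\<close>. Multiplied by \<open>2 * pi * \<i> * x0\<close>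
  this is the derivative in \<open>s\<close> of the 1-periodic function
  \<open>g (circ s * x0)\<close>, so it integrates to zero. \<open>W\<close> may be an
  annulus.\<close>

lemma circle_mean_has_derivative_zero:
  assumes W: "open W" "\<And>u z. norm u = 1 \<Longrightarrow> z \<in> W \<Longrightarrow> u * z \<in> W"
    and g: "g holomorphic_on W" and x0: "x0 \<in> W"
  shows "((\<lambda>x. integral {0..1} (\<lambda>s. g (circ s * x))) has_field_derivative 0) (at x0)"
proof -
  obtain e where e: "e > 0" "ball x0 e \<subseteq> W" using W x0 openE by blast
  let ?U = "ball x0 e"
  have in_W: "circ s * x \<in> W" if "x \<in> ?U" for s x
    using W(2) that e by auto
  have dg: "(g has_field_derivative deriv g z) (at z)" if "z \<in> W" for z
    using g that W(1) holomorphic_derivI by blast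
  have cg: "continuous_on W g" using g holomorphic_on_imp_continuous_on by blast
  have cdg: "continuous_on W (deriv g)"
    using holomorphic_deriv[OF g W(1)] holomorphic_on_imp_continuous_on by blast
  define D where "D = integral {0..1} (\<lambda>s. deriv g (circ s * x0) * circ s)"
  have "((\<lambda>x. integral (cbox 0 1) (\<lambda>s. g (circ s * x))) has_field_derivative
      integral (cbox 0 1) (\<lambda>s. deriv g (circ s * x0) * circ s)) (at x0 within ?U)"
  proof (rule leibniz_rule_field_derivative)
    fix x s assume "x \<in> ?U"
    then show "((\<lambda>x. g (circ s * x)) has_field_derivative deriv g (circ s * x) * circ s) (at x within ?U)"
      by (rule DERIV_chain2[where f = g and g = "\<lambda>x. circ s * x", OF dg[OF in_W] DERIV_cmult_Id])
  next
    fix x assume "x \<in> ?U"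
    then show "(\<lambda>s. g (circ s * x)) integrable_on cbox 0 1"
      by (intro integrable_continuous continuous_on_compose2[OF cg] continuous_on_mult
            continuous_on_circ continuous_on_const continuous_on_id) (auto intro: in_W)
  next
    show "continuous_on (?U \<times> cbox 0 1) (\<lambda>(x, s). deriv g (circ s * x) * circ s)"
      unfolding split_beta
      by (intro continuous_on_compose2[OF cdg] continuous_on_mult continuous_on_circ
            continuous_on_fst continuous_on_snd continuous_on_id) (auto intro: in_W)
  qed (use e in auto)
  then have 1: "((\<lambda>x. integral {0..1} (\<lambda>s. g (circ s * x))) has_field_derivative D) (at x0)"
    using e by (simp add: D_def at_within_open[of x0 ?U])
  have "D = 0"
  proof (cases "x0 = 0")
    \<comment> \<open>The factor \<open>x0\<close> cannot be cancelled at the origin, but there the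
      integrand is a constant times \<open>circ\<close>.\<close>
    case True
    then show ?thesis by (simp add: D_def integral_circ)
  next
    case False
    have "((\<lambda>s. (2 * pi * \<i> * x0) * (deriv g (circ s * x0) * circ s)) has_integral
        (g (circ 1 * x0) - g (circ 0 * x0))) {0..1}"
    proof (rule fundamental_theorem_of_calculus)
      fix s :: real
      have v: "((\<lambda>s. circ s * x0) has_vector_derivative (2 * pi * \<i> * circ s * x0)) (at s within {0..1})"
        using has_vector_derivative_mult_left[OF circ_has_vector_derivative] by blast
      have "circ s * x0 \<in> W" using in_W e by simp
      from field_vector_diff_chain_within[OF v, OF has_field_derivative_at_within[OF dg[OF this]]]
      show "((\<lambda>s. g (circ s * x0)) has_vector_derivative
          (2 * pi * \<i> * x0) * (deriv g (circ s * x0) * circ s)) (at s within {0..1})"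
        by (simp add: o_def mult_ac)
    qed simp
    then have "(2 * pi * \<i> * x0) * D = 0"
      unfolding D_def by (simp add: has_integral_iff del: mult_eq_0_iff)
    then show ?thesis using False by simp
  qed
  with 1 show ?thesis by simp
qed

text \<open>A vanishing derivative makes the mean locally constant; a connected set then carries the
  value from \<open>a\<close> to \<open>b\<close>.\<close>

lemma circle_mean_const:
  assumes W: "open W" "\<And>u z. norm u = 1 \<Longrightarrow> z \<in> W \<Longrightarrow> u * z \<in> W"
    and g: "g holomorphic_on W" and C: "connected C" "C \<subseteq> W" "a \<in> C" "b \<in> C"
  shows "integral {0..1} (\<lambda>s. g (circ s * a)) = integral {0..1} (\<lambda>s. g (circ s * b))"
proof (rule connected_local_const[OF C(1,3,4)], safe)
  fix x assume "x \<in> C"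
  then obtain e where e: "e > 0" "ball x e \<subseteq> W" using W C openE by blast
  have "integral {0..1} (\<lambda>s. g (circ s * x)) = integral {0..1} (\<lambda>s. g (circ s * y))" if "y \<in> ball x e" for y
  proof (rule has_field_derivative_zero_constant[THEN exE, of "ball x e" "\<lambda>x. integral {0..1} (\<lambda>s. g (circ s * x))"])
    show "((\<lambda>x. integral {0..1} (\<lambda>s. g (circ s * x))) has_field_derivative 0) (at z within ball x e)"
      if "z \<in> ball x e" for z
      using circle_mean_has_derivative_zero[OF W g] that e has_field_derivative_at_within by blast
  qed (use that e in auto)
  then show "eventually (\<lambda>y. integral {0..1} (\<lambda>s. g (circ s * x)) = integral {0..1} (\<lambda>s. g (circ s * y))) (at x within C)"
    unfolding eventually_at using e(1) by (metis dist_commute mem_ball)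
qed

section \<open>Slices and torus means for holomorphic functions of two variables\<close>

lemma holomorphic2_continuous_on:
  "holomorphic2_on f U \<Longrightarrow> continuous_on U f"
  unfolding holomorphic2_on_def
  by (meson continuous_at_imp_continuous_on has_derivative_continuous)

text \<open>The second conclusion ties the slice derivative to the coefficient of
  \<open>fst h\<close> in any total derivative; through it the one-variable Cauchy inequality later
  bounds these coefficients.\<close>

lemma holomorphic2_slice1:
  assumes "holomorphic2_on f U" "(z, w) \<in> U"
  obtains d where "((\<lambda>\<zeta>. f (\<zeta>, w)) has_field_derivative d) (at z)"
    "\<And>f'. (f has_derivative f') (at (z, w)) \<Longrightarrow> f' (1, 0) = d"
proof -
  obtain a b where ab: "(f has_derivative (\<lambda>h. a * fst h + b * snd h)) (at (z, w))"
    using assms unfolding holomorphic2_on_def by blast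
  have "((\<lambda>\<zeta>. (\<zeta>, w)) has_derivative (\<lambda>h. (h, 0))) (at z)"
    by (auto intro!: derivative_eq_intros)
  from has_derivative_compose[OF this, of f, OF ab]
  have "((\<lambda>\<zeta>. f (\<zeta>, w)) has_field_derivative a) (at z)"
    by (simp add: has_field_derivative_def)
  moreover have "f' (1, 0) = a" if "(f has_derivative f') (at (z, w))" for f'
    using has_derivative_unique[OF that ab] by simp
  ultimately show ?thesis using that by blast
qed

lemma holomorphic2_slice2:
  assumes "holomorphic2_on f U" "(z, w) \<in> U"
  obtains d where "((\<lambda>\<zeta>. f (z, \<zeta>)) has_field_derivative d) (at w)"
    "\<And>f'. (f has_derivative f') (at (z, w)) \<Longrightarrow> f' (0, 1) = d"
proof -
  obtain a b where ab: "(f has_derivative (\<lambda>h. a * fst h + b * snd h)) (at (z, w))"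
    using assms unfolding holomorphic2_on_def by blast
  have "((\<lambda>\<zeta>. (z, \<zeta>)) has_derivative (\<lambda>h. (0, h))) (at w)"
    by (auto intro!: derivative_eq_intros)
  from has_derivative_compose[OF this, of f, OF ab]
  have "((\<lambda>\<zeta>. f (z, \<zeta>)) has_field_derivative b) (at w)"
    by (simp add: has_field_derivative_def)
  moreover have "f' (0, 1) = b" if "(f has_derivative f') (at (z, w))" for f'
    using has_derivative_unique[OF that ab] by simp
  ultimately show ?thesis using that by blast
qed

lemma reinhardtD:
  "reinhardt W \<Longrightarrow> (z, w) \<in> W \<Longrightarrow> norm u = 1 \<Longrightarrow> norm v = 1 \<Longrightarrow> (u * z, v * w) \<in> W"
  unfolding reinhardt_def rot_def by force

lemma continuous_torus_fun:
  assumes "reinhardt W" "continuous_on W g" "z \<in> W"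
  shows "continuous_on S (\<lambda>p. g (rot (circ (fst p), circ (snd p)) z))"
  by (intro continuous_on_compose2[OF assms(2)])
    (use assms in \<open>auto simp: reinhardt_def rot_def intro!: continuous_intros\<close>)

text \<open>Fubini puts the circle of the moving coordinate innermost. For each fixed angle of the
  other coordinate the slice of \<open>W\<close> is open and circle invariant, so the one-variable
  result applies there.\<close>

lemma torus_mean_slice1:
  assumes W: "open W" "reinhardt W" and g: "holomorphic2_on g W"
    and C: "connected C" "a \<in> C" "b \<in> C" "\<And>z. z \<in> C \<Longrightarrow> (z, w) \<in> W"
  shows "torus_mean (\<lambda>u. g (rot u (a, w))) = torus_mean (\<lambda>u. g (rot u (b, w)))"
proof -
  have cont: "continuous_on W g" using g holomorphic2_continuous_on by blast
  have *: "torus_mean (\<lambda>u. g (rot u (z, w))) =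
      integral {0..1} (\<lambda>t. integral {0..1} (\<lambda>s. g (circ s * z, circ t * w)))" if "z \<in> C" for z
  proof -
    have c: "continuous_on (cbox (0, 0) (1, 1)) (\<lambda>(s, t). g (circ s * z, circ t * w))"
      using continuous_torus_fun[OF W(2) cont C(4)[OF that]] by (simp add: rot_def case_prod_unfold)
    have "torus_mean (\<lambda>u. g (rot u (z, w))) =
        integral {0..1} (\<lambda>s. integral {0..1} (\<lambda>t. g (circ s * z, circ t * w)))"
      using integral_prod_continuous[OF c] unfolding torus_mean_def rot_def by (simp add: case_prod_unfold)
    also have "\<dots> = integral {0..1} (\<lambda>t. integral {0..1} (\<lambda>s. g (circ s * z, circ t * w)))"
      using integral_swap_continuous[OF c] by simp
    finally show ?thesis .
  qed
  have "integral {0..1} (\<lambda>s. g (circ s * a, circ t * w)) = integral {0..1} (\<lambda>s. g (circ s * b, circ t * w))" for t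
  proof (rule circle_mean_const[of "{z. (z, circ t * w) \<in> W}" "\<lambda>z. g (z, circ t * w)" C])
    show "open {z. (z, circ t * w) \<in> W}"
      using open_vimage[OF W(1), of "\<lambda>z. (z, circ t * w)"]
      by (simp add: vimage_def continuous_on_Pair)
    show "u * z \<in> {z. (z, circ t * w) \<in> W}" if "norm u = 1" "z \<in> {z. (z, circ t * w) \<in> W}" for u z
      using reinhardtD[OF W(2), of z "circ t * w" u 1] that by simp
    show "(\<lambda>z. g (z, circ t * w)) holomorphic_on {z. (z, circ t * w) \<in> W}"
      unfolding holomorphic_on_def field_differentiable_def
      using holomorphic2_slice1[OF g] has_field_derivative_at_within by (metis mem_Collect_eq)
    show "C \<subseteq> {z. (z, circ t * w) \<in> W}"
      using C(4) reinhardtD[OF W(2), of _ w 1 "circ t"] by auto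
  qed (use C in auto)
  then show ?thesis using * C by simp
qed

lemma torus_mean_slice2:
  assumes W: "open W" "reinhardt W" and g: "holomorphic2_on g W"
    and C: "connected C" "a \<in> C" "b \<in> C" "\<And>w. w \<in> C \<Longrightarrow> (z, w) \<in> W"
  shows "torus_mean (\<lambda>u. g (rot u (z, a))) = torus_mean (\<lambda>u. g (rot u (z, b)))"
proof -
  have cont: "continuous_on W g" using g holomorphic2_continuous_on by blast
  have *: "torus_mean (\<lambda>u. g (rot u (z, w))) =
      integral {0..1} (\<lambda>s. integral {0..1} (\<lambda>t. g (circ s * z, circ t * w)))" if "w \<in> C" for w
  proof -
    have c: "continuous_on (cbox (0, 0) (1, 1)) (\<lambda>(s, t). g (circ s * z, circ t * w))"
      using continuous_torus_fun[OF W(2) cont C(4)[OF that]] by (simp add: rot_def case_prod_unfold)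
    show ?thesis
      using integral_prod_continuous[OF c] unfolding torus_mean_def rot_def by (simp add: case_prod_unfold)
  qed
  have "integral {0..1} (\<lambda>t. g (circ s * z, circ t * a)) = integral {0..1} (\<lambda>t. g (circ s * z, circ t * b))" for s
  proof (rule circle_mean_const[of "{w. (circ s * z, w) \<in> W}" "\<lambda>w. g (circ s * z, w)" C])
    show "open {w. (circ s * z, w) \<in> W}"
      using open_vimage[OF W(1), of "\<lambda>w. (circ s * z, w)"]
      by (simp add: vimage_def continuous_on_Pair)
    show "u * w \<in> {w. (circ s * z, w) \<in> W}" if "norm u = 1" "w \<in> {w. (circ s * z, w) \<in> W}" for u w
      using reinhardtD[OF W(2), of "circ s * z" w 1 u] that by simp
    show "(\<lambda>w. g (circ s * z, w)) holomorphic_on {w. (circ s * z, w) \<in> W}"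
      unfolding holomorphic_on_def field_differentiable_def
      using holomorphic2_slice2[OF g] has_field_derivative_at_within by (metis mem_Collect_eq)
    show "C \<subseteq> {w. (circ s * z, w) \<in> W}"
      using C(4) reinhardtD[OF W(2), of z _ "circ s" 1] by auto
  qed (use C in auto)
  then show ?thesis using * C by simp
qed

text \<open>Each point of \<open>W\<close> has a product of discs around it inside \<open>W\<close>,
  where two points are joined by moving one coordinate and then the other. This gives local
  constancy, hence constancy on connected sets.\<close>

lemma torus_mean_const:
  assumes W: "open W" "reinhardt W" and g: "holomorphic2_on g W"
    and C: "connected C" "C \<subseteq> W" "a \<in> C" "b \<in> C"
  shows "torus_mean (\<lambda>u. g (rot u a)) = torus_mean (\<lambda>u. g (rot u b))"
proof (rule connected_local_const[OF C(1,3,4)], rule ballI)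
  fix x assume "x \<in> C"
  then have "x \<in> W" using C by blast
  then obtain A B where AB: "open A" "open B" "x \<in> A \<times> B" "A \<times> B \<subseteq> W"
    using open_prod_elim[OF W(1)] by metis
  obtain x1 x2 where x: "x = (x1, x2)" by (cases x)
  obtain e1 where e1: "e1 > 0" "ball x1 e1 \<subseteq> A" using AB x openE by blast
  obtain e2 where e2: "e2 > 0" "ball x2 e2 \<subseteq> B" using AB x openE by blast
  have box: "(a, b) \<in> W" if "dist x1 a < e1" "dist x2 b < e2" for a b
    using that e1(2) e2(2) AB(4) by (auto simp: subset_eq)
  have "torus_mean (\<lambda>u. g (rot u x)) = torus_mean (\<lambda>u. g (rot u y))"
    if "y \<in> ball x1 e1 \<times> ball x2 e2" for y
  proof -
    obtain y1 y2 where y: "y = (y1, y2)" by (cases y)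
    have "torus_mean (\<lambda>u. g (rot u (x1, x2))) = torus_mean (\<lambda>u. g (rot u (y1, x2)))"
      by (rule torus_mean_slice1[OF W g, of "ball x1 e1"]) (use that e1 e2(1) y in \<open>auto intro!: box\<close>)
    also have "\<dots> = torus_mean (\<lambda>u. g (rot u (y1, y2)))"
      by (rule torus_mean_slice2[OF W g, of "ball x2 e2"]) (use that e1 e2(1) y in \<open>auto intro!: box\<close>)
    finally show ?thesis by (simp add: x y)
  qed
  moreover have "eventually (\<lambda>y. y \<in> ball x1 e1 \<times> ball x2 e2) (at x within C)"
    using e1 e2 by (intro eventually_at_topological[THEN iffD2])
      (auto simp: x intro!: exI[of _ "ball x1 e1 \<times> ball x2 e2"] open_Times)
  ultimately show "\<forall>\<^sub>F y in at x within C. torus_mean (\<lambda>u. g (rot u x)) = torus_mean (\<lambda>u. g (rot u y))"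
    by (auto elim: eventually_mono)
qed

section \<open>Averaging integrals over Reinhardt sets\<close>

abbreviation tor :: "real \<times> real \<Rightarrow> complex \<times> complex" where
  "tor p \<equiv> (circ (fst p), circ (snd p))"

lemma rot_rot_inverse:
  assumes "norm (fst u) = 1" "norm (snd u) = 1"
  shows "rot (inverse (fst u), inverse (snd u)) (rot u z) = z"
proof -
  have "fst u \<noteq> 0" "snd u \<noteq> 0" using assms by force+
  then show ?thesis by (simp add: rot_def mult.assoc[symmetric])
qed

lemma reinhardt_rot_iff:
  assumes "reinhardt U" "norm (fst u) = 1" "norm (snd u) = 1"
  shows "rot u z \<in> U \<longleftrightarrow> z \<in> U"
proof
  assume "rot u z \<in> U"
  then have "rot (inverse (fst u), inverse (snd u)) (rot u z) \<in> U"
    using assms unfolding reinhardt_def by (metis fst_conv snd_conv norm_inverse inverse_1)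
  then show "z \<in> U" using rot_rot_inverse[OF assms(2,3)] by simp
qed (use assms in \<open>simp add: reinhardt_def del: split_paired_All\<close>)

lemma lborel_distr_rot:
  assumes "norm (fst u) = 1" "norm (snd u) = 1"
  shows "distr lborel borel (rot u) = lborel"
proof (rule lborel_distr_linear_isometry)
  show "linear (rot u)"
    by (rule linearI) (auto simp: rot_def algebra_simps)
  show "norm (rot u z) = norm z" for z
    using assms by (simp add: rot_def norm_prod_def norm_mult)
qed

lemma rot_measurable [measurable]: "rot u \<in> borel_measurable borel"
  unfolding rot_def by (intro borel_measurable_continuous_onI continuous_intros)

lemma nn_integral_lebesgue_on_borel:
  assumes "U \<in> sets borel" "F \<in> borel_measurable borel"
  shows "(\<integral>\<^sup>+z. F z \<partial>lebesgue_on U) = (\<integral>\<^sup>+z. F z * indicator U z \<partial>lborel)"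
  using assms by (simp add: nn_integral_restrict_space nn_integral_completion)

lemma integral_lebesgue_on_borel:
  fixes F :: "complex \<times> complex \<Rightarrow> 'b::{banach, second_countable_topology}"
  assumes "U \<in> sets borel" "F \<in> borel_measurable borel"
  shows "integral\<^sup>L (lebesgue_on U) F = (\<integral>z. indicator U z *\<^sub>R F z \<partial>lborel)"
    and "integrable (lebesgue_on U) F \<longleftrightarrow> integrable lborel (\<lambda>z. indicator U z *\<^sub>R F z)"
  using assms by (simp_all add: integral_restrict_space integrable_restrict_space integral_completion integrable_completion)

lemma nn_integral_rot:
  assumes u: "norm (fst u) = 1" "norm (snd u) = 1" and U: "U \<in> sets borel" "reinhardt U"
    and F [measurable]: "F \<in> borel_measurable borel"
  shows "(\<integral>\<^sup>+z. F (rot u z) * indicator U z \<partial>lborel) = (\<integral>\<^sup>+z. F z * indicator U z \<partial>lborel)"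
proof -
  have [measurable]: "(\<lambda>z. F z * indicator U z) \<in> borel_measurable borel" using U by measurable
  have "(\<integral>\<^sup>+z. F z * indicator U z \<partial>lborel) = (\<integral>\<^sup>+z. F z * indicator U z \<partial>distr lborel borel (rot u))"
    using lborel_distr_rot[OF u] by simp
  also have "\<dots> = (\<integral>\<^sup>+z. F (rot u z) * indicator U (rot u z) \<partial>lborel)"
    by (subst nn_integral_distr) auto
  also have "\<dots> = (\<integral>\<^sup>+z. F (rot u z) * indicator U z \<partial>lborel)"
    by (simp add: indicator_def reinhardt_rot_iff[OF U(2) u])
  finally show ?thesis by simp
qed

lemma integral_rot:
  fixes F :: "complex \<times> complex \<Rightarrow> 'b::{banach, second_countable_topology}"
  assumes u: "norm (fst u) = 1" "norm (snd u) = 1" and U: "U \<in> sets borel" "reinhardt U"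
    and F [measurable]: "F \<in> borel_measurable borel"
  shows "(\<integral>z. indicator U z *\<^sub>R F (rot u z) \<partial>lborel) = (\<integral>z. indicator U z *\<^sub>R F z \<partial>lborel)"
    and "integrable lborel (\<lambda>z. indicator U z *\<^sub>R F (rot u z)) \<longleftrightarrow> integrable lborel (\<lambda>z. indicator U z *\<^sub>R F z)"
proof -
  have m [measurable]: "(\<lambda>z. indicator U z *\<^sub>R F z) \<in> borel_measurable borel" using U by measurable
  have eq: "(\<lambda>z. indicator U (rot u z) *\<^sub>R F (rot u z)) = (\<lambda>z. indicator U z *\<^sub>R F (rot u z))"
    by (simp add: indicator_def reinhardt_rot_iff[OF U(2) u])
  show "(\<integral>z. indicator U z *\<^sub>R F (rot u z) \<partial>lborel) = (\<integral>z. indicator U z *\<^sub>R F z \<partial>lborel)"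
    using integral_distr[of "rot u" lborel borel "\<lambda>z. indicator U z *\<^sub>R F z"] lborel_distr_rot[OF u]
    unfolding eq by simp
  show "integrable lborel (\<lambda>z. indicator U z *\<^sub>R F (rot u z)) \<longleftrightarrow> integrable lborel (\<lambda>z. indicator U z *\<^sub>R F z)"
    using integrable_distr_eq[of "rot u" lborel borel "\<lambda>z. indicator U z *\<^sub>R F z"] lborel_distr_rot[OF u]
    unfolding eq by simp
qed

lemma rot_tor_measurable [measurable]:
  "(\<lambda>x. rot (tor (fst x)) (snd x)) \<in> borel_measurable (borel \<Otimes>\<^sub>M borel)"
  unfolding borel_prod rot_def by (intro borel_measurable_continuous_onI continuous_intros)

lemma rot_tor_measurable' [measurable]: "(\<lambda>p. rot (tor p) z) \<in> borel_measurable borel"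
  unfolding rot_def by (intro borel_measurable_continuous_onI continuous_intros)

lemma emeasure_unit_square: "emeasure lborel (cbox (0::real, 0::real) (1, 1)) = 1"
proof -
  have "emeasure lborel (cbox (0::real, 0::real) (1, 1)) = emeasure (lborel \<Otimes>\<^sub>M lborel) ({0..1::real} \<times> {0..1::real})"
    by (simp add: cbox_Pair_eq lborel_prod)
  also have "\<dots> = 1"
    by (subst lborel.emeasure_pair_measure_Times) auto
  finally show ?thesis .
qed

text \<open>Each rotation preserves both \<open>U\<close> and Lebesgue measure, so the integral
  equals the average of its rotated copies; Tonelli moves that average inside.\<close>

lemma reinhardt_nn_mean:
  assumes U [measurable]: "U \<in> sets borel" and "reinhardt U"
    and F [measurable]: "F \<in> borel_measurable borel"
  shows "(\<integral>\<^sup>+z. F z * indicator U z \<partial>lborel) =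
    (\<integral>\<^sup>+z. (\<integral>\<^sup>+p. F (rot (tor p) z) * indicator (cbox (0,0) (1,1)) p \<partial>lborel) * indicator U z \<partial>lborel)"
proof -
  let ?C = "cbox (0,0) (1,1) :: (real \<times> real) set"
  have Fm [measurable]: "(\<lambda>x. F (rot (tor (fst x)) (snd x))) \<in> borel_measurable (borel \<Otimes>\<^sub>M borel)"
    using measurable_compose[OF rot_tor_measurable F] by simp
  have [measurable]: "?C \<in> sets lborel" "?C \<in> sets borel" by simp_all
  have "(\<integral>\<^sup>+z. (\<integral>\<^sup>+p. F (rot (tor p) z) * indicator ?C p \<partial>lborel) * indicator U z \<partial>lborel)
      = (\<integral>\<^sup>+z. \<integral>\<^sup>+p. F (rot (tor p) z) * indicator ?C p * indicator U z \<partial>lborel \<partial>lborel)"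
    by (intro nn_integral_cong nn_integral_multc[symmetric]) measurable
  also have "\<dots> = (\<integral>\<^sup>+p. \<integral>\<^sup>+z. F (rot (tor p) z) * indicator ?C p * indicator U z \<partial>lborel \<partial>lborel)"
    by (rule lborel_pair.Fubini') measurable
  also have "\<dots> = (\<integral>\<^sup>+p. (\<integral>\<^sup>+z. F z * indicator U z \<partial>lborel) * indicator ?C p \<partial>lborel)"
  proof (rule nn_integral_cong)
    fix p :: "real \<times> real"
    have "(\<integral>\<^sup>+z. F (rot (tor p) z) * indicator ?C p * indicator U z \<partial>lborel)
        = (\<integral>\<^sup>+z. F (rot (tor p) z) * indicator U z * indicator ?C p \<partial>lborel)"
      by (simp add: mult_ac)
    also have "\<dots> = (\<integral>\<^sup>+z. F (rot (tor p) z) * indicator U z \<partial>lborel) * indicator ?C p"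
      by (rule nn_integral_multc) measurable
    also have "(\<integral>\<^sup>+z. F (rot (tor p) z) * indicator U z \<partial>lborel) = (\<integral>\<^sup>+z. F z * indicator U z \<partial>lborel)"
      by (rule nn_integral_rot) (use assms in auto)
    finally show "(\<integral>\<^sup>+z. F (rot (tor p) z) * indicator ?C p * indicator U z \<partial>lborel)
        = (\<integral>\<^sup>+z. F z * indicator U z \<partial>lborel) * indicator ?C p" .
  qed
  also have "\<dots> = (\<integral>\<^sup>+z. F z * indicator U z \<partial>lborel)"
    by (subst nn_integral_cmult_indicator) (auto simp: emeasure_unit_square)
  finally show ?thesis by simp
qed

lemma torus_mean_lborel:
  assumes "continuous_on (cbox (0,0) (1,1)) (\<lambda>p. F (tor p))"
  shows "torus_mean F = (\<integral>p. indicator (cbox (0,0) (1,1)) p *\<^sub>R F (tor p) \<partial>lborel)"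
    and "integrable lborel (\<lambda>p. indicator (cbox (0,0) (1,1)) p *\<^sub>R F (tor p))"
proof -
  show i: "integrable lborel (\<lambda>p. indicator (cbox (0,0) (1,1)) p *\<^sub>R F (tor p))"
    by (rule borel_integrable_compact[OF compact_cbox assms])
  show "torus_mean F = (\<integral>p. indicator (cbox (0,0) (1,1)) p *\<^sub>R F (tor p) \<partial>lborel)"
    using set_borel_integral_eq_integral(2)[of "cbox (0,0) (1,1)" "\<lambda>p. F (tor p)"] i
    unfolding torus_mean_def set_integrable_def set_lebesgue_integral_def by simp
qed

text \<open>Counterpart of the averaging identity for integrable functions. The torus mean enters as
  a prescribed \<open>h\<close>, so an integral can be computed from torus means alone.\<close>

lemma reinhardt_mean:
  assumes U [measurable]: "U \<in> sets borel" and r: "reinhardt U"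
    and F [measurable]: "F \<in> borel_measurable borel" and int: "integrable (lebesgue_on U) F"
    and cont: "\<And>z. z \<in> U \<Longrightarrow> continuous_on (cbox (0,0) (1,1)) (\<lambda>p. F (rot (tor p) z))"
    and h: "\<And>z. z \<in> U \<Longrightarrow> torus_mean (\<lambda>u. F (rot u z)) = h z"
  shows "integral\<^sup>L (lebesgue_on U) F = (\<integral>z. indicator U z *\<^sub>R h z \<partial>lborel)"
proof -
  let ?C = "cbox (0,0) (1,1) :: (real \<times> real) set"
  define G where "G = (\<lambda>p z. indicator ?C p *\<^sub>R indicator U z *\<^sub>R F (rot (tor p) z))"
  have Fm [measurable]: "(\<lambda>x. F (rot (tor (fst x)) (snd x))) \<in> borel_measurable (borel \<Otimes>\<^sub>M borel)"
    using measurable_compose[OF rot_tor_measurable F] by simp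
  have [measurable]: "?C \<in> sets lborel" "?C \<in> sets borel" by simp_all
  have Gm [measurable]: "(\<lambda>x. G (fst x) (snd x)) \<in> borel_measurable (lborel \<Otimes>\<^sub>M lborel)"
    unfolding G_def by measurable
  have i: "integrable lborel (\<lambda>z. indicator U z *\<^sub>R F z)"
    using int integral_lebesgue_on_borel[OF U F] by simp
  have ip: "integrable lborel (G p)" for p
    unfolding G_def
    by (rule integrable_scaleR_right) (use integral_rot(2)[OF _ _ U r F, of "tor p"] i in simp)
  have Ip: "(\<integral>z. G p z \<partial>lborel) = indicator ?C p *\<^sub>R (\<integral>z. indicator U z *\<^sub>R F z \<partial>lborel)" for p
    unfolding G_def using integral_rot(1)[OF _ _ U r F, of "tor p"]
    by (simp del: scaleR_scaleR)
  \<comment> \<open>By rotation invariance the integral of the norm is the same for all angles in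
    the square; this is the domination that Fubini requires.\<close>
  have Np: "(\<integral>z. norm (G p z) \<partial>lborel) = indicator ?C p *\<^sub>R (\<integral>z. norm (indicator U z *\<^sub>R F z) \<partial>lborel)" for p
    unfolding G_def using integral_rot(1)[OF _ _ U r, of "tor p" "\<lambda>z. norm (F z)"]
    by (simp add: mult.assoc)
  have iC: "integrable lborel (\<lambda>p. indicator ?C p *\<^sub>R c)" for c :: real
    by (rule borel_integrable_compact[OF compact_cbox continuous_on_const])
  have iC1: "integrable lborel (indicator ?C :: _ \<Rightarrow> real)" using iC[of 1] by simp
  have "integrable (lborel \<Otimes>\<^sub>M lborel) (\<lambda>x. G (fst x) (snd x))"
    by (rule lborel_pair.Fubini_integrable) (auto simp: Np iC iC1 ip)
  then have "integrable (lborel \<Otimes>\<^sub>M lborel) (case_prod G)"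
    by (simp add: case_prod_unfold)
  then have "(\<integral>z. \<integral>p. G p z \<partial>lborel \<partial>lborel) = (\<integral>p. \<integral>z. G p z \<partial>lborel \<partial>lborel)"
    by (rule lborel_pair.Fubini_integral)
  also have "\<dots> = (\<integral>z. indicator U z *\<^sub>R F z \<partial>lborel)"
    unfolding Ip by (subst integral_scaleR_left) (use iC[of "1::real"] in \<open>auto simp: emeasure_unit_square measure_def\<close>)
  also have "\<dots> = integral\<^sup>L (lebesgue_on U) F"
    using integral_lebesgue_on_borel[OF U F] by simp
  finally have "integral\<^sup>L (lebesgue_on U) F = (\<integral>z. \<integral>p. G p z \<partial>lborel \<partial>lborel)" by simp
  also have "\<dots> = (\<integral>z. indicator U z *\<^sub>R h z \<partial>lborel)"
  proof (rule Bochner_Integration.integral_cong[OF refl])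
    fix z
    show "(\<integral>p. G p z \<partial>lborel) = indicator U z *\<^sub>R h z"
    proof (cases "z \<in> U")
      case True
      then show ?thesis
        using torus_mean_lborel(1)[OF cont[OF True]] h[OF True] by (simp add: G_def)
    qed (simp add: G_def)
  qed
  finally show ?thesis .
qed

text \<open>Cauchy-Schwarz against the constant 1 on the unit square, whose measure is 1.\<close>

lemma torus_mean_Jensen:
  assumes "continuous_on (cbox (0,0) (1,1)) (\<lambda>p. F (tor p))"
  shows "ennreal ((norm (torus_mean F))\<^sup>2)
    \<le> (\<integral>\<^sup>+p. ennreal ((norm (F (tor p)))\<^sup>2) * indicator (cbox (0,0) (1,1)) p \<partial>lborel)"
proof -
  let ?C = "cbox (0,0) (1,1) :: (real \<times> real) set"
  let ?f = "\<lambda>p. indicator ?C p *\<^sub>R F (tor p)"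
  have i: "integrable lborel ?f" using torus_mean_lborel(2)[OF assms] .
  have [measurable]: "?f \<in> borel_measurable lborel" using i by (rule borel_measurable_integrable)
  have "ennreal (norm (torus_mean F)) \<le> (\<integral>\<^sup>+p. ennreal (norm (?f p)) \<partial>lborel)"
    unfolding torus_mean_lborel(1)[OF assms] by (rule integral_norm_bound_ennreal[OF i])
  also have "\<dots> = (\<integral>\<^sup>+p. ennreal (norm (?f p)) * indicator ?C p \<partial>lborel)"
    by (intro nn_integral_cong) (simp add: indicator_def)
  finally have "(ennreal (norm (torus_mean F)))\<^sup>2 \<le> (\<integral>\<^sup>+p. ennreal (norm (?f p)) * indicator ?C p \<partial>lborel)\<^sup>2"
    by (rule power_mono) simp
  also have "\<dots> \<le> (\<integral>\<^sup>+p. (ennreal (norm (?f p)))\<^sup>2 \<partial>lborel) * (\<integral>\<^sup>+p. (indicator ?C p)\<^sup>2 \<partial>lborel)"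
    by (rule Cauchy_Schwarz_nn_integral) measurable
  also have "(\<integral>\<^sup>+p. (indicator ?C p)\<^sup>2 \<partial>(lborel :: (real \<times> real) measure)) = (1 :: ennreal)"
  proof -
    have "(\<integral>\<^sup>+p. (indicator ?C p)\<^sup>2 \<partial>lborel) = (\<integral>\<^sup>+p. indicator ?C p \<partial>(lborel :: (real \<times> real) measure))"
      by (intro nn_integral_cong) (simp add: indicator_def)
    then show ?thesis by (simp add: emeasure_unit_square)
  qed
  also have "(\<integral>\<^sup>+p. (ennreal (norm (?f p)))\<^sup>2 \<partial>lborel)
    = (\<integral>\<^sup>+p. ennreal ((norm (F (tor p)))\<^sup>2) * indicator ?C p \<partial>lborel)"
    by (intro nn_integral_cong) (simp add: indicator_def ennreal_power)
  finally show ?thesis by (simp add: ennreal_power)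
qed

section \<open>Point estimates in Bergman spaces\<close>

lemma bergman_spaceD:
  assumes "f \<in> bergman_space W"
  shows "holomorphic2_on f W" "f \<in> L2_on W" "\<And>z. z \<notin> W \<Longrightarrow> f z = 0"
  using assms by (auto simp: bergman_space_def)

lemma bergman_space_borel:
  assumes "open W" "f \<in> bergman_space W"
  shows "f \<in> borel_measurable borel"
proof -
  have "(\<lambda>z. indicator W z *\<^sub>R f z) \<in> borel_measurable borel"
    using assms bergman_spaceD(1) holomorphic2_continuous_on
    by (intro borel_measurable_continuous_on_indicator) auto
  also have "(\<lambda>z. indicator W z *\<^sub>R f z) = f"
    using bergman_spaceD(3)[OF assms(2)] by (auto simp: indicator_def)
  finally show ?thesis .
qed

lemma holomorphic2_on_add:
  "holomorphic2_on f W \<Longrightarrow> holomorphic2_on g W \<Longrightarrow> holomorphic2_on (\<lambda>z. f z + g z) W"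
  unfolding holomorphic2_on_def
proof safe
  fix x y assume *: "\<forall>z\<in>W. \<exists>a b. (f has_derivative (\<lambda>h. a * fst h + b * snd h)) (at z)"
    "\<forall>z\<in>W. \<exists>a b. (g has_derivative (\<lambda>h. a * fst h + b * snd h)) (at z)" "(x, y) \<in> W"
  then obtain a b a' b' where "(f has_derivative (\<lambda>h. a * fst h + b * snd h)) (at (x, y))"
    "(g has_derivative (\<lambda>h. a' * fst h + b' * snd h)) (at (x, y))" by blast
  from has_derivative_add[OF this]
  have "((\<lambda>z. f z + g z) has_derivative (\<lambda>h. (a + a') * fst h + (b + b') * snd h)) (at (x, y))"
    by (simp add: algebra_simps)
  then show "\<exists>a b. ((\<lambda>z. f z + g z) has_derivative (\<lambda>h. a * fst h + b * snd h)) (at (x, y))" by blast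
qed

lemma holomorphic2_on_mult:
  "holomorphic2_on f W \<Longrightarrow> holomorphic2_on g W \<Longrightarrow> holomorphic2_on (\<lambda>z. f z * g z) W"
  unfolding holomorphic2_on_def
proof safe
  fix x y assume *: "\<forall>z\<in>W. \<exists>a b. (f has_derivative (\<lambda>h. a * fst h + b * snd h)) (at z)"
    "\<forall>z\<in>W. \<exists>a b. (g has_derivative (\<lambda>h. a * fst h + b * snd h)) (at z)" "(x, y) \<in> W"
  then obtain a b a' b' where "(f has_derivative (\<lambda>h. a * fst h + b * snd h)) (at (x, y))"
    "(g has_derivative (\<lambda>h. a' * fst h + b' * snd h)) (at (x, y))" by blast
  from has_derivative_mult[OF this]
  have "((\<lambda>z. f z * g z) has_derivative
      (\<lambda>h. (f (x, y) * a' + a * g (x, y)) * fst h + (f (x, y) * b' + b * g (x, y)) * snd h)) (at (x, y))"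
    by (simp add: algebra_simps)
  then show "\<exists>a b. ((\<lambda>z. f z * g z) has_derivative (\<lambda>h. a * fst h + b * snd h)) (at (x, y))" by blast
qed

lemma holomorphic2_on_const: "holomorphic2_on (\<lambda>z. c) W"
  unfolding holomorphic2_on_def by (auto intro!: exI[of _ 0] derivative_eq_intros)

lemma holomorphic2_on_subset: "holomorphic2_on f W \<Longrightarrow> V \<subseteq> W \<Longrightarrow> holomorphic2_on f V"
  unfolding holomorphic2_on_def by blast

lemma holomorphic2_on_transform:
  assumes "holomorphic2_on f W" "open W" "\<And>z. z \<in> W \<Longrightarrow> f z = g z"
  shows "holomorphic2_on g W"
  unfolding holomorphic2_on_def
proof
  fix z assume z: "z \<in> W"
  then obtain a b where "(f has_derivative (\<lambda>h. a * fst h + b * snd h)) (at z)"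
    using assms(1) unfolding holomorphic2_on_def by blast
  then have "(g has_derivative (\<lambda>h. a * fst h + b * snd h)) (at z)"
    using has_derivative_transform_within_open assms(2,3) z by blast
  then show "\<exists>a b. (g has_derivative (\<lambda>h. a * fst h + b * snd h)) (at z)" by blast
qed

lemma bergman_space_zero: "(\<lambda>z. 0) \<in> bergman_space W"
  by (simp add: bergman_space_def holomorphic2_on_const L2_on_zero)

lemma bergman_space_add:
  "f \<in> bergman_space W \<Longrightarrow> g \<in> bergman_space W \<Longrightarrow> (\<lambda>z. f z + g z) \<in> bergman_space W"
  by (simp add: bergman_space_def holomorphic2_on_add L2_on_add)

lemma bergman_space_scale:
  "f \<in> bergman_space W \<Longrightarrow> (\<lambda>z. c * f z) \<in> bergman_space W"
  by (simp add: bergman_space_def holomorphic2_on_mult holomorphic2_on_const L2_on_scale)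

lemma bergman_space_diff:
  "f \<in> bergman_space W \<Longrightarrow> g \<in> bergman_space W \<Longrightarrow> (\<lambda>z. f z - g z) \<in> bergman_space W"
  using bergman_space_add[of f W "\<lambda>z. (-1) * g z"] bergman_space_scale[of g W "-1"] by simp

lemma bergman_space_sum:
  assumes "\<And>i. i \<in> S \<Longrightarrow> f i \<in> bergman_space W"
  shows "(\<lambda>z. \<Sum>i\<in>S. f i z) \<in> bergman_space W"
  using assms
proof (induction S rule: infinite_finite_induct)
  case (insert x F)
  then show ?case using bergman_space_add[of "f x" W "\<lambda>z. \<Sum>i\<in>F. f i z"] by simp
qed (auto simp: bergman_space_zero)

lemma nn_integral_L2_norm:
  assumes "f \<in> L2_on W"
  shows "(\<integral>\<^sup>+z. ennreal ((norm (f z))\<^sup>2) \<partial>lebesgue_on W) = ennreal ((L2_norm_on W f)\<^sup>2)"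
  unfolding L2_norm_sq by (rule nn_integral_eq_integral) (use L2_onD[OF assms] in auto)

lemma torus_mean_constant: "torus_mean (\<lambda>u. c) = c"
  using emeasure_unit_square by (simp add: torus_mean_def measure_def)

text \<open>After translation of the polydisc to the origin every torus can be shrunk to the centre,
  so each torus mean of the translate equals \<open>f (a, b)\<close>. Jensen on each torus, averaged
  over the polydisc, gives the estimate.\<close>

lemma bergman_point_estimate_sq:
  assumes W: "open W" and f: "f \<in> bergman_space W"
    and sub: "ball a r \<times> ball b r \<subseteq> W" and r: "r > 0"
  shows "(norm (f (a, b)))\<^sup>2 * measure lborel (ball (0::complex) r \<times> ball (0::complex) r) \<le> (L2_norm_on W f)\<^sup>2"
proof -
  define P where "P = ball (0::complex) r \<times> ball (0::complex) r"
  define g where "g = (\<lambda>\<zeta>. f ((a, b) + \<zeta>))"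
  have fm [measurable]: "f \<in> borel_measurable borel" using bergman_space_borel[OF W f] .
  have gm [measurable]: "g \<in> borel_measurable borel" unfolding g_def by measurable
  have P: "open P" "reinhardt P" "connected P" "(0, 0) \<in> P"
    using r by (auto simp: P_def open_Times reinhardt_def rot_def norm_mult connected_Times)
  have [measurable]: "P \<in> sets borel" using P(1) by simp
  have shift: "(a, b) + \<zeta> \<in> W" if "\<zeta> \<in> P" for \<zeta>
    using that sub by (auto simp: P_def subset_eq dist_norm)
  have hol: "holomorphic2_on g P"
    unfolding holomorphic2_on_def
  proof
    fix \<zeta> assume "\<zeta> \<in> P"
    then obtain c d where cd: "(f has_derivative (\<lambda>h. c * fst h + d * snd h)) (at ((a, b) + \<zeta>))"
      using bergman_spaceD(1)[OF f] shift unfolding holomorphic2_on_def by blast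
    have "((\<lambda>\<zeta>. (a, b) + \<zeta>) has_derivative (\<lambda>h. h)) (at \<zeta>)"
      by (auto intro!: derivative_eq_intros)
    from has_derivative_compose[OF this, of f, OF cd]
    show "\<exists>c d. (g has_derivative (\<lambda>h. c * fst h + d * snd h)) (at \<zeta>)"
      unfolding g_def by blast
  qed
  have mean: "torus_mean (\<lambda>u. g (rot u \<zeta>)) = f (a, b)" if "\<zeta> \<in> P" for \<zeta>
  proof -
    have "torus_mean (\<lambda>u. g (rot u \<zeta>)) = torus_mean (\<lambda>u. g (rot u (0, 0)))"
      by (rule torus_mean_const[OF P(1,2) hol P(3) subset_refl that P(4)])
    then show ?thesis by (simp add: rot_def torus_mean_constant g_def)
  qed
  have Pfin: "emeasure lborel P < \<infinity>"
    by (rule emeasure_bounded_finite) (simp add: P_def bounded_Times)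
  have "ennreal ((norm (f (a, b)))\<^sup>2) * emeasure lborel P
      = (\<integral>\<^sup>+\<zeta>. ennreal ((norm (f (a, b)))\<^sup>2) * indicator P \<zeta> \<partial>lborel)"
    by (subst nn_integral_cmult_indicator) auto
  also have "\<dots> \<le> (\<integral>\<^sup>+\<zeta>. (\<integral>\<^sup>+p. ennreal ((norm (g (rot (tor p) \<zeta>)))\<^sup>2) * indicator (cbox (0,0) (1,1)) p \<partial>lborel)
      * indicator P \<zeta> \<partial>lborel)"
  proof (rule nn_integral_mono)
    fix \<zeta>
    have "ennreal ((norm (torus_mean (\<lambda>u. g (rot u \<zeta>))))\<^sup>2)
      \<le> (\<integral>\<^sup>+p. ennreal ((norm (g (rot (tor p) \<zeta>)))\<^sup>2) * indicator (cbox (0,0) (1,1)) p \<partial>lborel)"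
      if "\<zeta> \<in> P"
      by (rule torus_mean_Jensen)
        (rule continuous_torus_fun[OF P(2) holomorphic2_continuous_on[OF hol] that])
    then show "ennreal ((norm (f (a, b)))\<^sup>2) * indicator P \<zeta> \<le>
      (\<integral>\<^sup>+p. ennreal ((norm (g (rot (tor p) \<zeta>)))\<^sup>2) * indicator (cbox (0,0) (1,1)) p \<partial>lborel) * indicator P \<zeta>"
      using mean by (cases "\<zeta> \<in> P") auto
  qed
  also have "\<dots> = (\<integral>\<^sup>+\<zeta>. ennreal ((norm (g \<zeta>))\<^sup>2) * indicator P \<zeta> \<partial>lborel)"
    by (rule reinhardt_nn_mean[symmetric]) (use P in auto)
  also have "\<dots> \<le> (\<integral>\<^sup>+\<zeta>. ennreal ((norm (g \<zeta>))\<^sup>2) \<partial>lborel)"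
    by (intro nn_integral_mono) (auto simp: indicator_def)
  also have "\<dots> = (\<integral>\<^sup>+z. ennreal ((norm (f z))\<^sup>2) \<partial>distr lborel borel ((+) (a, b)))"
    by (subst nn_integral_distr) (auto simp: g_def)
  also have "\<dots> = (\<integral>\<^sup>+z. ennreal ((norm (f z))\<^sup>2) * indicator W z \<partial>lborel)"
    using bergman_spaceD(3)[OF f]
    by (auto simp: lborel_distr_plus indicator_def intro!: nn_integral_cong)
  also have "\<dots> = (\<integral>\<^sup>+z. ennreal ((norm (f z))\<^sup>2) \<partial>lebesgue_on W)"
    by (subst nn_integral_lebesgue_on_borel) (use W in auto)
  also have "\<dots> = ennreal ((L2_norm_on W f)\<^sup>2)"
    by (rule nn_integral_L2_norm[OF bergman_spaceD(2)[OF f]])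
  finally have "ennreal ((norm (f (a, b)))\<^sup>2) * emeasure lborel P \<le> ennreal ((L2_norm_on W f)\<^sup>2)" .
  also have "emeasure lborel P = ennreal (measure lborel P)"
    using Pfin by (simp add: emeasure_eq_ennreal_measure)
  finally show ?thesis
    by (simp add: P_def ennreal_mult[symmetric])
qed

lemma bergman_point_estimate:
  assumes W: "open W" and f: "f \<in> bergman_space W"
    and sub: "ball a r \<times> ball b r \<subseteq> W" and r: "r > 0"
  shows "norm (f (a, b)) \<le> L2_norm_on W f / sqrt (measure lborel (ball (0::complex) r \<times> ball (0::complex) r))"
proof -
  define v where "v = measure lborel (ball (0::complex) r \<times> ball (0::complex) r)"
  have "v = measure lborel (ball (0::complex) r) * measure lborel (ball (0::complex) r)"
    unfolding v_def measure_def lborel_prod[symmetric]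
    by (subst lborel.emeasure_pair_measure_Times) (auto simp: enn2real_mult)
  then have v: "v > 0" using content_ball_pos[OF r, of "0::complex"] by (simp add: measure_completion)
  have "(norm (f (a, b)) * sqrt v)\<^sup>2 \<le> (L2_norm_on W f)\<^sup>2"
    using bergman_point_estimate_sq[OF assms] v unfolding v_def[symmetric]
    by (simp add: power_mult_distrib)
  then have "norm (f (a, b)) * sqrt v \<le> L2_norm_on W f"
    by (rule power2_le_imp_le) simp
  then show ?thesis
    unfolding v_def[symmetric] using v by (simp add: field_simps)
qed

text \<open>The constant is uniform in \<open>z\<close> near \<open>z0\<close> and in
  \<open>f\<close>, for values and for both partial derivatives. Such bounds turn norm-Cauchy
  sequences into sequences converging uniformly near \<open>z0\<close> together with their
  derivatives.\<close>

lemma bergman_local_estimate: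
  assumes W: "open W" and z0: "z0 \<in> W"
  obtains r K where "r > 0" "K \<ge> 0" "ball z0 r \<subseteq> W"
    "\<And>f z. f \<in> bergman_space W \<Longrightarrow> z \<in> ball z0 r \<Longrightarrow> norm (f z) \<le> K * L2_norm_on W f"
    "\<And>f z a b. f \<in> bergman_space W \<Longrightarrow> z \<in> ball z0 r \<Longrightarrow>
      (f has_derivative (\<lambda>h. a * fst h + b * snd h)) (at z) \<Longrightarrow>
      norm a \<le> K * L2_norm_on W f \<and> norm b \<le> K * L2_norm_on W f"
proof -
  obtain R where R: "R > 0" "ball z0 R \<subseteq> W" using W z0 openE by blast
  \<comment> \<open>Moving each coordinate of a point of \<open>ball z0 r\<close> by at most
    \<open>r\<close> stays in \<open>ball z0 (4 * r)\<close>, and the polydisc of radius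
    \<open>r\<close> about a point of \<open>ball z0 (4 * r)\<close> stays in
    \<open>ball z0 (6 * r)\<close>, inside \<open>ball z0 R\<close>.\<close>
  define r where "r = R / 8"
  have r: "r > 0" using R by (simp add: r_def)
  define K where "K = 1 / sqrt (measure lborel (ball (0::complex) r \<times> ball (0::complex) r))"
  have K: "K \<ge> 0" by (simp add: K_def)
  have near: "(x, y) \<in> ball z0 (s + 2 * d)" if "(z, w) \<in> ball z0 s" "dist z x \<le> d" "dist w y \<le> d" for x y z w s d
  proof -
    have "dist (z, w) (x, y) \<le> dist z x + dist w y"
      unfolding dist_Pair_Pair by (rule sqrt_sum_squares_le_sum) auto
    then have "dist z0 (x, y) < s + 2 * d"
      using dist_triangle[of z0 "(x, y)" "(z, w)"] that by auto
    then show ?thesis by simp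
  qed
  have bound: "norm (f z) \<le> K * L2_norm_on W f" if f: "f \<in> bergman_space W" and z: "z \<in> ball z0 (4 * r)" for f z
  proof -
    obtain x y where xy: "z = (x, y)" by (cases z)
    have "ball x r \<times> ball y r \<subseteq> ball z0 (4 * r + 2 * r)"
      using near[of x y "4 * r" _ r] z xy by (auto simp: less_imp_le)
    also have "\<dots> \<subseteq> ball z0 R" using r by (intro subset_ball) (simp add: r_def)
    finally show ?thesis
      using bergman_point_estimate[OF W f _ r, of x y] R(2) by (simp add: K_def xy)
  qed
  have sub4: "ball z0 (4 * r) \<subseteq> W" using R r by (auto simp: r_def subset_eq)
  show ?thesis
  proof (rule that[of r "max K (K / r)"])
    show "ball z0 r \<subseteq> W" using sub4 r by (auto simp: subset_eq)
  next
    fix f z assume f: "f \<in> bergman_space W" and z: "z \<in> ball z0 r"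
    have "norm (f z) \<le> K * L2_norm_on W f" using bound[OF f] z r by auto
    also have "\<dots> \<le> max K (K / r) * L2_norm_on W f" by (intro mult_right_mono) auto
    finally show "norm (f z) \<le> max K (K / r) * L2_norm_on W f" .
  next
    fix f z a b assume f: "f \<in> bergman_space W" and z: "z \<in> ball z0 r"
      and der: "(f has_derivative (\<lambda>h. a * fst h + b * snd h)) (at z)"
    note hol = bergman_spaceD(1)[OF f]
    obtain x y where xy: "z = (x, y)" by (cases z)
    define B where "B = K * L2_norm_on W f"
    have in1: "(\<zeta>, y) \<in> ball z0 (4 * r)" if "dist x \<zeta> \<le> r" for \<zeta>
      using near[of x y r \<zeta> r y] z xy that r by auto
    have in2: "(x, \<zeta>) \<in> ball z0 (4 * r)" if "dist y \<zeta> \<le> r" for \<zeta>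
      using near[of x y r x r \<zeta>] z xy that r by auto
    have xyW: "(x, y) \<in> W" using in1[of x] sub4 r by auto
    have fd1: "(\<lambda>\<zeta>. f (\<zeta>, y)) field_differentiable at \<zeta>" if "dist x \<zeta> \<le> r" for \<zeta>
    proof -
      have "(\<zeta>, y) \<in> W" using in1[OF that] sub4 by blast
      then show ?thesis
        by (rule holomorphic2_slice1[OF hol]) (auto simp: field_differentiable_def)
    qed
    have fd2: "(\<lambda>\<zeta>. f (x, \<zeta>)) field_differentiable at \<zeta>" if "dist y \<zeta> \<le> r" for \<zeta>
    proof -
      have "(x, \<zeta>) \<in> W" using in2[OF that] sub4 by blast
      then show ?thesis
        by (rule holomorphic2_slice2[OF hol]) (auto simp: field_differentiable_def)
    qed
    have "norm ((deriv ^^ 1) (\<lambda>\<zeta>. f (\<zeta>, y)) x) \<le> fact 1 * B / r ^ 1"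
    proof (rule Cauchy_inequality[OF _ _ r])
      show "(\<lambda>\<zeta>. f (\<zeta>, y)) holomorphic_on ball x r"
        by (auto simp: holomorphic_on_def intro!: field_differentiable_at_within fd1)
      show "continuous_on (cball x r) (\<lambda>\<zeta>. f (\<zeta>, y))"
        by (intro continuous_at_imp_continuous_on ballI field_differentiable_imp_continuous_at fd1) simp
      show "norm (f (\<zeta>, y)) \<le> B" if "norm (x - \<zeta>) = r" for \<zeta>
        unfolding B_def using bound[OF f in1[of \<zeta>]] that by (simp add: dist_norm)
    qed
    moreover have "deriv (\<lambda>\<zeta>. f (\<zeta>, y)) x = a"
    proof -
      obtain d where "((\<lambda>\<zeta>. f (\<zeta>, y)) has_field_derivative d) (at x)"
        "\<And>f'. (f has_derivative f') (at (x, y)) \<Longrightarrow> f' (1, 0) = d"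
        by (rule holomorphic2_slice1[OF hol xyW]) blast
      then show ?thesis using der DERIV_imp_deriv unfolding xy by fastforce
    qed
    ultimately have a: "norm a \<le> B / r" by simp
    have "norm ((deriv ^^ 1) (\<lambda>\<zeta>. f (x, \<zeta>)) y) \<le> fact 1 * B / r ^ 1"
    proof (rule Cauchy_inequality[OF _ _ r])
      show "(\<lambda>\<zeta>. f (x, \<zeta>)) holomorphic_on ball y r"
        by (auto simp: holomorphic_on_def intro!: field_differentiable_at_within fd2)
      show "continuous_on (cball y r) (\<lambda>\<zeta>. f (x, \<zeta>))"
        by (intro continuous_at_imp_continuous_on ballI field_differentiable_imp_continuous_at fd2) simp
      show "norm (f (x, \<zeta>)) \<le> B" if "norm (y - \<zeta>) = r" for \<zeta>
        unfolding B_def using bound[OF f in2[of \<zeta>]] that by (simp add: dist_norm)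
    qed
    moreover have "deriv (\<lambda>\<zeta>. f (x, \<zeta>)) y = b"
    proof -
      obtain d where "((\<lambda>\<zeta>. f (x, \<zeta>)) has_field_derivative d) (at y)"
        "\<And>f'. (f has_derivative f') (at (x, y)) \<Longrightarrow> f' (0, 1) = d"
        by (rule holomorphic2_slice2[OF hol xyW]) blast
      then show ?thesis using der DERIV_imp_deriv unfolding xy by fastforce
    qed
    ultimately have b: "norm b \<le> B / r" by simp
    have "B / r \<le> max K (K / r) * L2_norm_on W f"
      unfolding B_def times_divide_eq_left[symmetric] by (intro mult_right_mono) auto
    with a b show "norm a \<le> max K (K / r) * L2_norm_on W f \<and> norm b \<le> max K (K / r) * L2_norm_on W f"
      by linarith
  qed (use r K in auto)
qed

section \<open>Completeness and the Bergman projection\<close>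

lemma bergman_pointwise_estimate:
  assumes "open W" "z \<in> W"
  obtains K where "K \<ge> 0" "\<And>f. f \<in> bergman_space W \<Longrightarrow> norm (f z) \<le> K * L2_norm_on W f"
  using bergman_local_estimate[OF assms] by (metis assms(2) centre_in_ball)

lemma bergman_norm_zero:
  assumes "open W" "f \<in> bergman_space W" "L2_norm_on W f = 0"
  shows "f = (\<lambda>z. 0)"
proof
  fix z
  show "f z = 0"
  proof (cases "z \<in> W")
    case True
    then obtain K where "norm (f z) \<le> K * L2_norm_on W f"
      using bergman_pointwise_estimate[OF assms(1) True] assms(2) by metis
    then show ?thesis using assms(3) by simp
  qed (use bergman_spaceD(3)[OF assms(2)] in simp)
qed

text \<open>Fatou's lemma along \<open>m\<close>: a bound on the distances from \<open>f\<close> to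
  all late members passes to the pointwise limit. Applied with \<open>f\<close> itself a late
  member, it upgrades pointwise convergence to norm convergence.\<close>

lemma bergman_Fatou:
  assumes W: "open W" and h: "\<And>n. h n \<in> bergman_space W"
    and lim: "\<And>z. (\<lambda>n. h n z) \<longlonglongrightarrow> H z"
    and f: "f \<in> bergman_space W" and bound: "\<And>m. m \<ge> N \<Longrightarrow> L2_norm_on W (\<lambda>z. f z - h m z) \<le> e"
  shows "(\<lambda>z. f z - H z) \<in> L2_on W" "L2_norm_on W (\<lambda>z. f z - H z) \<le> e"
proof -
  have e: "e \<ge> 0" using bound[OF order_refl] L2_norm_nonneg order_trans by blast
  have hm [measurable]: "h n \<in> borel_measurable borel" for n using bergman_space_borel[OF W h] .
  have fm [measurable]: "f \<in> borel_measurable borel" using bergman_space_borel[OF W f] .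
  have Hm [measurable]: "H \<in> borel_measurable borel"
    using borel_measurable_LIMSEQ_metric[of h borel H] lim hm by auto
  have Wm [measurable]: "W \<in> sets borel" using W by simp
  have meas [measurable]: "g \<in> borel_measurable (lebesgue_on W)" if "g \<in> borel_measurable borel" for g :: "complex \<times> complex \<Rightarrow> complex"
    using that by (simp add: borel_measurable_if_D measurable_completion measurable_restrict_space1)
  have "(\<integral>\<^sup>+z. ennreal ((norm (f z - H z))\<^sup>2) \<partial>lebesgue_on W)
     = (\<integral>\<^sup>+z. liminf (\<lambda>m. ennreal ((norm (f z - h m z))\<^sup>2)) \<partial>lebesgue_on W)"
  proof (rule nn_integral_cong)
    fix z
    have "(\<lambda>m. ennreal ((norm (f z - h m z))\<^sup>2)) \<longlonglongrightarrow> ennreal ((norm (f z - H z))\<^sup>2)"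
      by (intro tendsto_intros lim)
    then show "ennreal ((norm (f z - H z))\<^sup>2) = liminf (\<lambda>m. ennreal ((norm (f z - h m z))\<^sup>2))"
      by (rule lim_imp_Liminf[OF trivial_limit_sequentially, symmetric])
  qed
  also have "\<dots> \<le> liminf (\<lambda>m. \<integral>\<^sup>+z. ennreal ((norm (f z - h m z))\<^sup>2) \<partial>lebesgue_on W)"
  proof (rule nn_integral_liminf)
    fix m
    show "(\<lambda>z. ennreal ((norm (f z - h m z))\<^sup>2)) \<in> borel_measurable (lebesgue_on W)"
      using meas[OF fm] meas[OF hm[of m]] by measurable
  qed
  also have "\<dots> \<le> ennreal (e\<^sup>2)"
  proof -
    have "\<forall>\<^sub>F m in sequentially. (\<integral>\<^sup>+z. ennreal ((norm (f z - h m z))\<^sup>2) \<partial>lebesgue_on W) \<le> ennreal (e\<^sup>2)"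
      unfolding eventually_sequentially
    proof (intro exI[of _ N] allI impI)
      fix m assume "N \<le> m"
      then show "(\<integral>\<^sup>+z. ennreal ((norm (f z - h m z))\<^sup>2) \<partial>lebesgue_on W) \<le> ennreal (e\<^sup>2)"
        unfolding nn_integral_L2_norm[OF bergman_spaceD(2)[OF bergman_space_diff[OF f h]]]
        by (intro ennreal_leI power_mono bound) auto
    qed
    from Liminf_mono[OF this] show ?thesis by (simp add: Liminf_const)
  qed
  finally have le: "(\<integral>\<^sup>+z. ennreal ((norm (f z - H z))\<^sup>2) \<partial>lebesgue_on W) \<le> ennreal (e\<^sup>2)" .
  have m: "(\<lambda>z. f z - H z) \<in> borel_measurable (lebesgue_on W)" using meas[OF fm] meas[OF Hm] by measurable
  have m2: "(\<lambda>z. (norm (f z - H z))\<^sup>2) \<in> borel_measurable (lebesgue_on W)" using m by measurable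
  have "integrable (lebesgue_on W) (\<lambda>z. (norm (f z - H z))\<^sup>2)"
    by (rule integrableI_bounded[OF m2]) (use le in \<open>auto simp: order_le_less_trans\<close>)
  then show L: "(\<lambda>z. f z - H z) \<in> L2_on W" unfolding L2_on_def using m by blast
  have "ennreal ((L2_norm_on W (\<lambda>z. f z - H z))\<^sup>2) \<le> ennreal (e\<^sup>2)"
    using le nn_integral_L2_norm[OF L] by simp
  then have "(L2_norm_on W (\<lambda>z. f z - H z))\<^sup>2 \<le> e\<^sup>2" by simp
  then show "L2_norm_on W (\<lambda>z. f z - H z) \<le> e" using e by (rule power2_le_imp_le)
qed

text \<open>The main point is holomorphy of the limit: the derivative coefficients are locally
  uniformly Cauchy by the local estimate, so the limit is differentiable with a complex linear
  derivative.\<close>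

lemma bergman_complete:
  assumes W: "open W" and h: "\<And>n. h n \<in> bergman_space W"
    and Cauchy: "\<And>e. e > 0 \<Longrightarrow> \<exists>N. \<forall>m\<ge>N. \<forall>n\<ge>N. L2_norm_on W (\<lambda>z. h m z - h n z) \<le> e"
  obtains H where "H \<in> bergman_space W" "(\<lambda>n. L2_norm_on W (\<lambda>z. h n z - H z)) \<longlonglongrightarrow> 0"
proof -
  have small: "\<exists>N. \<forall>m\<ge>N. \<forall>n\<ge>N. K * L2_norm_on W (\<lambda>z. h m z - h n z) \<le> e" if "e > 0" "K \<ge> 0" for e K
  proof -
    \<comment> \<open>Dividing by \<open>K + 1\<close> rather than \<open>K\<close> allows
      \<open>K = 0\<close>.\<close>
    from Cauchy[of "e / (K + 1)"] that obtain N where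
      N: "L2_norm_on W (\<lambda>z. h m z - h n z) \<le> e / (K + 1)" if "m \<ge> N" "n \<ge> N" for m n
      by (metis add_nonneg_pos divide_pos_pos zero_less_one)
    have "K * L2_norm_on W (\<lambda>z. h m z - h n z) \<le> e" if "m \<ge> N" "n \<ge> N" for m n
    proof -
      have "K * L2_norm_on W (\<lambda>z. h m z - h n z) \<le> (K + 1) * (e / (K + 1))"
        using N[OF that] \<open>K \<ge> 0\<close> \<open>e > 0\<close> by (intro mult_mono) auto
      then show ?thesis using \<open>K \<ge> 0\<close> by simp
    qed
    then show ?thesis by blast
  qed
  define H where "H = (\<lambda>z. lim (\<lambda>n. h n z))"
  have lim: "(\<lambda>n. h n z) \<longlonglongrightarrow> H z" for z
  proof (cases "z \<in> W")
    case True
    obtain K where K: "K \<ge> 0" "\<And>f. f \<in> bergman_space W \<Longrightarrow> norm (f z) \<le> K * L2_norm_on W f"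
      using bergman_pointwise_estimate[OF W True] by metis
    have "Cauchy (\<lambda>n. h n z)"
    proof (rule CauchyI)
      fix e :: real assume "e > 0"
      then obtain N where N: "\<forall>m\<ge>N. \<forall>n\<ge>N. K * L2_norm_on W (\<lambda>z. h m z - h n z) \<le> e / 2"
        using small[of "e / 2" K] K(1) by auto
      have "norm (h m z - h n z) < e" if "m \<ge> N" "n \<ge> N" for m n
        using K(2)[OF bergman_space_diff[OF h h], of m n] N[rule_format, OF that] \<open>e > 0\<close> by linarith
      then show "\<exists>N. \<forall>m\<ge>N. \<forall>n\<ge>N. norm (h m z - h n z) < e" by blast
    qed
    then show ?thesis unfolding H_def by (simp add: Cauchy_convergent_iff convergent_LIMSEQ_iff)
  next
    case False
    then have "h n z = 0" for n using bergman_spaceD(3)[OF h] by simp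
    then show ?thesis by (simp add: H_def)
  qed
  have H0: "H z = 0" if "z \<notin> W" for z
    using that bergman_spaceD(3)[OF h] by (simp add: H_def)
  have hol: "holomorphic2_on H W"
    unfolding holomorphic2_on_def
  proof
    fix z0 assume z0: "z0 \<in> W"
    obtain r K where r: "r > 0" and K: "K \<ge> 0" and sub: "ball z0 r \<subseteq> W"
      and "\<And>f z. f \<in> bergman_space W \<Longrightarrow> z \<in> ball z0 r \<Longrightarrow> norm (f z) \<le> K * L2_norm_on W f"
      and der: "\<And>f z a b. f \<in> bergman_space W \<Longrightarrow> z \<in> ball z0 r \<Longrightarrow>
        (f has_derivative (\<lambda>h. a * fst h + b * snd h)) (at z) \<Longrightarrow>
        norm a \<le> K * L2_norm_on W f \<and> norm b \<le> K * L2_norm_on W f"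
      by (rule bergman_local_estimate[OF W z0]) (rule that; assumption)
    have "\<forall>n z. \<exists>a b. z \<in> ball z0 r \<longrightarrow> (h n has_derivative (\<lambda>h. a * fst h + b * snd h)) (at z)"
      using bergman_spaceD(1)[OF h] sub unfolding holomorphic2_on_def by (meson subsetD)
    then obtain a b where ab: "(h n has_derivative (\<lambda>h. a n z * fst h + b n z * snd h)) (at z)"
      if "z \<in> ball z0 r" for n z by metis
    have diff: "norm (a m z - a n z) \<le> K * L2_norm_on W (\<lambda>z. h m z - h n z)
        \<and> norm (b m z - b n z) \<le> K * L2_norm_on W (\<lambda>z. h m z - h n z)" if z: "z \<in> ball z0 r" for m n z
    proof (rule der[OF bergman_space_diff[OF h h] z])
      show "((\<lambda>z. h m z - h n z) has_derivative (\<lambda>h. (a m z - a n z) * fst h + (b m z - b n z) * snd h)) (at z)"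
        using has_derivative_diff[OF ab[OF z, of m] ab[OF z, of n]] by (simp add: algebra_simps)
    qed
    define A where "A = (\<lambda>z. lim (\<lambda>n. a n z))"
    define B where "B = (\<lambda>z. lim (\<lambda>n. b n z))"
    have limAB: "(\<lambda>n. a n z) \<longlonglongrightarrow> A z \<and> (\<lambda>n. b n z) \<longlonglongrightarrow> B z" if z: "z \<in> ball z0 r" for z
    proof -
      have *: "\<exists>N. \<forall>m\<ge>N. \<forall>n\<ge>N. norm (a m z - a n z) < e \<and> norm (b m z - b n z) < e" if "e > 0" for e
      proof -
        obtain N where N: "\<forall>m\<ge>N. \<forall>n\<ge>N. K * L2_norm_on W (\<lambda>z. h m z - h n z) \<le> e / 2"
          using small[of "e / 2" K] K \<open>e > 0\<close> by auto
        then show ?thesis using diff[OF z] \<open>e > 0\<close>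
          by (intro exI[of _ N]) (smt (verit) field_sum_of_halves)
      qed
      have "Cauchy (\<lambda>n. a n z)" by (rule CauchyI) (use * in blast)
      moreover have "Cauchy (\<lambda>n. b n z)" by (rule CauchyI) (use * in blast)
      ultimately show ?thesis unfolding A_def B_def by (simp add: Cauchy_convergent_iff convergent_LIMSEQ_iff)
    qed
    have "\<exists>g. \<forall>z\<in>ball z0 r. (\<lambda>n. h n z) \<longlonglongrightarrow> g z \<and>
        (g has_derivative (\<lambda>h. A z * fst h + B z * snd h)) (at z within ball z0 r)"
    \<comment> \<open>Uniform convergence of the derivatives on a convex set, with convergence of
      the values at \<open>z0\<close>, yields some limit \<open>g\<close> that has the limiting
      derivative; \<open>g\<close> is afterwards identified with \<open>H\<close>.\<close>
    proof (rule has_derivative_sequence[where f' = "\<lambda>n z h. a n z * fst h + b n z * snd h"])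
      show "(h n has_derivative (\<lambda>h. a n z * fst h + b n z * snd h)) (at z within ball z0 r)"
        if "z \<in> ball z0 r" for n z using has_derivative_at_withinI[OF ab[OF that]] .
    next
      fix e :: real assume "e > 0"
      then obtain N where N: "\<forall>m\<ge>N. \<forall>n\<ge>N. K * L2_norm_on W (\<lambda>z. h m z - h n z) \<le> e / 2"
        using small[of "e / 2" K] K by auto
      have "norm (a n z * fst v + b n z * snd v - (A z * fst v + B z * snd v)) \<le> e * norm v"
        if n: "n \<ge> N" and z: "z \<in> ball z0 r" for n z v
      proof -
        have "norm (a n z - A z) \<le> e / 2"
        proof (rule Lim_bounded)
          show "(\<lambda>m. norm (a n z - a m z)) \<longlonglongrightarrow> norm (a n z - A z)"
            using limAB[OF z] by (intro tendsto_intros) auto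
          show "\<forall>m\<ge>N. norm (a n z - a m z) \<le> e / 2"
            using diff[OF z] N n by (meson order_trans)
        qed
        moreover have "norm (b n z - B z) \<le> e / 2"
        proof (rule Lim_bounded)
          show "(\<lambda>m. norm (b n z - b m z)) \<longlonglongrightarrow> norm (b n z - B z)"
            using limAB[OF z] by (intro tendsto_intros) auto
          show "\<forall>m\<ge>N. norm (b n z - b m z) \<le> e / 2"
            using diff[OF z] N n by (meson order_trans)
        qed
        ultimately have "norm (a n z - A z) * norm (fst v) + norm (b n z - B z) * norm (snd v)
            \<le> e / 2 * norm v + e / 2 * norm v"
          using norm_fst_le[of "fst v" "snd v"] norm_snd_le[of "snd v" "fst v"] \<open>e > 0\<close>
          by (intro add_mono mult_mono) auto
        moreover have "norm (a n z * fst v + b n z * snd v - (A z * fst v + B z * snd v))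
            \<le> norm (a n z - A z) * norm (fst v) + norm (b n z - B z) * norm (snd v)"
          using norm_triangle_ineq[of "(a n z - A z) * fst v" "(b n z - B z) * snd v"]
          unfolding norm_mult[symmetric] left_diff_distrib by (simp only: add_diff_add)
        ultimately show ?thesis by simp
      qed
      then show "\<forall>\<^sub>F n in sequentially. \<forall>z\<in>ball z0 r. \<forall>v.
          norm (a n z * fst v + b n z * snd v - (A z * fst v + B z * snd v)) \<le> e * norm v"
        unfolding eventually_sequentially by blast
    next
      show "z0 \<in> ball z0 r" using r by simp
      show "(\<lambda>n. h n z0) \<longlonglongrightarrow> H z0" by (rule lim)
    qed simp
    then obtain g where g: "\<And>z. z \<in> ball z0 r \<Longrightarrow> (\<lambda>n. h n z) \<longlonglongrightarrow> g z"
      "\<And>z. z \<in> ball z0 r \<Longrightarrow> (g has_derivative (\<lambda>h. A z * fst h + B z * snd h)) (at z within ball z0 r)"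
      by blast
    have "g z = H z" if "z \<in> ball z0 r" for z using LIMSEQ_unique[OF g(1)[OF that] lim] .
    moreover have "(g has_derivative (\<lambda>h. A z0 * fst h + B z0 * snd h)) (at z0)"
      using g(2)[of z0] r by (simp add: at_within_open[of z0 "ball z0 r"])
    ultimately have "(H has_derivative (\<lambda>h. A z0 * fst h + B z0 * snd h)) (at z0)"
      using has_derivative_transform_within_open[of g _ z0 UNIV "ball z0 r" H] r by simp
    then show "\<exists>a b. (H has_derivative (\<lambda>h. a * fst h + b * snd h)) (at z0)" by blast
  qed
  have L2: "\<exists>N. \<forall>n\<ge>N. (\<lambda>z. h n z - H z) \<in> L2_on W \<and> L2_norm_on W (\<lambda>z. h n z - H z) \<le> e" if "e > 0" for e
  proof -
    from Cauchy[OF that] obtain N where N: "\<forall>m\<ge>N. \<forall>n\<ge>N. L2_norm_on W (\<lambda>z. h m z - h n z) \<le> e" by blast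
    then show ?thesis
      using bergman_Fatou[OF W h lim h, of N _ e] by blast
  qed
  obtain n where n: "(\<lambda>z. h n z - H z) \<in> L2_on W" using L2[of 1] by auto
  have "H \<in> L2_on W" using L2_on_diff[OF bergman_spaceD(2)[OF h[of n]] n] by simp
  then have "H \<in> bergman_space W" using hol H0 by (simp add: bergman_space_def)
  moreover have "(\<lambda>n. L2_norm_on W (\<lambda>z. h n z - H z)) \<longlonglongrightarrow> 0"
  proof (rule LIMSEQ_I)
    fix e :: real assume "e > 0"
    then obtain N where "\<forall>n\<ge>N. L2_norm_on W (\<lambda>z. h n z - H z) \<le> e / 2" using L2[of "e / 2"] by auto
    then show "\<exists>N. \<forall>n\<ge>N. norm (L2_norm_on W (\<lambda>z. h n z - H z) - 0) < e"
      using \<open>e > 0\<close> by (intro exI[of _ N]) (auto simp: field_sum_of_halves intro: le_less_trans)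
  qed
  ultimately show ?thesis using that by blast
qed

text \<open>The Hilbert space projection argument on function representatives: a minimising sequence
  for the distance to \<open>g\<close> is Cauchy by the parallelogram law, and minimality of its
  limit forces orthogonality.\<close>

lemma bergman_projection_exists:
  assumes W: "open W" and g: "g \<in> L2_on W"
  obtains h where "h \<in> bergman_space W"
    "\<And>k. k \<in> bergman_space W \<Longrightarrow> L2_inner_on W (\<lambda>z. g z - h z) k = 0"
proof -
  define \<delta> where "\<delta> = (\<lambda>k. (L2_norm_on W (\<lambda>z. g z - k z))\<^sup>2)"
  define d where "d = Inf (\<delta> ` bergman_space W)"
  have bdd: "bdd_below (\<delta> ` bergman_space W)" by (rule bdd_belowI[of _ 0]) (auto simp: \<delta>_def)
  have ne: "\<delta> ` bergman_space W \<noteq> {}" using bergman_space_zero by blast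
  have d_le: "d \<le> \<delta> k" if "k \<in> bergman_space W" for k
    unfolding d_def using bdd that by (simp add: cInf_lower)
  have "\<exists>k\<in>bergman_space W. \<delta> k < d + 1 / real (Suc n)" for n
  proof -
    have "Inf (\<delta> ` bergman_space W) < d + 1 / real (Suc n)" by (simp add: d_def)
    then show ?thesis using cInf_lessD[OF ne] by blast
  qed
  then obtain h where h: "\<And>n. h n \<in> bergman_space W" "\<And>n. \<delta> (h n) < d + 1 / real (Suc n)" by metis
  have L: "k \<in> L2_on W" if "k \<in> bergman_space W" for k using bergman_spaceD(2)[OF that] .
  have gd: "(\<lambda>z. g z - k z) \<in> L2_on W" if "k \<in> bergman_space W" for k
    using L2_on_diff[OF g L[OF that]] .
  \<comment> \<open>Parallelogram law for \<open>g - h n\<close> and \<open>g - h m\<close>: the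
    midpoint \<open>k\<close> lies in the space, so its squared distance to \<open>g\<close> is at
    least \<open>d\<close>.\<close>
  have par: "(L2_norm_on W (\<lambda>z. h m z - h n z))\<^sup>2 \<le> 2 * \<delta> (h m) + 2 * \<delta> (h n) - 4 * d" for m n
  proof -
    define u where "u = (\<lambda>z. g z - h n z)"
    define v where "v = (\<lambda>z. g z - h m z)"
    have uv: "u \<in> L2_on W" "v \<in> L2_on W" unfolding u_def v_def using gd h(1) by auto
    define k where "k = (\<lambda>z. (1/2) * (h m z + h n z))"
    have k: "k \<in> bergman_space W" unfolding k_def using bergman_space_scale[OF bergman_space_add[OF h(1) h(1)]] .
    have "(\<lambda>z. u z + v z) = (\<lambda>z. 2 * (g z - k z))" by (auto simp: u_def v_def k_def field_simps)
    then have "(L2_norm_on W (\<lambda>z. u z + v z))\<^sup>2 = 4 * \<delta> k"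
      by (simp only: L2_norm_scale \<delta>_def) (simp add: power_mult_distrib)
    moreover have "(\<lambda>z. h m z - h n z) = (\<lambda>z. u z - v z)" by (auto simp: u_def v_def)
    moreover have "\<delta> (h n) = (L2_norm_on W u)\<^sup>2" "\<delta> (h m) = (L2_norm_on W v)\<^sup>2"
      by (simp_all add: \<delta>_def u_def v_def)
    ultimately show ?thesis
      using L2_norm_add_sq[OF uv] L2_norm_diff_sq[OF uv] d_le[OF k] by simp
  qed
  have "\<exists>N. \<forall>m\<ge>N. \<forall>n\<ge>N. L2_norm_on W (\<lambda>z. h m z - h n z) \<le> e" if "e > 0" for e
  proof -
    have "e\<^sup>2 / 4 > 0" using that by simp
    from reals_Archimedean[OF this] obtain N where N: "1 / real (Suc N) < e\<^sup>2 / 4"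
      unfolding inverse_eq_divide by blast
    have "L2_norm_on W (\<lambda>z. h m z - h n z) \<le> e" if "m \<ge> N" "n \<ge> N" for m n
    proof (rule power2_le_imp_le)
      have "1 / real (Suc m) \<le> 1 / real (Suc N)" "1 / real (Suc n) \<le> 1 / real (Suc N)"
        using that by (auto simp: frac_le)
      then show "(L2_norm_on W (\<lambda>z. h m z - h n z))\<^sup>2 \<le> e\<^sup>2"
        using par[of m n] h(2)[of m] h(2)[of n] N by linarith
    qed (use \<open>e > 0\<close> in simp)
    then show ?thesis by blast
  qed
  then obtain H where H: "H \<in> bergman_space W" "(\<lambda>n. L2_norm_on W (\<lambda>z. h n z - H z)) \<longlonglongrightarrow> 0"
    using bergman_complete[of W h, OF W h(1)] by blast
  have "\<delta> H \<le> d"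
  proof (rule LIMSEQ_le_const)
    have "(\<lambda>n. (sqrt (d + 1 / real (Suc n)) + L2_norm_on W (\<lambda>z. h n z - H z))\<^sup>2)
      \<longlonglongrightarrow> (sqrt (d + 0) + 0)\<^sup>2"
      by (intro tendsto_power tendsto_add tendsto_real_sqrt tendsto_const H(2)
            LIMSEQ_inverse_real_of_nat[unfolded inverse_eq_divide])
    moreover have "d \<ge> 0" unfolding d_def by (rule cInf_greatest[OF ne]) (auto simp: \<delta>_def)
    ultimately show "(\<lambda>n. (sqrt (d + 1 / real (Suc n)) + L2_norm_on W (\<lambda>z. h n z - H z))\<^sup>2) \<longlonglongrightarrow> d"
      by simp
  next
    show "\<exists>N. \<forall>n\<ge>N. \<delta> H \<le> (sqrt (d + 1 / real (Suc n)) + L2_norm_on W (\<lambda>z. h n z - H z))\<^sup>2"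
    proof (intro exI[of _ 0] allI impI)
      fix n
      have "L2_norm_on W (\<lambda>z. g z - H z) \<le> L2_norm_on W (\<lambda>z. g z - h n z) + L2_norm_on W (\<lambda>z. h n z - H z)"
        by (rule L2_norm_triangle_diff[OF g L[OF h(1)] L[OF H(1)]])
      also have "L2_norm_on W (\<lambda>z. g z - h n z) \<le> sqrt (d + 1 / real (Suc n))"
        by (rule real_le_rsqrt) (use h(2)[of n] in \<open>simp add: \<delta>_def\<close>)
      finally show "\<delta> H \<le> (sqrt (d + 1 / real (Suc n)) + L2_norm_on W (\<lambda>z. h n z - H z))\<^sup>2"
        unfolding \<delta>_def by (intro power_mono) auto
    qed
  qed
  have "L2_inner_on W (\<lambda>z. g z - H z) k = 0" if k: "k \<in> bergman_space W" for k
  proof (cases "L2_norm_on W k = 0")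
    case True
    then show ?thesis using L2_Cauchy_Schwarz[OF gd[OF H(1)] L[OF k]] by simp
  next
    case False
    define n where "n = L2_norm_on W k"
    have n: "n > 0" using False L2_norm_nonneg[of W k] unfolding n_def by linarith
    define a where "a = L2_inner_on W (\<lambda>z. g z - H z) k"
    \<comment> \<open>Adding this multiple of \<open>k\<close> to \<open>H\<close> would lower the
      squared distance by \<open>(norm a)^2 / n^2\<close>; minimality of \<open>H\<close> forbids it
      unless \<open>a = 0\<close>.\<close>
    define c where "c = a / of_real (n\<^sup>2)"
    have "(\<lambda>z. H z + c * k z) \<in> bergman_space W"
      using bergman_space_add[OF H(1) bergman_space_scale[OF k]] .
    from d_le[OF this] have "\<delta> H \<le> (L2_norm_on W (\<lambda>z. (g z - H z) - c * k z))\<^sup>2"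
      using \<open>\<delta> H \<le> d\<close> unfolding \<delta>_def diff_diff_add by linarith
    also have "\<dots> = \<delta> H - 2 * Re (cnj c * a) + (norm c * n)\<^sup>2"
      using L2_norm_diff_sq[OF gd[OF H(1)] L2_on_scale[OF L[OF k], of c]]
      by (simp add: L2_inner_scale_right L2_norm_scale n_def a_def \<delta>_def)
    also have "cnj c * a = of_real ((norm a)\<^sup>2 / n\<^sup>2)"
      unfolding c_def using complex_norm_square[of a] by (simp add: mult.commute)
    also have "(norm c * n)\<^sup>2 = (norm a)\<^sup>2 / n\<^sup>2"
      using n by (simp add: c_def norm_divide power_mult_distrib power_divide field_simps norm_power)
    finally have "(norm a)\<^sup>2 / n\<^sup>2 \<le> 0" by simp
    then have "(norm a)\<^sup>2 \<le> 0" using n by (simp add: field_simps)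
    then show ?thesis by (simp add: a_def)
  qed
  then show ?thesis using H(1) that by blast
qed

text \<open>Two candidates differ by an element orthogonal to itself, hence of norm 0; the point
  estimate on \<open>W\<close> and the normalisation off \<open>W\<close> make it the zero function.
  This is what allows the definite description to be evaluated.\<close>

lemma bergman_proj_eqI:
  assumes W: "open W" and g: "g \<in> L2_on W" and h: "h \<in> bergman_space W"
    and orth: "\<And>k. k \<in> bergman_space W \<Longrightarrow> L2_inner_on W (\<lambda>z. g z - h z) k = 0"
  shows "bergman_proj W g = h"
  unfolding bergman_proj_def
proof (rule the_equality)
  fix h' assume h': "h' \<in> bergman_space W \<and> (\<forall>k\<in>bergman_space W. L2_inner_on W (\<lambda>z. g z - h' z) k = 0)"
  define u where "u = (\<lambda>z. h z - h' z)"
  have u: "u \<in> bergman_space W" unfolding u_def using bergman_space_diff h h' by blast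
  note L = bergman_spaceD(2)
  have "L2_inner_on W u u = L2_inner_on W (\<lambda>z. (g z - h' z) - (g z - h z)) u"
    by (simp add: u_def)
  also have "\<dots> = 0"
    using h h' u orth[OF u] by (subst L2_inner_diff_left) (auto intro!: L2_on_diff g intro: L)
  finally have "L2_norm_on W u = 0" by (simp add: L2_inner_self)
  from bergman_norm_zero[OF W u this] show "h' = h" by (auto simp: u_def fun_eq_iff)
qed (use h orth in auto)

lemma bergman_proj_props:
  assumes "open W" "g \<in> L2_on W"
  shows "bergman_proj W g \<in> bergman_space W"
    and "k \<in> bergman_space W \<Longrightarrow> L2_inner_on W (\<lambda>z. g z - bergman_proj W g z) k = 0"
  using bergman_projection_exists[OF assms] bergman_proj_eqI[OF assms] by metis+

text \<open>Pythagoras. It bounds the norm of a Hankel image by the distance to any trial function,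
  so the projection itself need not be computed.\<close>

lemma bergman_proj_dist:
  assumes W: "open W" and g: "g \<in> L2_on W" and k: "k \<in> bergman_space W"
  shows "L2_norm_on W (\<lambda>z. g z - bergman_proj W g z) \<le> L2_norm_on W (\<lambda>z. g z - k z)"
proof (rule power2_le_imp_le)
  note P = bergman_proj_props[OF W g]
  have d: "(\<lambda>z. bergman_proj W g z - k z) \<in> bergman_space W" by (rule bergman_space_diff[OF P(1) k])
  have "(L2_norm_on W (\<lambda>z. (g z - bergman_proj W g z) + (bergman_proj W g z - k z)))\<^sup>2 =
    (L2_norm_on W (\<lambda>z. g z - bergman_proj W g z))\<^sup>2 + (L2_norm_on W (\<lambda>z. bergman_proj W g z - k z))\<^sup>2"
    using P(2)[OF d] L2_norm_add_sq[OF L2_on_diff[OF g bergman_spaceD(2)[OF P(1)]] bergman_spaceD(2)[OF d]] by simp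
  then show "(L2_norm_on W (\<lambda>z. g z - bergman_proj W g z))\<^sup>2 \<le> (L2_norm_on W (\<lambda>z. g z - k z))\<^sup>2"
    by simp
qed simp

lemma bergman_proj_add:
  assumes W: "open W" and g: "g \<in> L2_on W" "g' \<in> L2_on W"
  shows "bergman_proj W (\<lambda>z. g z + g' z) = (\<lambda>z. bergman_proj W g z + bergman_proj W g' z)"
proof (rule bergman_proj_eqI[OF W L2_on_add[OF g]])
  note P = bergman_proj_props[OF W g(1)] and P' = bergman_proj_props[OF W g(2)]
  show "(\<lambda>z. bergman_proj W g z + bergman_proj W g' z) \<in> bergman_space W"
    by (rule bergman_space_add[OF P(1) P'(1)])
  fix k assume k: "k \<in> bergman_space W"
  have "L2_inner_on W (\<lambda>z. (g z - bergman_proj W g z) + (g' z - bergman_proj W g' z)) k = 0"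
    using P(2)[OF k] P'(2)[OF k]
    by (subst L2_inner_add_left) (auto intro!: L2_on_diff g intro: bergman_spaceD(2) P(1) P'(1) k)
  then show "L2_inner_on W (\<lambda>z. g z + g' z - (bergman_proj W g z + bergman_proj W g' z)) k = 0"
    by (simp add: algebra_simps)
qed

lemma bergman_proj_scale:
  assumes W: "open W" and g: "g \<in> L2_on W"
  shows "bergman_proj W (\<lambda>z. c * g z) = (\<lambda>z. c * bergman_proj W g z)"
proof (rule bergman_proj_eqI[OF W L2_on_scale[OF g]])
  note P = bergman_proj_props[OF W g]
  show "(\<lambda>z. c * bergman_proj W g z) \<in> bergman_space W" by (rule bergman_space_scale[OF P(1)])
  fix k assume "k \<in> bergman_space W"
  then show "L2_inner_on W (\<lambda>z. c * g z - c * bergman_proj W g z) k = 0"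
    using P(2) by (simp add: right_diff_distrib[symmetric] L2_inner_scale_left)
qed

section \<open>Hankel operators with bounded symbol\<close>

context
  fixes W :: "(complex \<times> complex) set" and \<phi> :: "complex \<times> complex \<Rightarrow> complex" and C :: real
  assumes W: "open W" and \<phi>: "\<phi> \<in> borel_measurable (lebesgue_on W)"
    and C: "\<And>z. z \<in> W \<Longrightarrow> norm (\<phi> z) \<le> C" "C \<ge> 0"
begin

lemma symbol_mult_L2:
  "f \<in> bergman_space W \<Longrightarrow> (\<lambda>z. \<phi> z * f z) \<in> L2_on W"
  by (rule L2_on_mult_bounded[OF bergman_spaceD(2) \<phi> C(1)])

lemma hankel_L2:
  assumes f: "f \<in> bergman_space W" shows "hankel W \<phi> f \<in> L2_on W"
  unfolding hankel_def
  by (rule L2_on_diff[OF symbol_mult_L2[OF f]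
      bergman_spaceD(2)[OF bergman_proj_props(1)[OF W symbol_mult_L2[OF f]]]])

lemma hankel_norm_le:
  assumes f: "f \<in> bergman_space W" shows "L2_norm_on W (hankel W \<phi> f) \<le> C * L2_norm_on W f"
proof -
  have "L2_norm_on W (hankel W \<phi> f) \<le> L2_norm_on W (\<lambda>z. \<phi> z * f z - 0)"
    unfolding hankel_def by (rule bergman_proj_dist[OF W symbol_mult_L2[OF f] bergman_space_zero])
  also have "\<dots> \<le> C * L2_norm_on W f"
    using L2_norm_mult_bounded[OF bergman_spaceD(2)[OF f] \<phi> C] by simp
  finally show ?thesis .
qed

lemma hankel_add:
  assumes "f \<in> bergman_space W" "g \<in> bergman_space W"
  shows "hankel W \<phi> (\<lambda>w. f w + g w) z = hankel W \<phi> f z + hankel W \<phi> g z"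
  using bergman_proj_add[OF W symbol_mult_L2[OF assms(1)] symbol_mult_L2[OF assms(2)]]
  by (simp add: hankel_def distrib_left)

lemma hankel_scale:
  assumes "f \<in> bergman_space W"
  shows "hankel W \<phi> (\<lambda>w. c * f w) z = c * hankel W \<phi> f z"
  using bergman_proj_scale[OF W symbol_mult_L2[OF assms], of c]
  by (simp add: hankel_def right_diff_distrib mult.left_commute)

lemma hankel_sum:
  assumes "finite S" "S \<subseteq> bergman_space W"
  shows "hankel W \<phi> (\<lambda>w. \<Sum>\<xi>\<in>S. c \<xi> * \<xi> w) z = (\<Sum>\<xi>\<in>S. c \<xi> * hankel W \<phi> \<xi> z)"
  using assms
proof (induction S rule: finite_induct)
  case empty
  show ?case using hankel_scale[OF bergman_space_zero, of 0] by simp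
next
  case (insert x F)
  then have "(\<lambda>w. \<Sum>\<xi>\<in>F. c \<xi> * \<xi> w) \<in> bergman_space W"
    by (intro bergman_space_sum bergman_space_scale) auto
  then show ?case
    using insert hankel_add[of "\<lambda>w. c x * x w" "\<lambda>w. \<Sum>\<xi>\<in>F. c \<xi> * \<xi> w"]
    by (simp add: hankel_scale bergman_space_scale)
qed

lemma hankel_bounded_linear: "bounded_linear_bergman W (hankel W \<phi>)"
  unfolding bounded_linear_bergman_def
  using hankel_L2 hankel_add hankel_scale hankel_norm_le by (auto intro!: exI[of _ C])

end

section \<open>Fourier uniqueness on the torus\<close>

abbreviation unit_torus :: "(complex \<times> complex) set" where
  "unit_torus \<equiv> sphere 0 1 \<times> sphere 0 1"

lemma continuous_on_tor:
  "continuous_on unit_torus F \<Longrightarrow> continuous_on S (\<lambda>p. F (tor p))"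
  by (rule continuous_on_compose2[of unit_torus F]) (auto intro!: continuous_intros)

lemma torus_mean_cong:
  assumes "\<And>u. u \<in> unit_torus \<Longrightarrow> F u = G u"
  shows "torus_mean F = torus_mean G"
  unfolding torus_mean_def using assms by (intro integral_cong) auto

lemma torus_mean_add:
  assumes "continuous_on unit_torus F" "continuous_on unit_torus G"
  shows "torus_mean (\<lambda>u. F u + G u) = torus_mean F + torus_mean G"
  unfolding torus_mean_def
  by (rule Henstock_Kurzweil_Integration.integral_add)
    (auto intro!: integrable_continuous continuous_on_tor assms)

lemma torus_mean_cmult: "torus_mean (\<lambda>u. c * F u) = c * torus_mean F"
  unfolding torus_mean_def by simp

lemma torus_mean_bound:
  assumes "continuous_on unit_torus F" "B \<ge> 0" "\<And>u. u \<in> unit_torus \<Longrightarrow> norm (F u) \<le> B"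
  shows "norm (torus_mean F) \<le> B"
proof -
  have "((\<lambda>p. F (tor p)) has_integral torus_mean F) (cbox (0,0) (1,1))"
    unfolding torus_mean_def
    by (intro integrable_integral integrable_continuous continuous_on_tor assms)
  from has_integral_bound[OF assms(2) this] have "norm (torus_mean F) \<le> B * measure lborel (cbox (0::real, 0::real) (1,1))"
    using assms(3) by auto
  then show ?thesis using emeasure_unit_square by (simp add: measure_def)
qed

text \<open>For negative exponents \<open>powi\<close> takes the junk value 0 at 0, so the multiplicative laws of \<open>tmono\<close>
  hold only off the coordinate axes.\<close>

definition tmono :: "int \<Rightarrow> int \<Rightarrow> complex \<times> complex \<Rightarrow> complex" where
  "tmono m n z = (fst z powi m) * (snd z powi n)"

lemma tmono_mult:
  assumes "fst z \<noteq> 0" "snd z \<noteq> 0"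
  shows "tmono m n z * tmono k l z = tmono (m + k) (n + l) z"
  using assms by (simp add: tmono_def power_int_add)

definition fourier_null :: "(complex \<times> complex \<Rightarrow> complex) \<Rightarrow> bool" where
  "fourier_null F \<longleftrightarrow> continuous_on unit_torus F \<and> (\<forall>m n. torus_mean (\<lambda>u. tmono m n u * F u) = 0)"

lemma continuous_on_tmono: "continuous_on unit_torus (tmono m n)"
  unfolding tmono_def by (intro continuous_intros) auto

lemma fourier_null_add:
  assumes "fourier_null F" "fourier_null G"
  shows "fourier_null (\<lambda>u. F u + G u)"
proof -
  have c: "continuous_on unit_torus (\<lambda>u. tmono m n u * F u)" "continuous_on unit_torus (\<lambda>u. tmono m n u * G u)" for m n
    using assms unfolding fourier_null_def by (auto intro!: continuous_intros continuous_on_tmono)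
  show ?thesis
    using assms torus_mean_add[OF c] unfolding fourier_null_def
    by (auto simp: distrib_left intro!: continuous_intros)
qed

lemma fourier_null_cmult:
  assumes "fourier_null F" shows "fourier_null (\<lambda>u. c * F u)"
  using assms torus_mean_cmult[of c] unfolding fourier_null_def
  by (auto simp: mult.left_commute intro!: continuous_intros)

text \<open>Multiplication by a character only shifts the indices, and the condition runs over all
  integers.\<close>

lemma fourier_null_tmono:
  assumes "fourier_null F" shows "fourier_null (\<lambda>u. tmono k l u * F u)"
  unfolding fourier_null_def
proof (intro conjI allI)
  show "continuous_on unit_torus (\<lambda>u. tmono k l u * F u)"
    using assms unfolding fourier_null_def by (auto intro!: continuous_intros continuous_on_tmono)
  fix m n
  have "torus_mean (\<lambda>u. tmono m n u * (tmono k l u * F u)) = torus_mean (\<lambda>u. tmono (m + k) (n + l) u * F u)"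
  proof (rule torus_mean_cong)
    fix u :: "complex \<times> complex" assume "u \<in> unit_torus"
    then have "fst u \<noteq> 0" "snd u \<noteq> 0" by auto
    then show "tmono m n u * (tmono k l u * F u) = tmono (m + k) (n + l) u * F u"
      by (simp add: tmono_mult mult.assoc[symmetric])
  qed
  then show "torus_mean (\<lambda>u. tmono m n u * (tmono k l u * F u)) = 0"
    using assms unfolding fourier_null_def by simp
qed

lemma fourier_null_cong:
  assumes "fourier_null F" "\<And>u. u \<in> unit_torus \<Longrightarrow> F u = G u"
  shows "fourier_null G"
  using assms(1) continuous_on_cong[of unit_torus unit_torus F G]
    torus_mean_cong[of "\<lambda>u. tmono m n u * F u" "\<lambda>u. tmono m n u * G u" for m n] assms(2)
  unfolding fourier_null_def by simp

text \<open>On the unit circle the inverse is the conjugate. Real coordinates thereby become Laurent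
  polynomials, which brings the real polynomials of Stone-Weierstrass within reach of
  characters.\<close>

lemma unit_circle_Re_Im:
  fixes a :: complex
  assumes "norm a = 1"
  shows "complex_of_real (Re a) = (a + inverse a) / 2" "complex_of_real (Im a) = (a - inverse a) / (2 * \<i>)"
proof -
  have "inverse a = cnj a"
    using assms complex_norm_square[of a] by (metis inverse_unique of_real_1 one_power2)
  then show "complex_of_real (Re a) = (a + inverse a) / 2" "complex_of_real (Im a) = (a - inverse a) / (2 * \<i>)"
    by (simp_all add: complex_eq_iff)
qed

lemma real_linear_on_unit_torus:
  assumes "bounded_linear (L :: complex \<times> complex \<Rightarrow> real)"
  obtains c1 c2 c3 c4 where "\<And>u. u \<in> unit_torus \<Longrightarrow>
    complex_of_real (L u) = c1 * tmono 1 0 u + c2 * tmono (-1) 0 u + c3 * tmono 0 1 u + c4 * tmono 0 (-1) u"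
proof -
  interpret bounded_linear L by fact
  have "L u = Re (fst u) * L (1, 0) + Im (fst u) * L (\<i>, 0) + Re (snd u) * L (0, 1) + Im (snd u) * L (0, \<i>)" for u
  proof -
    have "u = Re (fst u) *\<^sub>R (1, 0) + Im (fst u) *\<^sub>R (\<i>, 0) + Re (snd u) *\<^sub>R (0, 1) + Im (snd u) *\<^sub>R (0, \<i>)"
      by (auto simp: prod_eq_iff complex_eq_iff)
    then have "L u = L (Re (fst u) *\<^sub>R (1, 0) + Im (fst u) *\<^sub>R (\<i>, 0) + Re (snd u) *\<^sub>R (0, 1) + Im (snd u) *\<^sub>R (0, \<i>))"
      by simp
    also have "\<dots> = Re (fst u) * L (1, 0) + Im (fst u) * L (\<i>, 0) + Re (snd u) * L (0, 1) + Im (snd u) * L (0, \<i>)"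
      by (simp only: add scaleR real_scaleR_def)
    finally show ?thesis .
  qed
  note L = this
  have split: "(a + a') / 2 * p + (a - a') / (2 * \<i>) * q = (p / 2 + q / (2 * \<i>)) * a + (p / 2 - q / (2 * \<i>)) * a'"
    for a a' p q :: complex
    by (simp add: add_divide_distrib diff_divide_distrib distrib_right distrib_left left_diff_distrib
        right_diff_distrib mult.commute)
  have "complex_of_real (L u) =
      (L (1, 0) / 2 + L (\<i>, 0) / (2 * \<i>)) * tmono 1 0 u + (L (1, 0) / 2 - L (\<i>, 0) / (2 * \<i>)) * tmono (-1) 0 u
    + (L (0, 1) / 2 + L (0, \<i>) / (2 * \<i>)) * tmono 0 1 u + (L (0, 1) / 2 - L (0, \<i>) / (2 * \<i>)) * tmono 0 (-1) u"
    if "u \<in> unit_torus" for u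
  proof -
    have n: "norm (fst u) = 1" "norm (snd u) = 1" using that by auto
    have t: "tmono 1 0 u = fst u" "tmono (-1) 0 u = inverse (fst u)" "tmono 0 1 u = snd u"
      "tmono 0 (-1) u = inverse (snd u)" by (simp_all add: tmono_def power_int_minus)
    show ?thesis
      unfolding t L[of u] of_real_add of_real_mult unit_circle_Re_Im[OF n(1)] unit_circle_Re_Im[OF n(2)]
      by (simp only: split add.assoc[symmetric]) (simp only: split add.assoc of_real_divide of_real_numeral)
  qed
  then show ?thesis using that by blast
qed

text \<open>On the torus a linear functional is a combination of four characters, so the base case
  is an index shift. \<open>F\<close> stays arbitrary in the induction because a product is absorbed
  one factor at a time.\<close>

lemma fourier_null_real_polynomial:
  assumes "real_polynomial_function p" "fourier_null F"
  shows "fourier_null (\<lambda>u. complex_of_real (p u) * F u)"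
  using assms
proof (induction p arbitrary: F rule: real_polynomial_function.induct)
  case (linear L)
  obtain c1 c2 c3 c4 where L: "\<And>u. u \<in> unit_torus \<Longrightarrow>
    complex_of_real (L u) = c1 * tmono 1 0 u + c2 * tmono (-1) 0 u + c3 * tmono 0 1 u + c4 * tmono 0 (-1) u"
    using real_linear_on_unit_torus[OF linear(1)] by metis
  have "fourier_null (\<lambda>u. c1 * (tmono 1 0 u * F u) + c2 * (tmono (-1) 0 u * F u)
      + c3 * (tmono 0 1 u * F u) + c4 * (tmono 0 (-1) u * F u))"
    by (intro fourier_null_add fourier_null_cmult fourier_null_tmono linear)
  then show ?case
    by (rule fourier_null_cong) (simp add: L distrib_right mult.assoc)
next
  case (const c)
  then show ?case by (rule fourier_null_cmult)
next
  case (add f g)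
  then show ?case using fourier_null_add[OF add.IH(1) add.IH(2)] by (simp add: distrib_right)
next
  case (mult f g)
  then show ?case using mult.IH(1)[OF mult.IH(2)] by (simp add: mult.assoc)
qed

text \<open>Null Fourier coefficients are preserved under multiplication by real polynomials, and
  \<open>cnj F\<close> is a uniform limit of such polynomials by Stone-Weierstrass.\<close>

lemma fourier_null_mean_square:
  assumes F: "fourier_null F"
  shows "torus_mean (\<lambda>u. cnj (F u) * F u) = 0"
proof -
  have c: "continuous_on unit_torus F" using F by (simp add: fourier_null_def)
  have comp: "compact unit_torus" by (intro compact_Times compact_sphere)
  obtain M where M: "\<And>u. u \<in> unit_torus \<Longrightarrow> norm (F u) \<le> M" "M > 0"
    using compact_imp_bounded[OF compact_continuous_image[OF c comp]] unfolding bounded_pos by force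
  have "norm (torus_mean (\<lambda>u. cnj (F u) * F u)) \<le> e" if e: "e > 0" for e
  proof -
    have cc: "continuous_on unit_torus (\<lambda>u. cnj (F u))" by (intro continuous_intros c)
    \<comment> \<open>The tolerance is \<open>e / M\<close> because the error is later multiplied by
      \<open>F\<close>, which is bounded by \<open>M\<close>.\<close>
    obtain g where g: "polynomial_function g" "\<And>u. u \<in> unit_torus \<Longrightarrow> norm (cnj (F u) - g u) < e / M"
      using Stone_Weierstrass_polynomial_function[OF comp cc, of "e / M"] M(2) e by auto
    have "real_polynomial_function (Re \<circ> g)" "real_polynomial_function (Im \<circ> g)"
      using g(1) bounded_linear_Re bounded_linear_Im unfolding polynomial_function_def by blast+
    note re_im = this
    have split: "complex_of_real (Re x) * y + \<i> * (complex_of_real (Im x) * y) = x * y" for x y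
      by (metis complex_eq distrib_right mult.assoc)
    from fourier_null_add[OF fourier_null_real_polynomial[OF re_im(1) F]
        fourier_null_cmult[OF fourier_null_real_polynomial[OF re_im(2) F], of \<i>]]
    have "fourier_null (\<lambda>u. g u * F u)"
      by (simp only: o_def split)
    \<comment> \<open>This is the coefficient with both indices 0, where the character is the
      constant 1.\<close>
    then have gF: "torus_mean (\<lambda>u. g u * F u) = 0" and cg: "continuous_on unit_torus (\<lambda>u. g u * F u)"
      unfolding fourier_null_def by (auto dest!: spec[of _ 0] simp: tmono_def)
    have gc: "continuous_on unit_torus g" using g(1) by (rule continuous_on_polymonial_function)
    have "torus_mean (\<lambda>u. cnj (F u) * F u) = torus_mean (\<lambda>u. (cnj (F u) - g u) * F u + g u * F u)"
      by (simp add: algebra_simps)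
    also have "\<dots> = torus_mean (\<lambda>u. (cnj (F u) - g u) * F u)"
      using gF by (subst torus_mean_add) (auto intro!: continuous_intros c gc)
    finally have eq: "torus_mean (\<lambda>u. cnj (F u) * F u) = torus_mean (\<lambda>u. (cnj (F u) - g u) * F u)" .
    show ?thesis unfolding eq
    proof (rule torus_mean_bound)
      show "continuous_on unit_torus (\<lambda>u. (cnj (F u) - g u) * F u)" by (auto intro!: continuous_intros c gc)
      show "norm ((cnj (F u) - g u) * F u) \<le> e" if "u \<in> unit_torus" for u
      proof -
        have "norm (cnj (F u) - g u) * norm (F u) \<le> e / M * M"
          using g(2)[OF that] M e that by (intro mult_mono) auto
        then show ?thesis using M(2) by (simp add: norm_mult)
      qed
    qed (use e in simp)
  qed
  then show ?thesis by (metis field_le_epsilon add_0 norm_le_zero_iff)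
qed

section \<open>Volumes and divergent monomial integrals\<close>

lemma emeasure_complex_ball:
  assumes "r \<ge> 0" shows "emeasure lborel (ball (0::complex) r) = ennreal (pi * r\<^sup>2)"
    and "emeasure lborel (cball (0::complex) r) = ennreal (pi * r\<^sup>2)"
  using emeasure_ball[OF assms, of "0::complex"] emeasure_cball[OF assms, of "0::complex"]
  by (simp_all add: eval_unit_ball_vol)

lemma emeasure_annulus:
  assumes "0 \<le> a" "a \<le> b"
  shows "emeasure lborel {z::complex. a < norm z \<and> norm z < b} = ennreal (pi * (b\<^sup>2 - a\<^sup>2))"
    and "emeasure lborel {z::complex. a \<le> norm z \<and> norm z < b} = ennreal (pi * (b\<^sup>2 - a\<^sup>2))"
proof -
  have "{z::complex. a \<le> norm z \<and> norm z < b} = ball 0 b - ball 0 a" by auto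
  also have "emeasure lborel (ball (0::complex) b - ball 0 a) = ennreal (pi * b\<^sup>2) - ennreal (pi * a\<^sup>2)"
    using assms by (subst emeasure_Diff) (auto simp: emeasure_complex_ball)
  finally show "emeasure lborel {z::complex. a \<le> norm z \<and> norm z < b} = ennreal (pi * (b\<^sup>2 - a\<^sup>2))"
    using assms by (simp add: ennreal_minus right_diff_distrib)
  show "emeasure lborel {z::complex. a < norm z \<and> norm z < b} = ennreal (pi * (b\<^sup>2 - a\<^sup>2))"
  proof (cases "a = b")
    case True
    then have e: "{z::complex. a < norm z \<and> norm z < b} = {}" by auto
    show ?thesis unfolding e using True by simp
  next
    case False
    have "{z::complex. a < norm z \<and> norm z < b} = ball 0 b - cball 0 a" by auto
    also have "emeasure lborel (ball (0::complex) b - cball 0 a) = ennreal (pi * b\<^sup>2) - ennreal (pi * a\<^sup>2)"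
      using assms False by (subst emeasure_Diff) (auto simp: emeasure_complex_ball)
    finally show ?thesis
      using assms by (simp add: ennreal_minus right_diff_distrib)
  qed
qed

lemma annulus_borel [measurable]:
  "{z::complex. a < norm z \<and> norm z < b} \<in> sets borel" "{z::complex. a \<le> norm z \<and> norm z < b} \<in> sets borel"
  by measurable

lemma emeasure_lborel_Times:
  assumes "A \<in> sets borel" "B \<in> sets borel"
  shows "emeasure lborel (A \<times> B :: (complex \<times> complex) set) = emeasure lborel A * emeasure lborel B"
  unfolding lborel_prod[symmetric]
  by (rule lborel.emeasure_pair_measure_Times) (use assms in auto)

lemma emeasure_finite_by_cover:
  fixes f :: "nat \<Rightarrow> real"
  assumes "A \<subseteq> (\<Union>i. B i)" "\<And>i. B i \<in> sets lborel"
    and "\<And>i. emeasure lborel (B i) \<le> ennreal (f i)" "summable f" "\<And>i. f i \<ge> 0"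
  shows "emeasure lborel A < \<infinity>"
proof -
  have "emeasure lborel A \<le> emeasure lborel (\<Union>i. B i)"
    using assms by (intro emeasure_mono) auto
  also have "\<dots> \<le> (\<Sum>i. emeasure lborel (B i))"
    by (rule emeasure_subadditive_countably) (use assms in auto)
  also have "\<dots> \<le> (\<Sum>i. ennreal (f i))"
    by (intro suminf_le assms) auto
  also have "\<dots> = ennreal (suminf f)" using assms by (intro suminf_ennreal2) auto
  also have "\<dots> < \<infinity>" by simp
  finally show ?thesis .
qed

lemma summable_inverse_squares: "summable (\<lambda>i. c / (real i + real (Suc k))\<^sup>2)"
proof -
  have "summable (\<lambda>i. inverse (real (i + Suc k) ^ 2))"
    using inverse_power_summable[of 2, where 'a=real] summable_iff_shift[of "\<lambda>i. inverse (real i ^ 2)" "Suc k"] by simp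
  from summable_mult[OF this, of c] show ?thesis
    by (simp add: divide_inverse add_ac)
qed

text \<open>On the shell from modulus \<open>4^(i+1)\<close> to \<open>4^(i+2)\<close> the logarithm
  is at least \<open>i + 1\<close>, which bounds the fibre radius. Covering the shell by a whole
  disc loses only a constant factor, and the volumes are \<open>4 * pi^2 / (i+1)^2\<close>.\<close>

lemma set_X_finite: "emeasure lborel set_X < \<infinity>"
proof (rule emeasure_finite_by_cover)
  show "set_X \<subseteq> (\<Union>i. ball 0 (4 ^ (i + 2)) \<times> ball 0 (1 / (2 * 4 ^ (i + 1) * (real i + 1))))"
  proof (clarify)
    fix z1 z2 :: complex assume "(z1, z2) \<in> set_X"
    then have z: "norm z1 > 4" "norm z2 < 1 / (2 * norm z1 * log 4 (norm z1))" by (auto simp: set_X_def)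
    define L where "L = log 4 (norm z1)"
    have "norm z1 > 0" using z(1) by linarith
    then have "log 4 4 < log 4 (norm z1)" using z(1) by (subst log_less_cancel_iff) auto
    then have L: "L > 1" unfolding L_def by simp
    define i where "i = nat (\<lfloor>L\<rfloor> - 1)"
    have i: "real i + 1 \<le> L" "L < real i + 2" unfolding i_def using L by linarith+
    have p: "norm z1 = 4 powr L" unfolding L_def using \<open>norm z1 > 0\<close> by simp
    have pw: "(4::real) ^ j = 4 powr real j" for j by (simp only: powr_realpow zero_less_numeral)
    have lo: "4 ^ (i + 1) \<le> norm z1"
      unfolding p pw by (rule powr_mono) (use i in auto)
    have hi: "norm z1 < 4 ^ (i + 2)"
      unfolding p pw by (rule powr_less_mono) (use i in auto)
    have "2 * 4 ^ (i + 1) * (real i + 1) \<le> 2 * norm z1 * L"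
      using lo i by (intro mult_mono) auto
    then have "1 / (2 * norm z1 * L) \<le> 1 / (2 * 4 ^ (i + 1) * (real i + 1))"
      by (intro divide_left_mono mult_pos_pos) (use L z(1) in auto)
    then have "norm z2 < 1 / (2 * 4 ^ (i + 1) * (real i + 1))" using z(2) unfolding L_def by linarith
    then show "(z1, z2) \<in> (\<Union>i. ball 0 (4 ^ (i + 2)) \<times> ball 0 (1 / (2 * 4 ^ (i + 1) * (real i + 1))))"
      using hi by auto
  qed
  show "summable (\<lambda>i. 4 * pi\<^sup>2 / (real i + real (Suc 0))\<^sup>2)" by (rule summable_inverse_squares)
  show "emeasure lborel (ball (0::complex) (4 ^ (i + 2)) \<times> ball (0::complex) (1 / (2 * 4 ^ (i + 1) * (real i + 1))))
      \<le> ennreal (4 * pi\<^sup>2 / (real i + real (Suc 0))\<^sup>2)" for i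
  proof -
    have q: "(4::real) ^ (i + 2) = 4 * 4 ^ (i + 1)" by simp
    have "pi * (4 * q)\<^sup>2 * (pi * (1 / (2 * q * w))\<^sup>2) = 4 * pi\<^sup>2 / w\<^sup>2" if "q > 0" "w > 0" for q w :: real
      using that by (simp add: field_simps power2_eq_square)
    from this[of "4 ^ (i + 1)" "real i + 1"] have "pi * (4 ^ (i + 2))\<^sup>2 * (pi * (1 / (2 * 4 ^ (i + 1) * (real i + 1)))\<^sup>2) = 4 * pi\<^sup>2 / (real i + 1)\<^sup>2"
      unfolding q by simp
    then show ?thesis
      by (subst emeasure_lborel_Times) (auto simp: emeasure_complex_ball ennreal_mult[symmetric] simp del: power_Suc)
  qed
qed (auto simp: borel_open open_Times)

text \<open>From \<open>s - S = (s^2 - S^2) / (s + S)\<close>. Over a shell of unit length in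
  \<open>s^2\<close> the centre \<open>1 / s\<close> of the tube thus drifts by at most half of
  \<open>1 / S^3\<close>.\<close>

lemma sqrt_bracket:
  fixes S s :: real
  assumes "0 < S" "S \<le> s" "s\<^sup>2 \<le> S\<^sup>2 + 1"
  shows "0 \<le> 1 / S - 1 / s" "1 / S - 1 / s \<le> 1 / (2 * S ^ 3)"
proof -
  have s: "s > 0" using assms by linarith
  show "0 \<le> 1 / S - 1 / s" using assms s by (simp add: field_simps)
  have "(s - S) * (2 * S) \<le> (s - S) * (s + S)" using assms by (intro mult_left_mono) auto
  also have "\<dots> = s\<^sup>2 - S\<^sup>2" by (simp add: power2_eq_square algebra_simps)
  also have "\<dots> \<le> 1" using assms by simp
  finally have 1: "s - S \<le> 1 / (2 * S)" using assms by (simp add: field_simps)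
  have "1 / S - 1 / s = (s - S) / (S * s)" using assms s by (simp add: field_simps)
  also have "\<dots> \<le> (1 / (2 * S)) / (S * S)" using 1 assms s by (intro frac_le mult_mono) auto
  also have "\<dots> = 1 / (2 * S ^ 3)" by (simp add: power3_eq_cube)
  finally show "1 / S - 1 / s \<le> 1 / (2 * S ^ 3)" .
qed

text \<open>The shells \<open>i + 16 \<le> norm z2 ^ 2 < i + 17\<close> all have area
  \<open>pi\<close>. The factor \<open>3/2\<close> adds the half-width of the tube, 1, to the drift
  of its centre, \<open>1/2\<close>, in units of \<open>1 / S^3\<close>; the resulting annuli have
  area \<open>6 * pi / (i + 16)^2\<close>.\<close>

lemma set_Y_finite: "emeasure lborel set_Y < \<infinity>"
proof (rule emeasure_finite_by_cover)
  define S where "S = (\<lambda>i::nat. sqrt (real i + 16))"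
  define A where "A = (\<lambda>i. {z::complex. 1 / S i - 3 / (2 * S i ^ 3) < norm z \<and> norm z < 1 / S i + 3 / (2 * S i ^ 3)})"
  define B where "B = (\<lambda>i. {z::complex. S i \<le> norm z \<and> norm z < sqrt (real i + 17)})"
  have S: "S i \<ge> 4" "(S i)\<^sup>2 = real i + 16" for i by (simp_all add: S_def real_le_rsqrt)
  show "set_Y \<subseteq> (\<Union>i. A i \<times> B i)"
  proof (clarify)
    fix z1 z2 :: complex assume "(z1, z2) \<in> set_Y"
    then have z: "norm z2 > 4" "\<bar>norm z1 - 1 / norm z2\<bar> < 1 / norm z2 ^ 3" by (auto simp: set_Y_def)
    define s where "s = norm z2"
    have "4\<^sup>2 \<le> s\<^sup>2" using z(1) unfolding s_def by (intro power_mono) auto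
    then have s2: "s\<^sup>2 \<ge> 16" by simp
    define i where "i = nat (\<lfloor>s\<^sup>2\<rfloor> - 16)"
    have i: "real i + 16 \<le> s\<^sup>2" "s\<^sup>2 < real i + 17" unfolding i_def using s2 by linarith+
    have lo: "S i \<le> s" unfolding S_def by (rule real_le_lsqrt) (use i in \<open>auto simp: s_def\<close>)
    have hi: "s < sqrt (real i + 17)" by (rule real_less_rsqrt) (use i in auto)
    have Spos: "S i > 0" using S(1)[of i] by linarith
    have br: "0 \<le> 1 / S i - 1 / s" "1 / S i - 1 / s \<le> 1 / (2 * S i ^ 3)"
      by (rule sqrt_bracket[OF Spos lo]; use i S(2)[of i] in simp)+
    have "1 / s ^ 3 \<le> 1 / S i ^ 3" using lo Spos
      by (intro divide_left_mono power_mono mult_pos_pos zero_less_power) linarith+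
    moreover have "1 / S i ^ 3 + 1 / (2 * S i ^ 3) = 3 / (2 * S i ^ 3)" using Spos by (simp add: field_simps)
    moreover have "\<bar>norm z1 - 1 / s\<bar> < 1 / s ^ 3" using z(2) by (simp add: s_def)
    ultimately have "\<bar>norm z1 - 1 / S i\<bar> < 3 / (2 * S i ^ 3)" using br by linarith
    then have "z1 \<in> A i" by (auto simp: A_def abs_less_iff)
    moreover have "z2 \<in> B i" using lo hi by (simp add: B_def s_def)
    ultimately show "(z1, z2) \<in> (\<Union>i. A i \<times> B i)" by auto
  qed
  show "summable (\<lambda>i. 6 * pi\<^sup>2 / (real i + real (Suc 15))\<^sup>2)" by (rule summable_inverse_squares)
  show "A i \<times> B i \<in> sets lborel" for i
    unfolding A_def B_def using annulus_borel by (simp add: borel_Times)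
  show "emeasure lborel (A i \<times> B i) \<le> ennreal (6 * pi\<^sup>2 / (real i + real (Suc 15))\<^sup>2)" for i
  proof -
    have S3: "3 / (2 * S i ^ 3) \<le> 1 / S i"
    proof -
      have "3 * S i \<le> 2 * S i ^ 3"
      proof -
        have "3 \<le> 2 * (S i)\<^sup>2" using S(2)[of i] by simp
        then have "3 * S i \<le> 2 * (S i)\<^sup>2 * S i" using S(1)[of i] by (intro mult_right_mono) auto
        then show ?thesis by (simp add: power2_eq_square power3_eq_cube)
      qed
      then show ?thesis using S(1)[of i] by (simp add: field_simps)
    qed
    have eA: "emeasure lborel (A i) = ennreal (6 * pi / (S i)^4)"
    proof -
      have "(1 / S i + 3 / (2 * S i ^ 3))\<^sup>2 - (1 / S i - 3 / (2 * S i ^ 3))\<^sup>2 = 4 * (1 / S i) * (3 / (2 * S i ^ 3))"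
        by (simp add: power2_eq_square algebra_simps)
      also have "\<dots> = 6 / S i ^ 4" by (simp add: eval_nat_numeral)
      finally have e: "(1 / S i + 3 / (2 * S i ^ 3))\<^sup>2 - (1 / S i - 3 / (2 * S i ^ 3))\<^sup>2 = 6 / S i ^ 4" .
      show ?thesis unfolding A_def
        by (subst emeasure_annulus(1)) (use S3 S(1)[of i] e in \<open>auto intro!: add_nonneg_nonneg\<close>)
    qed
    have "emeasure lborel (B i) = ennreal pi"
      unfolding B_def by (subst emeasure_annulus(2)) (auto simp: S_def)
    moreover have "A i \<in> sets borel" "B i \<in> sets borel" unfolding A_def B_def by measurable
    moreover have "(S i) ^ 4 = (real i + 16)\<^sup>2" using S(2)[of i] by (metis power2_eq_square power4_eq_xxxx mult.assoc)
    ultimately show ?thesis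
      by (simp add: emeasure_lborel_Times eA ennreal_mult[symmetric] power2_eq_square)
  qed
qed auto

text \<open>The exponent may have either sign, so \<open>x\<close> is bounded away from both 0 and
  infinity.\<close>

lemma power_int_ge_bracket:
  fixes x t :: real
  assumes "0 < t" "t \<le> x" "x \<le> 1 / t"
  shows "t ^ nat \<bar>m\<bar> \<le> x powi m"
proof (cases "m \<ge> 0")
  case True
  then show ?thesis using assms by (simp add: power_int_def power_mono)
next
  case False
  have "t \<le> inverse x" using assms by (simp add: field_simps)
  then show ?thesis using False assms by (simp add: power_int_def power_mono)
qed

text \<open>Factor \<open>z1^n z2^m\<close> as \<open>z1^(n - m) (z1 z2)^m\<close>. Along a tail the
  product is under control, while the large variable occurs with an exponent of at least 1.\<close>

lemma norm_tmono_sq_ge: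
  assumes "a \<ge> 1" "norm (fst z) \<ge> a" "snd z \<noteq> 0" "n > m"
    and "0 < t" "t \<le> norm (fst z * snd z)" "norm (fst z * snd z) \<le> 1 / t"
  shows "a\<^sup>2 * t ^ (2 * nat \<bar>m\<bar>) \<le> (norm (tmono n m z))\<^sup>2"
proof -
  have nz: "fst z \<noteq> 0" using assms by auto
  have "norm (tmono n m z) = norm (fst z) powi (n - m) * norm (fst z * snd z) powi m"
    using nz assms(3) by (simp add: tmono_def norm_mult norm_power_int power_int_mult_distrib power_int_diff)
  moreover have "a * t ^ nat \<bar>m\<bar> \<le> norm (fst z) powi (n - m) * norm (fst z * snd z) powi m"
  proof (intro mult_mono power_int_ge_bracket assms(5-7))
    have "a \<le> norm (fst z) powi 1" using assms by simp
    also have "\<dots> \<le> norm (fst z) powi (n - m)" using assms by (intro power_int_increasing) auto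
    finally show "a \<le> norm (fst z) powi (n - m)" .
  qed (use assms in auto)
  ultimately have "(a * t ^ nat \<bar>m\<bar>)\<^sup>2 \<le> (norm (tmono n m z))\<^sup>2"
    using assms by (intro power_mono) auto
  then show ?thesis by (simp add: power_mult_distrib power_mult[symmetric] mult.commute)
qed

definition no_axes :: "(complex \<times> complex) set" where
  "no_axes = {z. fst z \<noteq> 0 \<and> snd z \<noteq> 0}"

lemma open_no_axes: "open no_axes"
proof -
  have e: "no_axes = (- {0}) \<times> (- {0})" by (auto simp: no_axes_def)
  show ?thesis unfolding e by (intro open_Times open_Compl closed_singleton)
qed

text \<open>Single boxes suffice: at scale \<open>4^k\<close> the integrand is at least
  \<open>16^k\<close> times a fixed power of \<open>1 / (6 * (k+1))\<close>, and the box has volume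
  of order \<open>1 / (k+1)^2\<close>. The exponential wins whatever \<open>m\<close> is.\<close>

lemma monomial_not_L2_X:
  assumes nm: "n > m"
  shows "(\<integral>\<^sup>+z. ennreal ((norm (tmono n m z))\<^sup>2) * indicator (set_X \<inter> no_axes) z \<partial>lborel) = \<infinity>"
proof -
  define I where "I = (\<integral>\<^sup>+z. ennreal ((norm (tmono n m z))\<^sup>2) * indicator (set_X \<inter> no_axes) z \<partial>lborel)"
  define M where "M = 2 * nat \<bar>m\<bar>"
  define v where "v = (\<lambda>k::nat. 16 ^ k * (1 / (6 * (real k + 1))) ^ M * (1 / (2 * (real k + 1)\<^sup>2)))"
  have le: "ennreal (v k) \<le> I" if k: "k \<ge> 1" for k
  proof -
    define R where "R = (4::real) ^ k"
    \<comment> \<open>The fibre radius at the outer modulus \<open>3/2 * R\<close>, with the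
      logarithm replaced by its upper bound \<open>k + 1\<close>; hence \<open>A \<times> B\<close>
      lies in the tail.\<close>
    define \<sigma> where "\<sigma> = 1 / (3 * R * (real k + 1))"
    define A where "A = {z::complex. R < norm z \<and> norm z < 3 / 2 * R}"
    define B where "B = {z::complex. \<sigma> / 2 < norm z \<and> norm z < \<sigma>}"
    define c where "c = R\<^sup>2 * (1 / (6 * (real k + 1))) ^ M"
    have R: "R \<ge> 4" using power_increasing[OF k, of "4::real"] by (simp add: R_def)
    have \<sigma>: "\<sigma> > 0" using R by (simp add: \<sigma>_def)
    have R\<sigma>: "R * \<sigma> = 1 / (3 * (real k + 1))" using R by (simp add: \<sigma>_def)
    have [measurable]: "A \<in> sets borel" "B \<in> sets borel" unfolding A_def B_def by measurable
    have AB: "z \<in> set_X \<inter> no_axes \<and> c \<le> (norm (tmono n m z))\<^sup>2" if "z \<in> A \<times> B" for z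
    proof -
      obtain z1 z2 where z: "z = (z1, z2)" by (cases z)
      have a: "R < norm z1" "norm z1 < 3 / 2 * R" and b: "\<sigma> / 2 < norm z2" "norm z2 < \<sigma>"
        using that by (auto simp: z A_def B_def)
      have n1: "norm z1 > 4" "z1 \<noteq> 0" using a R by auto
      have L: "log 4 (norm z1) \<le> real k + 1" "log 4 (norm z1) > 0"
      proof -
        have "norm z1 \<le> 4 ^ (k + 1)" using a R by (simp add: R_def)
        then have "norm z1 \<le> 4 powr real (k + 1)" by (subst powr_realpow) auto
        then show "log 4 (norm z1) \<le> real k + 1" using n1 by (subst log_le_iff) (auto simp: add.commute)
        show "log 4 (norm z1) > 0" using n1 by (subst zero_less_log_cancel_iff) auto
      qed
      have "2 * norm z1 * log 4 (norm z1) \<le> 3 * R * (real k + 1)"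
        by (rule mult_mono) (use a L R in auto)
      then have "\<sigma> \<le> 1 / (2 * norm z1 * log 4 (norm z1))"
        unfolding \<sigma>_def by (intro frac_le mult_pos_pos) (use n1 L(2) in auto)
      then have X: "z \<in> set_X" using a b R by (auto simp: z set_X_def)
      have "norm z1 * norm z2 \<ge> R * (\<sigma> / 2)" using a b R \<sigma> by (intro mult_mono) auto
      then have lo: "norm (fst z * snd z) \<ge> 1 / (6 * (real k + 1))"
        using R\<sigma> by (simp add: z norm_mult)
      have "norm z1 * norm z2 \<le> (3 / 2 * R) * \<sigma>" using a b R \<sigma> by (intro mult_mono) auto
      also have "\<dots> = 3 / 2 * (R * \<sigma>)" by simp
      also have "\<dots> = 1 / (2 * (real k + 1))" unfolding R\<sigma> by (simp add: field_simps)
      also have "\<dots> \<le> 1" by simp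
      also have "\<dots> \<le> 1 / (1 / (6 * (real k + 1)))" by simp
      finally have hi: "norm (fst z * snd z) \<le> 1 / (1 / (6 * (real k + 1)))"
        by (simp add: z norm_mult)
      have "c \<le> (norm (tmono n m z))\<^sup>2"
        unfolding c_def M_def
        by (rule norm_tmono_sq_ge[OF _ _ _ nm _ lo hi]) (use R a b \<sigma> in \<open>auto simp: z\<close>)
      moreover have "z \<in> no_axes" using a b R \<sigma> by (auto simp: z no_axes_def)
      ultimately show ?thesis using X by blast
    qed
    have "v k \<le> c * (pi * ((3 / 2 * R)\<^sup>2 - R\<^sup>2) * (pi * (\<sigma>\<^sup>2 - (\<sigma> / 2)\<^sup>2)))"
    proof -
      have "pi * ((3 / 2 * R)\<^sup>2 - R\<^sup>2) * (pi * (\<sigma>\<^sup>2 - (\<sigma> / 2)\<^sup>2)) = 15 / 16 * pi\<^sup>2 * (R * \<sigma>)\<^sup>2"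
        by (simp add: power2_eq_square algebra_simps)
      also have "\<dots> = (15 / 144) * pi\<^sup>2 * (1 / (real k + 1)\<^sup>2)"
      proof -
        have "15 / 16 * pi\<^sup>2 * (1 / (3 * w))\<^sup>2 = (15 / 144) * pi\<^sup>2 * (1 / w\<^sup>2)" for w
          by (simp add: power_divide power_mult_distrib)
        then show ?thesis unfolding R\<sigma> by blast
      qed
      also have "\<dots> \<ge> (15 / 144) * 3\<^sup>2 * (1 / (real k + 1)\<^sup>2)"
        using pi_gt3 by (intro mult_mono power_mono) auto
      finally have "pi * ((3 / 2 * R)\<^sup>2 - R\<^sup>2) * (pi * (\<sigma>\<^sup>2 - (\<sigma> / 2)\<^sup>2)) \<ge> (15 / 16) * (1 / (real k + 1)\<^sup>2)"
        by simp
      moreover have "(15 / 16) * (1 / (real k + 1)\<^sup>2) \<ge> 1 / (2 * (real k + 1)\<^sup>2)" by (simp add: field_simps)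
      moreover have "c = 16 ^ k * (1 / (6 * (real k + 1))) ^ M"
      proof -
        have "R\<^sup>2 = (4\<^sup>2) ^ k" unfolding R_def by (simp only: power_mult[symmetric] mult.commute)
        then show ?thesis by (simp add: c_def)
      qed
      ultimately show ?thesis
        unfolding v_def by (intro mult_mono) (auto simp: c_def)
    qed
    then have "ennreal (v k) \<le> ennreal (c * (pi * ((3 / 2 * R)\<^sup>2 - R\<^sup>2) * (pi * (\<sigma>\<^sup>2 - (\<sigma> / 2)\<^sup>2))))"
      by (rule ennreal_leI)
    also have "\<dots> = ennreal c * emeasure lborel (A \<times> B)"
    proof -
      have "0 \<le> (3 / 2 * R)\<^sup>2 - R\<^sup>2" "0 \<le> \<sigma>\<^sup>2 - (\<sigma> / 2)\<^sup>2"
        using R \<sigma> by (auto intro!: power_mono)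
      then have "ennreal (c * (pi * ((3 / 2 * R)\<^sup>2 - R\<^sup>2) * (pi * (\<sigma>\<^sup>2 - (\<sigma> / 2)\<^sup>2))))
        = ennreal c * (ennreal (pi * ((3 / 2 * R)\<^sup>2 - R\<^sup>2)) * ennreal (pi * (\<sigma>\<^sup>2 - (\<sigma> / 2)\<^sup>2)))"
        by (subst ennreal_mult'[symmetric], simp, subst ennreal_mult'[symmetric])
          (auto simp: c_def)
      also have "\<dots> = ennreal c * emeasure lborel (A \<times> B)"
      proof -
        have "emeasure lborel A = ennreal (pi * ((3 / 2 * R)\<^sup>2 - R\<^sup>2))"
          unfolding A_def by (rule emeasure_annulus(1)) (use R in auto)
        moreover have "emeasure lborel B = ennreal (pi * (\<sigma>\<^sup>2 - (\<sigma> / 2)\<^sup>2))"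
          unfolding B_def by (rule emeasure_annulus(1)) (use \<sigma> in auto)
        ultimately show ?thesis by (simp add: emeasure_lborel_Times)
      qed
      finally show ?thesis .
    qed
    also have "\<dots> = (\<integral>\<^sup>+z. ennreal c * indicator (A \<times> B) z \<partial>lborel)"
      by (subst nn_integral_cmult_indicator) (auto simp: borel_Times)
    also have "\<dots> \<le> I"
      unfolding I_def using AB by (intro nn_integral_mono) (auto simp: indicator_def ennreal_leI)
    finally show ?thesis .
  qed
  have "filterlim v at_top at_top" unfolding v_def by real_asymp
  then have "eventually (\<lambda>k. v k \<ge> B) sequentially" for B by (simp add: filterlim_at_top)
  then have "ennreal B \<le> I" for B
  proof -
    assume *: "\<And>B. eventually (\<lambda>k. v k \<ge> B) sequentially"
    obtain k where "k \<ge> 1" "v k \<ge> B"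
      using eventually_conj[OF *[of B] eventually_ge_at_top[of 1]] eventually_happens[of _ sequentially] by auto
    then show "ennreal B \<le> I" using le ennreal_leI order_trans by blast
  qed
  note ge = this
  have "I = \<infinity>"
  proof (rule ccontr)
    assume "I \<noteq> \<infinity>"
    then obtain b where b: "I = ennreal b" "b \<ge> 0" by (cases I) auto
    then show False using ge[of "b + 1"] by simp
  qed
  then show ?thesis unfolding I_def .
qed

lemma tmono_swap: "tmono n m (prod.swap z) = tmono m n z"
  by (simp add: tmono_def mult.commute)

text \<open>The tail contains disjoint boxes, with \<open>z2\<close> between the radii \<open>sqrt j\<close> and \<open>sqrt (j + 1)\<close>,
  each contributing a multiple of \<open>1 / j\<close> to the integral.\<close>

lemma monomial_not_L2_Y:
  assumes nm: "m > n"
  shows "(\<integral>\<^sup>+z. ennreal ((norm (tmono n m z))\<^sup>2) * indicator (set_Y \<inter> no_axes) z \<partial>lborel) = \<infinity>"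
proof -
  define I where "I = (\<integral>\<^sup>+z. ennreal ((norm (tmono n m z))\<^sup>2) * indicator (set_Y \<inter> no_axes) z \<partial>lborel)"
  define M where "M = 2 * nat \<bar>n\<bar>"
  define S where "S = (\<lambda>i::nat. sqrt (real i + 17))"
  \<comment> \<open>The half-width is a quarter of \<open>1 / S^3\<close>: the centre drifts by up
    to one half, and three quarters in total still fit under \<open>1 / s^3\<close>.\<close>
  define A where "A = (\<lambda>i. {z::complex. 1 / S i - 1 / (4 * S i ^ 3) < norm z \<and> norm z < 1 / S i + 1 / (4 * S i ^ 3)})"
  define B where "B = (\<lambda>i. {z::complex. S i < norm z \<and> norm z < S (Suc i)})"
  define c where "c = (\<lambda>i. (S i)\<^sup>2 * (1 / 2) ^ M)"
  define v where "v = (\<lambda>i. (1 / 2) ^ M * pi\<^sup>2 * (1 / (real i + 17)))"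
  have S: "S i > 4" "(S i)\<^sup>2 = real i + 17" "(S (Suc i))\<^sup>2 = (S i)\<^sup>2 + 1" for i
    by (simp_all add: S_def real_less_rsqrt)
  have Spos: "S i > 0" for i using S(1)[of i] by linarith
  have [measurable]: "A i \<in> sets borel" "B i \<in> sets borel" for i unfolding A_def B_def by measurable
  have AxB [measurable]: "A i \<times> B i \<in> sets borel" for i by (simp add: borel_Times)
  have AB: "z \<in> set_Y \<inter> no_axes \<and> c i \<le> (norm (tmono n m z))\<^sup>2" if "z \<in> A i \<times> B i" for z i
  proof -
    obtain z1 z2 where z: "z = (z1, z2)" by (cases z)
    define s where "s = norm z2"
    have a: "\<bar>norm z1 - 1 / S i\<bar> < 1 / (4 * S i ^ 3)" and b: "S i < s" "s < S (Suc i)"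
      using that by (auto simp: z A_def B_def s_def abs_less_iff)
    have s4: "s > 4" using b S(1)[of i] by linarith
    have s2: "s\<^sup>2 < (S i)\<^sup>2 + 1" unfolding S(3)[symmetric] using b s4 by (intro power_strict_mono) auto
    have br: "0 \<le> 1 / S i - 1 / s" "1 / S i - 1 / s \<le> 1 / (2 * S i ^ 3)"
      by (rule sqrt_bracket[OF Spos]; use b s2 in simp)+
    \<comment> \<open>Since \<open>S^2 \<ge> 17\<close>, the ratio \<open>s / S\<close> is at most
      \<open>18/17\<close>, whose cube is below \<open>4/3\<close>.\<close>
    have "1 / (4 * S i ^ 3) + 1 / (2 * S i ^ 3) \<le> 1 / s ^ 3"
    proof -
      have S16: "(S i)\<^sup>2 \<ge> 17" using S(2)[of i] by simp
      have "s \<le> 18 / 17 * S i"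
      proof (rule power2_le_imp_le)
        have "s\<^sup>2 \<le> 18 / 17 * (S i)\<^sup>2" using s2 S16 by linarith
        also have "\<dots> \<le> (18 / 17 * S i)\<^sup>2" by (simp add: power_mult_distrib power2_eq_square)
        finally show "s\<^sup>2 \<le> (18 / 17 * S i)\<^sup>2" .
      qed (use Spos[of i] in simp)
      then have "s ^ 3 \<le> (18 / 17 * S i) ^ 3" using s4 by (intro power_mono) auto
      also have "\<dots> \<le> 4 / 3 * S i ^ 3" using Spos[of i] by (simp add: power_mult_distrib power_divide)
      finally have "1 / (4 / 3 * S i ^ 3) \<le> 1 / s ^ 3" using s4 by (intro frac_le) auto
      moreover have "1 / (4 * S i ^ 3) + 1 / (2 * S i ^ 3) = 1 / (4 / 3 * S i ^ 3)"
        using Spos[of i] by (simp add: field_simps)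
      ultimately show ?thesis by simp
    qed
    then have Y': "\<bar>norm z1 - 1 / s\<bar> < 1 / s ^ 3" using a br by linarith
    then have Y: "z \<in> set_Y" using s4 by (auto simp: z set_Y_def s_def)
    have "\<bar>norm z1 * s - 1\<bar> = \<bar>norm z1 - 1 / s\<bar> * s"
    proof -
      have "norm z1 * s - 1 = (norm z1 - 1 / s) * s" using s4 by (simp add: field_simps)
      then show ?thesis using s4 by (simp add: abs_mult)
    qed
    also have "\<dots> \<le> 1 / s ^ 3 * s" using Y' s4 by (intro mult_right_mono) auto
    also have "\<dots> = 1 / s\<^sup>2" using s4 by (simp add: power2_eq_square power3_eq_cube)
    also have "\<dots> \<le> 1 / 4\<^sup>2" using s4 by (intro frac_le power_mono) auto
    finally have ab: "\<bar>norm z1 * s - 1\<bar> \<le> 1 / 16" by simp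
    then have ab': "1 / 2 \<le> norm z1 * s" "norm z1 * s \<le> 2" by linarith+
    then have z10: "z1 \<noteq> 0" by auto
    \<comment> \<open>With coordinates exchanged, \<open>z2\<close> becomes the large variable of
      the estimate, with exponent difference \<open>m - n\<close>.\<close>
    have "c i \<le> (norm (tmono m n (prod.swap z)))\<^sup>2"
      unfolding c_def M_def
      by (rule norm_tmono_sq_ge[OF _ _ _ nm])
        (use b s4 z10 ab' S(1)[of i] in \<open>auto simp: z norm_mult s_def mult.commute\<close>)
    moreover have "z \<in> no_axes" using z10 s4 by (auto simp: z no_axes_def s_def)
    ultimately show ?thesis using Y by (simp add: tmono_swap)
  qed
  have disj: "i = j" if "z \<in> A i \<times> B i" "z \<in> A j \<times> B j" for z i j
  proof -
    have "i' \<le> j'" if "z \<in> A i' \<times> B i'" "z \<in> A j' \<times> B j'" for i' j'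
    proof -
      have "S i' < S (Suc j')" using that by (auto simp: B_def)
      then show ?thesis by (simp add: S_def)
    qed
    then show ?thesis using that by (meson order_antisym)
  qed
  have vol: "ennreal (c i) * emeasure lborel (A i \<times> B i) = ennreal (v i)" for i
  proof -
    have S3: "1 / (4 * S i ^ 3) \<le> 1 / S i"
    proof -
      have "S i * 1 \<le> S i * (4 * (S i)\<^sup>2)" using S(2)[of i] Spos[of i] by (intro mult_left_mono) auto
      then have "S i \<le> 4 * S i ^ 3" by (simp add: power2_eq_square power3_eq_cube)
      then show ?thesis using Spos[of i] by (intro frac_le) auto
    qed
    have "(1 / S i + 1 / (4 * S i ^ 3))\<^sup>2 - (1 / S i - 1 / (4 * S i ^ 3))\<^sup>2 = 4 * (1 / S i) * (1 / (4 * S i ^ 3))"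
      by (simp add: power2_eq_square algebra_simps)
    also have "\<dots> = 1 / S i ^ 4" by (simp add: eval_nat_numeral)
    finally have e: "(1 / S i + 1 / (4 * S i ^ 3))\<^sup>2 - (1 / S i - 1 / (4 * S i ^ 3))\<^sup>2 = 1 / S i ^ 4" .
    have "emeasure lborel (A i) = ennreal (pi * (1 / S i ^ 4))"
      unfolding A_def e[symmetric]
      by (rule emeasure_annulus(1)) (use S3 Spos[of i] in \<open>auto intro!: add_nonneg_nonneg\<close>)
    moreover have "emeasure lborel (B i) = ennreal pi"
      unfolding B_def by (subst emeasure_annulus(1)) (use S(3)[of i] Spos[of i] in \<open>auto simp: S_def\<close>)
    ultimately have "ennreal (c i) * emeasure lborel (A i \<times> B i) = ennreal (c i * (pi * (1 / S i ^ 4) * pi))"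
    proof -
      assume e: "emeasure lborel (A i) = ennreal (pi * (1 / S i ^ 4))" "emeasure lborel (B i) = ennreal pi"
      have n: "0 \<le> c i" "0 \<le> pi * (1 / S i ^ 4)" "0 \<le> pi * (1 / S i ^ 4) * pi"
        using Spos[of i] by (auto simp: c_def)
      have "emeasure lborel (A i \<times> B i) = emeasure lborel (A i) * emeasure lborel (B i)"
        by (rule emeasure_lborel_Times) measurable
      then show ?thesis
        by (simp only: e ennreal_mult[OF n(1,3)] ennreal_mult[OF n(2) pi_ge_zero])
    qed
    also have "c i * (pi * (1 / S i ^ 4) * pi) = v i"
    proof -
      have "S i ^ 4 = (S i)\<^sup>2 * (S i)\<^sup>2" by (simp add: eval_nat_numeral)
      then show ?thesis unfolding c_def v_def S(2) by (simp add: power2_eq_square)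
    qed
    finally show ?thesis .
  qed
  have le: "ennreal (\<Sum>i<N. v i) \<le> I" for N
  proof -
    have "ennreal (\<Sum>i<N. v i) = (\<Sum>i<N. ennreal (v i))" by (rule sum_ennreal[symmetric]) (simp add: v_def)
    also have "\<dots> = (\<Sum>i<N. \<integral>\<^sup>+z. ennreal (c i) * indicator (A i \<times> B i) z \<partial>lborel)"
      unfolding vol[symmetric] by (intro sum.cong refl nn_integral_cmult_indicator[symmetric]) (auto simp: borel_Times)
    also have "\<dots> = (\<integral>\<^sup>+z. (\<Sum>i<N. ennreal (c i) * indicator (A i \<times> B i) z) \<partial>lborel)"
      by (rule nn_integral_sum[symmetric]) measurable
    also have "\<dots> \<le> I"
      unfolding I_def
    proof (rule nn_integral_mono)
      fix z
      show "(\<Sum>i<N. ennreal (c i) * indicator (A i \<times> B i) z)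
          \<le> ennreal ((norm (tmono n m z))\<^sup>2) * indicator (set_Y \<inter> no_axes) z"
      proof (cases "\<exists>k<N. z \<in> A k \<times> B k")
        case True
        then obtain k where k: "k < N" "z \<in> A k \<times> B k" by blast
        have "(\<Sum>i<N. ennreal (c i) * indicator (A i \<times> B i) z) = (\<Sum>i\<in>{k}. ennreal (c i) * indicator (A i \<times> B i) z)"
          by (rule sum.mono_neutral_right) (use k disj in \<open>auto simp: indicator_def\<close>)
        then show ?thesis using k AB[OF k(2)] by (simp add: ennreal_leI)
      next
        case False
        then have "(\<Sum>i<N. ennreal (c i) * indicator (A i \<times> B i) z) = 0"
          by (intro sum.neutral) (auto simp: indicator_def)
        then show ?thesis by simp
      qed
    qed
    finally show ?thesis .
  qed
  have "I = \<infinity>"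
  proof (rule ccontr)
    assume "I \<noteq> \<infinity>"
    then obtain b where b: "I = ennreal b" "b \<ge> 0" by (cases I) auto
    have "(\<Sum>i<N. v i) \<le> b" for N using le[of N] b by simp
    then have "summable v" by (intro summableI_nonneg_bounded) (auto simp: v_def)
    then have "summable (\<lambda>i. 1 / (real i + 17))"
      unfolding v_def summable_cmult_iff by simp
    then have "summable (\<lambda>i. inverse (real (i + 17)))" by (simp add: inverse_eq_divide)
    then have "summable (\<lambda>i. inverse (real i))"
      using summable_iff_shift[of "\<lambda>i. inverse (real i)" 17] by blast
    then show False using not_summable_harmonic[where 'a=real] by blast
  qed
  then show ?thesis unfolding I_def .
qed

section \<open>Geometry of Omega\<close>

lemma reinhardt_interior:
  assumes "reinhardt A" shows "reinhardt (interior A)"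
  unfolding reinhardt_def
proof (intro allI impI)
  fix u z :: "complex \<times> complex" assume z: "z \<in> interior A" and u: "norm (fst u) = 1" "norm (snd u) = 1"
  define v where "v = (inverse (fst u), inverse (snd u))"
  have nz: "fst u \<noteq> 0" "snd u \<noteq> 0" using u by force+
  have v: "norm (fst v) = 1" "norm (snd v) = 1" using u by (simp_all add: v_def norm_inverse)
  have uv: "rot u (rot v w) = w" and vu: "rot v (rot u w) = w" for w
    using nz by (simp_all add: rot_def v_def mult.assoc[symmetric])
  have "open (rot v -` interior A)"
    by (rule open_vimage) (auto simp: rot_def intro!: continuous_intros)
  moreover have "rot v -` interior A \<subseteq> A"
  proof
    fix w assume "w \<in> rot v -` interior A"
    then have "rot v w \<in> A" using interior_subset by blast
    then have "rot u (rot v w) \<in> A" using assms u unfolding reinhardt_def by blast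
    then show "w \<in> A" by (simp add: uv)
  qed
  moreover have "rot u z \<in> rot v -` interior A" using z by (simp add: vu)
  ultimately show "rot u z \<in> interior A" by (meson interiorI)
qed

lemma reinhardt_no_axes: "reinhardt no_axes"
  by (auto simp: reinhardt_def rot_def no_axes_def)

lemma reinhardt_Int: "reinhardt A \<Longrightarrow> reinhardt B \<Longrightarrow> reinhardt (A \<inter> B)"
  by (auto simp: reinhardt_def)

lemma reinhardt_XYZ: "reinhardt set_X" "reinhardt set_Y" "reinhardt set_Z"
  by (auto simp: reinhardt_def rot_def set_X_def set_Y_def set_Z_def norm_mult)

lemma reinhardt_Omega: "reinhardt Omega"
  unfolding Omega_def
  by (rule reinhardt_interior) (use reinhardt_XYZ in \<open>auto simp: reinhardt_def\<close>)

lemma open_Omega: "open Omega" by (simp add: Omega_def)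

definition bidisc :: "(complex \<times> complex) set" where
  "bidisc = ball 0 4 \<times> ball 0 4"

lemma bidisc_subset_Omega: "bidisc \<subseteq> Omega"
  unfolding Omega_def bidisc_def
  by (rule interior_maximal) (auto simp: set_Z_def open_Times)

lemma open_Collect_less_0:
  fixes f :: "'a::topological_space \<Rightarrow> real"
  assumes "open A" "continuous_on A f" shows "open {z \<in> A. f z < 0}"
proof -
  have "open (f -` {..<0} \<inter> A)"
    by (rule iffD1[OF continuous_on_open_vimage[OF assms(1)] assms(2), rule_format]) simp
  also have "f -` {..<0} \<inter> A = {z \<in> A. f z < 0}" by auto
  finally show ?thesis .
qed

lemma log4_gt_1: "x > 4 \<Longrightarrow> log 4 x > 1"
  using log_less_cancel_iff[of 4 4 x] by simp

text \<open>Cleared of its denominator, the condition is visibly continuous and monotone in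
  \<open>norm a\<close>, as openness and the later slice argument require.\<close>

lemma set_X_iff:
  "(a, b) \<in> set_X \<longleftrightarrow> norm a > 4 \<and> norm b * (2 * norm a * log 4 (norm a)) < 1"
proof (cases "norm a > 4")
  case True
  then have "2 * norm a * log 4 (norm a) > 0" using log4_gt_1[OF True] by (intro mult_pos_pos) auto
  from pos_less_divide_eq[OF this, of "norm b" 1] show ?thesis by (auto simp: set_X_def)
qed (auto simp: set_X_def)

lemma open_set_X: "open set_X"
proof -
  have e: "set_X = {z \<in> {z. 4 < norm (fst z)}. norm (snd z) * (2 * norm (fst z) * log 4 (norm (fst z))) - 1 < 0}"
    using set_X_iff by auto
  show ?thesis
    unfolding e
    by (intro open_Collect_less_0 open_Collect_less continuous_on_diff continuous_on_mult continuous_on_norm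
        continuous_on_fst continuous_on_snd continuous_on_id continuous_on_const continuous_on_log) auto
qed

lemma open_set_Y: "open set_Y"
proof -
  have e: "set_Y = {z \<in> {z. 4 < norm (snd z)}. \<bar>norm (fst z) - 1 / norm (snd z)\<bar> - 1 / norm (snd z) ^ 3 < 0}"
    by (auto simp: set_Y_def)
  show ?thesis
    unfolding e by (intro open_Collect_less_0 open_Collect_less continuous_intros) auto
qed

text \<open>Glues the tail to the core: \<open>max 1\<close> continues the tail below modulus 4, so
  points with \<open>norm z1 = 4\<close> and small \<open>z2\<close> are seen to be interior. Paths
  from the tail into the bidisc cross there.\<close>

lemma near_X_subset_Omega:
  assumes "1 < norm z1" "norm z2 * (2 * norm z1 * max 1 (log 4 (norm z1))) < 1"
  shows "(z1, z2) \<in> Omega"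
proof -
  define N where "N = {z \<in> {z :: complex \<times> complex. 1 < norm (fst z)}.
    norm (snd z) * (2 * norm (fst z) * max 1 (log 4 (norm (fst z)))) - 1 < 0}"
  have "open N"
    unfolding N_def
    by (intro open_Collect_less_0 open_Collect_less continuous_on_diff continuous_on_mult continuous_on_norm
        continuous_on_fst continuous_on_snd continuous_on_id continuous_on_const continuous_on_max
        continuous_on_log) auto
  moreover have "N \<subseteq> set_X \<union> set_Y \<union> set_Z"
  proof
    fix z assume z: "z \<in> N"
    obtain a b where ab: "z = (a, b)" by (cases z)
    have *: "1 < norm a" "norm b * (2 * norm a * max 1 (log 4 (norm a))) < 1" using z by (auto simp: N_def ab)
    show "z \<in> set_X \<union> set_Y \<union> set_Z"
    proof (cases "norm a > 4")
      case True
      then have "norm b * (2 * norm a * log 4 (norm a)) < 1"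
        using *(2) log4_gt_1[OF True] by (simp add: max_def split: if_splits)
      then show ?thesis using True by (simp add: ab set_X_iff)
    next
      case False
      have "norm b * 1 \<le> norm b * (2 * norm a * max 1 (log 4 (norm a)))"
        using *(1) mult_mono[of 1 "2 * norm a" 1 "max 1 (log 4 (norm a))"] by (intro mult_left_mono) auto
      then have "norm b \<le> 4" using * by linarith
      then show ?thesis using False by (auto simp: ab set_Z_def)
    qed
  qed
  moreover have "(z1, z2) \<in> N" using assms by (simp add: N_def)
  ultimately show ?thesis
    unfolding Omega_def by (meson interiorI)
qed

text \<open>The same gluing across \<open>norm z2 = 4\<close>; the threshold 3 leaves room for the
  coordinate \<open>7/2\<close> of the base point.\<close>

lemma near_Y_subset_Omega:
  assumes "3 < norm z2" "\<bar>norm z1 - 1 / norm z2\<bar> < 1 / norm z2 ^ 3"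
  shows "(z1, z2) \<in> Omega"
proof -
  define N where "N = {z \<in> {z :: complex \<times> complex. 3 < norm (snd z)}.
    \<bar>norm (fst z) - 1 / norm (snd z)\<bar> - 1 / norm (snd z) ^ 3 < 0}"
  have "open N"
    unfolding N_def
    by (intro open_Collect_less_0 open_Collect_less continuous_intros) auto
  moreover have "N \<subseteq> set_X \<union> set_Y \<union> set_Z"
  proof
    fix z assume z: "z \<in> N"
    obtain a b where ab: "z = (a, b)" by (cases z)
    have *: "3 < norm b" "\<bar>norm a - 1 / norm b\<bar> < 1 / norm b ^ 3" using z by (auto simp: N_def ab)
    show "z \<in> set_X \<union> set_Y \<union> set_Z"
    proof (cases "norm b > 4")
      case True
      then show ?thesis using * by (auto simp: ab set_Y_def)
    next
      case False
      have "1 / norm b \<le> 1 / 3" by (rule frac_le) (use * in auto)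
      moreover have "1 / norm b ^ 3 \<le> 1 / 3 ^ 3" by (intro frac_le power_mono) (use * in auto)
      ultimately have "norm a \<le> 4" using *(2) by simp
      then show ?thesis using False by (auto simp: ab set_Z_def)
    qed
  qed
  moreover have "(z1, z2) \<in> N" using assms by (simp add: N_def)
  ultimately show ?thesis
    unfolding Omega_def by (meson interiorI)
qed
lemma Omega_subset: "Omega \<subseteq> set_X \<union> set_Y \<union> set_Z"
  unfolding Omega_def by (rule interior_subset)

lemma set_X_subset_Omega: "set_X \<subseteq> Omega"
proof (clarify)
  fix a b :: complex assume "(a, b) \<in> set_X"
  then have "norm a > 4" "norm b * (2 * norm a * log 4 (norm a)) < 1" by (auto simp: set_X_iff)
  then show "(a, b) \<in> Omega" using log4_gt_1[of "norm a"] by (intro near_X_subset_Omega) (auto simp: max_def)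
qed

lemma set_Y_subset_Omega: "set_Y \<subseteq> Omega"
  by (auto simp: set_Y_def intro!: near_Y_subset_Omega)

lemma Omega_finite: "emeasure lborel Omega < \<infinity>"
proof -
  have e: "set_Z = cball 0 4 \<times> cball 0 4" by (auto simp: set_Z_def)
  have Z: "emeasure lborel set_Z < \<infinity>"
    unfolding e by (intro emeasure_bounded_finite bounded_Times bounded_cball)
  have m: "set_X \<in> sets lborel" "set_Y \<in> sets lborel" "set_Z \<in> sets lborel"
    using open_set_X open_set_Y by (auto simp: e intro!: borel_closed closed_Times)
  have "emeasure lborel Omega \<le> emeasure lborel (set_X \<union> set_Y \<union> set_Z)"
    using Omega_subset m by (intro emeasure_mono) auto
  also have "\<dots> \<le> emeasure lborel (set_X \<union> set_Y) + emeasure lborel set_Z"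
    using m by (intro emeasure_subadditive) auto
  also have "\<dots> \<le> emeasure lborel set_X + emeasure lborel set_Y + emeasure lborel set_Z"
    using m by (intro add_right_mono emeasure_subadditive)
  also have "\<dots> < \<infinity>" using set_X_finite set_Y_finite Z by simp
  finally show ?thesis .
qed

text \<open>The constant comes from the corner of \<open>set_Z\<close>; on the tails the product
  stays below 2.\<close>

lemma prod_bounded_XYZ:
  assumes "(a, b) \<in> set_X \<union> set_Y \<union> set_Z" shows "norm (a * b) \<le> 16"
proof -
  consider "(a, b) \<in> set_X" | "(a, b) \<in> set_Y" | "(a, b) \<in> set_Z" using assms by blast
  then show ?thesis
  proof cases
    case 1
    then have *: "norm a > 4" "norm b * (2 * norm a * log 4 (norm a)) < 1" by (auto simp: set_X_iff)
    note L = log4_gt_1[OF *(1)]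
    moreover have "norm b * (norm a * 1) \<le> norm b * (2 * norm a * log 4 (norm a))"
      using L by (intro mult_left_mono mult_mono) auto
    ultimately show ?thesis using * by (simp add: norm_mult mult.commute)
  next
    case 2
    then have *: "norm b > 4" "\<bar>norm a - 1 / norm b\<bar> < 1 / norm b ^ 3" by (auto simp: set_Y_def)
    have "norm a * norm b \<le> (1 / norm b + 1 / norm b ^ 3) * norm b"
      using * by (intro mult_right_mono) auto
    also have "\<dots> = 1 + 1 / (norm b)\<^sup>2"
    proof -
      have "b \<noteq> 0" using * by auto
      then show ?thesis by (simp add: field_simps power2_eq_square power3_eq_cube)
    qed
    also have "1 / (norm b)\<^sup>2 \<le> 1 / 4\<^sup>2" using * by (intro frac_le power_mono) auto
    finally show ?thesis by (simp add: norm_mult)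
  next
    case 3
    then have "norm a * norm b \<le> 4 * 4" by (intro mult_mono) (auto simp: set_Z_def)
    then show ?thesis by (simp add: norm_mult)
  qed
qed

section \<open>Laurent coefficients on Omega\<close>

lemma holomorphic2_on_fst:
  assumes "open A" "g holomorphic_on A" "\<And>z. z \<in> V \<Longrightarrow> fst z \<in> A"
  shows "holomorphic2_on (\<lambda>z. g (fst z)) V"
  unfolding holomorphic2_on_def
proof
  fix z assume "z \<in> V"
  then have "(g has_derivative (\<lambda>h. deriv g (fst z) * h)) (at (fst z))"
    using holomorphic_derivI[OF assms(2,1), of "fst z"] assms(3) by (simp add: has_field_derivative_def)
  from has_derivative_compose[OF has_derivative_fst[OF has_derivative_ident] this]
  have "((\<lambda>z. g (fst z)) has_derivative (\<lambda>h. deriv g (fst z) * fst h + 0 * snd h)) (at z)" by simp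
  then show "\<exists>a b. ((\<lambda>z. g (fst z)) has_derivative (\<lambda>h. a * fst h + b * snd h)) (at z)" by blast
qed

lemma holomorphic2_on_snd:
  assumes "open A" "g holomorphic_on A" "\<And>z. z \<in> V \<Longrightarrow> snd z \<in> A"
  shows "holomorphic2_on (\<lambda>z. g (snd z)) V"
  unfolding holomorphic2_on_def
proof
  fix z assume "z \<in> V"
  then have "(g has_derivative (\<lambda>h. deriv g (snd z) * h)) (at (snd z))"
    using holomorphic_derivI[OF assms(2,1), of "snd z"] assms(3) by (simp add: has_field_derivative_def)
  from has_derivative_compose[OF has_derivative_snd[OF has_derivative_ident] this]
  have "((\<lambda>z. g (snd z)) has_derivative (\<lambda>h. 0 * fst h + deriv g (snd z) * snd h)) (at z)" by simp
  then show "\<exists>a b. ((\<lambda>z. g (snd z)) has_derivative (\<lambda>h. a * fst h + b * snd h)) (at z)" by blast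
qed

lemma holomorphic2_on_tmono:
  assumes "\<And>z. z \<in> V \<Longrightarrow> m < 0 \<Longrightarrow> fst z \<noteq> 0" "\<And>z. z \<in> V \<Longrightarrow> n < 0 \<Longrightarrow> snd z \<noteq> 0"
  shows "holomorphic2_on (tmono m n) V"
  unfolding tmono_def
proof (rule holomorphic2_on_mult)
  show "holomorphic2_on (\<lambda>z. fst z powi m) V"
    by (rule holomorphic2_on_fst[where g = "\<lambda>x. x powi m" and A = "if m < 0 then - {0} else UNIV"])
      (use assms in \<open>auto intro!: holomorphic_intros open_Compl split: if_splits\<close>)
  show "holomorphic2_on (\<lambda>z. snd z powi n) V"
    by (rule holomorphic2_on_snd[where g = "\<lambda>x. x powi n" and A = "if n < 0 then - {0} else UNIV"])
      (use assms in \<open>auto intro!: holomorphic_intros open_Compl split: if_splits\<close>)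
qed

text \<open>Tails are connected to the bidisc through slices in \<open>z1\<close> and, for \<open>set_Y\<close>, through the image of
  \<open>\<lambda>\<zeta>. (1 / \<zeta>, \<zeta>)\<close>.\<close>

lemma Omega_torus_mean_const:
  assumes g: "holomorphic2_on g (Omega \<inter> no_axes)" and z: "z \<in> Omega \<inter> no_axes"
  shows "torus_mean (\<lambda>u. g (rot u z)) = torus_mean (\<lambda>u. g (rot u (7/2, 7/2)))"
proof -
  let ?W = "Omega \<inter> no_axes"
  let ?T = "\<lambda>z. torus_mean (\<lambda>u. g (rot u z))"
  have W: "open ?W" "reinhardt ?W"
    using open_Omega open_no_axes reinhardt_Omega reinhardt_no_axes by (auto intro: reinhardt_Int)
  note const = torus_mean_const[OF W g]
  \<comment> \<open>Off the axes the bidisc is a product of punctured discs, hence connected, so the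
    other cases need only reach it. The value \<open>7/2\<close> lies between 3 and 4: inside the
    bidisc, yet covered by both gluing lemmas.\<close>
  have disc: "?T z = ?T (7/2, 7/2)" if "z \<in> bidisc \<inter> no_axes" for z
  proof (rule const)
    define C where "C = (ball 0 4 - {0 :: complex}) \<times> (ball 0 4 - {0 :: complex})"
    have C: "C = bidisc \<inter> no_axes" by (auto simp: C_def bidisc_def no_axes_def)
    show "connected C" unfolding C_def by (intro connected_Times connected_punctured_ball) auto
    show "C \<subseteq> ?W" using bidisc_subset_Omega unfolding C by blast
    show "z \<in> C" using that C by simp
    show "(7/2, 7/2) \<in> C" by (simp add: C_def)
  qed
  obtain z1 z2 where zz: "z = (z1, z2)" by (cases z)
  have nz: "z1 \<noteq> 0" "z2 \<noteq> 0" using z by (auto simp: zz no_axes_def)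
  consider "z \<in> set_X" | "z \<in> set_Y" | "z \<in> set_Z" using z Omega_subset by blast
  then show ?thesis
  proof cases
    case 1
    then have z1: "norm z1 > 4" and z2: "norm z2 * (2 * norm z1 * log 4 (norm z1)) < 1"
      by (auto simp: zz set_X_iff)
    note L = log4_gt_1[OF z1]
    have "?T (z1, z2) = ?T (7/2, z2)"
    proof (rule torus_mean_slice1[OF W g])
      show "connected {\<zeta>::complex. 3 < norm (\<zeta> - 0) \<and> norm (\<zeta> - 0) \<le> norm z1}"
        by (rule connected_annulus) simp
      fix \<zeta> assume "\<zeta> \<in> {\<zeta>::complex. 3 < norm (\<zeta> - 0) \<and> norm (\<zeta> - 0) \<le> norm z1}"
      then have \<zeta>: "3 < norm \<zeta>" "norm \<zeta> \<le> norm z1" by auto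
      \<comment> \<open>Decreasing the modulus of the first coordinate, here down to 3, only relaxes
        the tail condition.\<close>
      have "max 1 (log 4 (norm \<zeta>)) \<le> log 4 (norm z1)"
        using L \<zeta> by (auto intro!: log_mono)
      then have "norm z2 * (2 * norm \<zeta> * max 1 (log 4 (norm \<zeta>))) \<le> norm z2 * (2 * norm z1 * log 4 (norm z1))"
        using \<zeta> by (intro mult_left_mono mult_mono) auto
      then have "norm z2 * (2 * norm \<zeta> * max 1 (log 4 (norm \<zeta>))) < 1" using z2 by linarith
      then have "(\<zeta>, z2) \<in> Omega" using \<zeta> by (intro near_X_subset_Omega) auto
      then show "(\<zeta>, z2) \<in> ?W" using \<zeta> nz by (auto simp: no_axes_def)
    qed (use z1 in auto)
    also have "\<dots> = ?T (7/2, 7/2)"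
    proof (rule disc)
      have "norm z2 * 1 \<le> norm z2 * (2 * norm z1 * log 4 (norm z1))"
        using L z1 mult_mono[of 1 "2 * norm z1" 1 "log 4 (norm z1)"] by (intro mult_left_mono) auto
      then have "norm z2 < 1" using z2 by linarith
      then show "(7/2, z2) \<in> bidisc \<inter> no_axes" using nz by (auto simp: bidisc_def no_axes_def)
    qed
    finally show ?thesis by (simp add: zz)
  next
    case 2
    then have z2: "norm z2 > 4" and z1: "\<bar>norm z1 - 1 / norm z2\<bar> < 1 / norm z2 ^ 3"
      by (auto simp: zz set_Y_def)
    have pos: "1 / r ^ 3 < 1 / r" if "r > 3" for r :: real
    proof -
      have "r ^ 1 < r ^ 3" using that by (intro power_strict_increasing) auto
      then show ?thesis using that by (intro frac_less2) auto
    qed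
    have "?T (z1, z2) = ?T (1 / z2, z2)"
    proof (rule torus_mean_slice1[OF W g])
      show "connected {\<zeta>::complex. 1 / norm z2 - 1 / norm z2 ^ 3 < norm (\<zeta> - 0) \<and> norm (\<zeta> - 0) < 1 / norm z2 + 1 / norm z2 ^ 3}"
        by (rule connected_annulus) simp
      fix \<zeta> :: complex assume "\<zeta> \<in> {\<zeta>. 1 / norm z2 - 1 / norm z2 ^ 3 < norm (\<zeta> - 0) \<and> norm (\<zeta> - 0) < 1 / norm z2 + 1 / norm z2 ^ 3}"
      then have \<zeta>: "\<bar>norm \<zeta> - 1 / norm z2\<bar> < 1 / norm z2 ^ 3" by (auto simp: abs_less_iff)
      then have "\<zeta> \<noteq> 0" using pos[of "norm z2"] z2 by auto
      then show "(\<zeta>, z2) \<in> ?W" using near_Y_subset_Omega[OF _ \<zeta>] z2 nz by (auto simp: no_axes_def)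
    qed (use z1 z2 in \<open>auto simp: abs_less_iff norm_divide\<close>)
    also have "\<dots> = ?T (2/7, 7/2)"
    proof (rule const)
      let ?C = "(\<lambda>\<zeta>. (1 / \<zeta>, \<zeta>)) ` (- cball (0::complex) 3)"
      show "connected ?C"
        by (intro connected_continuous_image connected_complement_bounded_convex continuous_intros) auto
      show "?C \<subseteq> ?W"
        by (auto simp: no_axes_def norm_divide intro!: near_Y_subset_Omega)
      show "(1 / z2, z2) \<in> ?C" using z2 by auto
      show "(2 / 7, 7 / 2) \<in> ?C" by (auto intro!: image_eqI[of _ _ "7/2"])
    qed
    also have "\<dots> = ?T (7/2, 7/2)" by (rule disc) (simp add: bidisc_def no_axes_def)
    finally show ?thesis by (simp add: zz)
  next
    case 3
    obtain e where e: "e > 0" "ball z e \<subseteq> Omega" using open_Omega z openE by blast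
    \<comment> \<open>A point of \<open>Omega\<close> in \<open>set_Z\<close> may have a coordinate
      of modulus 4. Shrinking by \<open>s < 1\<close> enters the open bidisc, and \<open>s\<close>
      close enough to 1 keeps the segment inside \<open>ball z e\<close>.\<close>
    define s where "s = max (1/2) (1 - e / (2 * (norm z + 1)))"
    have s: "0 < s" "s < 1" unfolding s_def using e(1) by (auto simp: add_nonneg_pos)
    have dist: "dist z (s *\<^sub>R z) < e"
    proof -
      have "dist z (s *\<^sub>R z) = (1 - s) * norm z"
        using s by (simp add: dist_norm scaleR_left_diff_distrib[symmetric, of 1, simplified])
      also have "\<dots> \<le> (e / (2 * (norm z + 1))) * norm z" using s_def by (intro mult_right_mono) auto
      also have "\<dots> = e * (norm z / (2 * (norm z + 1)))" by simp
      also have "\<dots> < e * 1"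
      proof (rule mult_strict_left_mono[OF _ e(1)])
        have "x < 2 * (x + 1)" if "x \<ge> 0" for x :: real using that by (simp add: distrib_left)
        from this[OF norm_ge_zero[of z]] show "norm z / (2 * (norm z + 1)) < 1" by (subst divide_less_eq_1_pos) (auto simp: add_nonneg_pos)
      qed
      also have "\<dots> = e" by simp
      finally show ?thesis .
    qed
    have "?T z = ?T (s *\<^sub>R z)"
    proof (rule const)
      have "connected ((\<lambda>t. t *\<^sub>R z) ` {s..1})"
        by (intro connected_continuous_image continuous_intros connected_Icc)
      then show "connected ((\<lambda>t. t *\<^sub>R z) ` {s..1})" .
      show "(\<lambda>t. t *\<^sub>R z) ` {s..1} \<subseteq> ?W"
      proof (rule image_subsetI)
        fix t assume t: "t \<in> {s..1}"
        have "dist z (t *\<^sub>R z) = (1 - t) * norm z"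
          using t by (simp add: dist_norm scaleR_left_diff_distrib[symmetric, of 1, simplified])
        also have "\<dots> \<le> (1 - s) * norm z" using t by (intro mult_right_mono) auto
        also have "\<dots> = dist z (s *\<^sub>R z)"
          using s by (simp add: dist_norm scaleR_left_diff_distrib[symmetric, of 1, simplified])
        finally have "t *\<^sub>R z \<in> Omega" using dist e(2) by auto
        moreover have "t *\<^sub>R z \<in> no_axes" using nz t s by (auto simp: no_axes_def zz)
        ultimately show "t *\<^sub>R z \<in> ?W" by blast
      qed
      show "z \<in> (\<lambda>t. t *\<^sub>R z) ` {s..1}" using s by (intro image_eqI[of _ _ 1]) auto
      show "s *\<^sub>R z \<in> (\<lambda>t. t *\<^sub>R z) ` {s..1}" using s by auto
    qed
    also have "\<dots> = ?T (7/2, 7/2)"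
    proof (rule disc)
      have "norm z1 \<le> 4" "norm z2 \<le> 4" using 3 by (auto simp: zz set_Z_def)
      then have "s * norm z1 \<le> s * 4" "s * norm z2 \<le> s * 4" using s by (auto intro!: mult_left_mono)
      moreover have "s * 4 < 4" using s by simp
      ultimately have "s * norm z1 < 4" "s * norm z2 < 4" by linarith+
      then show "s *\<^sub>R z \<in> bidisc \<inter> no_axes" using nz s by (auto simp: zz bidisc_def no_axes_def)
    qed
    finally show ?thesis .
  qed
qed

text \<open>By Cauchy's formula this is the coefficient of \<open>z1^n z2^m\<close> in the Laurent
  expansion of \<open>f\<close>, computed on the torus through \<open>z\<close>. Keeping
  \<open>z\<close> as an argument makes independence of the torus a statement of its own.\<close>

definition laurent_mean :: "(complex \<times> complex \<Rightarrow> complex) \<Rightarrow> int \<Rightarrow> int \<Rightarrow> complex \<times> complex \<Rightarrow> complex" where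
  "laurent_mean f n m z = torus_mean (\<lambda>u. tmono (-n) (-m) (rot u z) * f (rot u z))"

lemma tmono_rot: "tmono n m (rot u z) = tmono n m u * tmono n m z"
  by (simp add: tmono_def rot_def power_int_mult_distrib)

lemma tmono_cancel: "z \<in> no_axes \<Longrightarrow> tmono n m z * tmono (-n) (-m) z = 1"
  by (subst tmono_mult) (auto simp: no_axes_def tmono_def)

text \<open>Passes between the Fourier coefficient of \<open>f\<close> on the torus through
  \<open>z\<close> and the Laurent coefficient: they differ by the value of the monomial at
  \<open>z\<close>.\<close>

lemma fourier_coefficient_laurent_mean:
  assumes "z \<in> no_axes"
  shows "torus_mean (\<lambda>u. tmono (-n) (-m) u * f (rot u z)) = tmono n m z * laurent_mean f n m z"
proof -
  have "tmono n m z * laurent_mean f n m z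
      = torus_mean (\<lambda>u. tmono n m z * (tmono (-n) (-m) (rot u z) * f (rot u z)))"
    unfolding laurent_mean_def by (rule torus_mean_cmult[symmetric])
  also have "(\<lambda>u. tmono n m z * (tmono (-n) (-m) (rot u z) * f (rot u z)))
      = (\<lambda>u. tmono (-n) (-m) u * f (rot u z))"
    using tmono_cancel[OF assms, of n m] by (auto simp: tmono_rot mult_ac)
  finally show ?thesis by simp
qed

lemma continuous_on_rot_torus:
  assumes "reinhardt W" "continuous_on W f" "z \<in> W"
  shows "continuous_on unit_torus (\<lambda>u. f (rot u z))"
  by (intro continuous_on_compose2[OF assms(2)])
    (use assms in \<open>auto simp: reinhardt_def rot_def intro!: continuous_intros\<close>)

lemma norm_tmono_torus: "u \<in> unit_torus \<Longrightarrow> norm (tmono n m u) = 1"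
  by (auto simp: tmono_def norm_mult norm_power_int)

lemma tmono_measurable [measurable]: "tmono n m \<in> borel_measurable borel"
proof -
  have [measurable]: "fst \<in> borel_measurable (borel :: (complex \<times> complex) measure)"
    "snd \<in> borel_measurable (borel :: (complex \<times> complex) measure)"
    by (intro borel_measurable_continuous_onI continuous_intros)+
  have "(\<lambda>z. fst z powi n) \<in> borel_measurable (borel :: (complex \<times> complex) measure)"
    by (cases "n \<ge> 0") (simp_all add: power_int_def)
  moreover have "(\<lambda>z. snd z powi m) \<in> borel_measurable (borel :: (complex \<times> complex) measure)"
    by (cases "m \<ge> 0") (simp_all add: power_int_def)
  ultimately show ?thesis unfolding tmono_def by measurable
qed

text \<open>On the torus through \<open>z\<close>, Jensen bounds the squared modulus of
  \<open>c * tmono n m z\<close> by the mean of \<open>norm f ^ 2\<close>; averaging over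
  \<open>V\<close> integrates this. A monomial that is not square integrable on \<open>V\<close>
  thus has coefficient 0.\<close>

lemma laurent_mean_L2_bound:
  assumes W: "open W" "reinhardt W" and f: "f \<in> bergman_space W"
    and V: "V \<in> sets borel" "reinhardt V" "V \<subseteq> W \<inter> no_axes"
    and c: "\<And>z. z \<in> V \<Longrightarrow> laurent_mean f n m z = c"
  shows "ennreal ((norm c)\<^sup>2) * (\<integral>\<^sup>+z. ennreal ((norm (tmono n m z))\<^sup>2) * indicator V z \<partial>lborel)
    \<le> ennreal ((L2_norm_on W f)\<^sup>2)"
proof -
  have fm [measurable]: "f \<in> borel_measurable borel" using bergman_space_borel[OF W(1) f] .
  have [measurable]: "V \<in> sets borel" by fact
  have cf: "continuous_on W f" using holomorphic2_continuous_on[OF bergman_spaceD(1)[OF f]] .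
  have "ennreal ((norm c)\<^sup>2) * (\<integral>\<^sup>+z. ennreal ((norm (tmono n m z))\<^sup>2) * indicator V z \<partial>lborel)
      = (\<integral>\<^sup>+z. ennreal ((norm c)\<^sup>2) * (ennreal ((norm (tmono n m z))\<^sup>2) * indicator V z) \<partial>lborel)"
    by (rule nn_integral_cmult[symmetric]) measurable
  also have "\<dots> \<le> (\<integral>\<^sup>+z. (\<integral>\<^sup>+p. ennreal ((norm (f (rot (tor p) z)))\<^sup>2) * indicator (cbox (0,0) (1,1)) p \<partial>lborel)
      * indicator V z \<partial>lborel)"
  proof (rule nn_integral_mono)
    fix z
    show "ennreal ((norm c)\<^sup>2) * (ennreal ((norm (tmono n m z))\<^sup>2) * indicator V z)
      \<le> (\<integral>\<^sup>+p. ennreal ((norm (f (rot (tor p) z)))\<^sup>2) * indicator (cbox (0,0) (1,1)) p \<partial>lborel) * indicator V z"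
    proof (cases "z \<in> V")
      case True
      then have z: "z \<in> W" "z \<in> no_axes" using V by auto
      have "ennreal ((norm c)\<^sup>2) * ennreal ((norm (tmono n m z))\<^sup>2)
        = ennreal ((norm (torus_mean (\<lambda>u. tmono (-n) (-m) u * f (rot u z))))\<^sup>2)"
        using c[OF True] fourier_coefficient_laurent_mean[OF z(2), of n m f]
        by (simp add: norm_mult power_mult_distrib ennreal_mult mult.commute)
      also have "\<dots> \<le> (\<integral>\<^sup>+p. ennreal ((norm (tmono (-n) (-m) (tor p) * f (rot (tor p) z)))\<^sup>2)
          * indicator (cbox (0,0) (1,1)) p \<partial>lborel)"
        by (intro torus_mean_Jensen continuous_on_tor continuous_on_mult continuous_on_tmono
            continuous_on_rot_torus[OF W(2) cf z(1)])
      also have "\<dots> = (\<integral>\<^sup>+p. ennreal ((norm (f (rot (tor p) z)))\<^sup>2) * indicator (cbox (0,0) (1,1)) p \<partial>lborel)"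
        by (simp add: norm_mult norm_tmono_torus)
      finally show ?thesis using True by simp
    qed simp
  qed
  also have "\<dots> = (\<integral>\<^sup>+z. ennreal ((norm (f z))\<^sup>2) * indicator V z \<partial>lborel)"
    by (rule reinhardt_nn_mean[symmetric]) (use V in auto)
  also have "\<dots> \<le> (\<integral>\<^sup>+z. ennreal ((norm (f z))\<^sup>2) * indicator W z \<partial>lborel)"
    using V(3) by (intro nn_integral_mono) (auto simp: indicator_def)
  also have "\<dots> = (\<integral>\<^sup>+z. ennreal ((norm (f z))\<^sup>2) \<partial>lebesgue_on W)"
    by (subst nn_integral_lebesgue_on_borel) (use W in auto)
  also have "\<dots> = ennreal ((L2_norm_on W f)\<^sup>2)"
    by (rule nn_integral_L2_norm[OF bergman_spaceD(2)[OF f]])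
  finally show ?thesis .
qed

lemma Omega_laurent_mean_off_diagonal:
  assumes f: "f \<in> bergman_space Omega" and z: "z \<in> Omega \<inter> no_axes" and nm: "n \<noteq> m"
  shows "laurent_mean f n m z = 0"
proof -
  define c where "c = laurent_mean f n m (7/2, 7/2)"
  have hol: "holomorphic2_on (\<lambda>z. tmono (-n) (-m) z * f z) (Omega \<inter> no_axes)"
    by (intro holomorphic2_on_mult holomorphic2_on_tmono holomorphic2_on_subset[OF bergman_spaceD(1)[OF f]])
      (auto simp: no_axes_def)
  have c: "laurent_mean f n m z = c" if "z \<in> Omega \<inter> no_axes" for z
    unfolding c_def laurent_mean_def by (rule Omega_torus_mean_const[OF hol that])
  \<comment> \<open>The dominating exponent decides which tail serves; removing the axes keeps
    \<open>V\<close> where the coefficient is known to be constant.\<close>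
  have "\<exists>V. V \<in> sets borel \<and> reinhardt V \<and> V \<subseteq> Omega \<inter> no_axes \<and>
    (\<integral>\<^sup>+z. ennreal ((norm (tmono n m z))\<^sup>2) * indicator V z \<partial>lborel) = \<infinity>"
  proof (cases "n > m")
    case True
    then show ?thesis
      using monomial_not_L2_X[OF True] set_X_subset_Omega open_set_X open_no_axes reinhardt_no_axes reinhardt_XYZ(1)
      by (intro exI[of _ "set_X \<inter> no_axes"]) (auto intro: reinhardt_Int)
  next
    case False
    then have "m > n" using nm by simp
    then show ?thesis
      using monomial_not_L2_Y[of n m] set_Y_subset_Omega open_set_Y open_no_axes reinhardt_no_axes reinhardt_XYZ(2)
      by (intro exI[of _ "set_Y \<inter> no_axes"]) (auto intro: reinhardt_Int)
  qed
  then obtain V where V: "V \<in> sets borel" "reinhardt V" "V \<subseteq> Omega \<inter> no_axes"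
    "(\<integral>\<^sup>+z. ennreal ((norm (tmono n m z))\<^sup>2) * indicator V z \<partial>lborel) = \<infinity>" by blast
  have "ennreal ((norm c)\<^sup>2) * \<infinity> \<le> ennreal ((L2_norm_on Omega f)\<^sup>2)"
    using laurent_mean_L2_bound[OF open_Omega reinhardt_Omega f V(1-3), of n m c] c V(3,4) by auto
  then have "c = 0" by (auto simp: ennreal_mult_top top_unique split: if_splits)
  then show ?thesis using c[OF z] by simp
qed

text \<open>For \<open>n < 0\<close> the function \<open>tmono (-n) (-n) z * f z\<close> is
  holomorphic across the axes as well, so its torus mean may be moved to the origin, where the
  monomial vanishes.\<close>

lemma Omega_laurent_mean_negative:
  assumes f: "f \<in> bergman_space Omega" and z: "z \<in> Omega \<inter> no_axes" and n: "n < 0"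
  shows "laurent_mean f n n z = 0"
proof -
  have hol: "holomorphic2_on (\<lambda>z. tmono (-n) (-n) z * f z) Omega"
    by (intro holomorphic2_on_mult holomorphic2_on_tmono bergman_spaceD(1)[OF f]) (use n in auto)
  have "laurent_mean f n n z = torus_mean (\<lambda>u. tmono (-n) (-n) (rot u (7/2, 7/2)) * f (rot u (7/2, 7/2)))"
    unfolding laurent_mean_def
    by (rule Omega_torus_mean_const[OF holomorphic2_on_subset[OF hol] z]) auto
  also have "\<dots> = torus_mean (\<lambda>u. tmono (-n) (-n) (rot u (0, 0)) * f (rot u (0, 0)))"
    by (rule torus_mean_const[OF open_Omega reinhardt_Omega hol _ bidisc_subset_Omega])
      (auto simp: bidisc_def intro!: connected_Times)
  also have "\<dots> = 0" using n by (simp add: tmono_def rot_def torus_mean_constant)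
  finally show ?thesis .
qed

section \<open>Monomials in the Bergman space and completeness of the powers of the product\<close>

lemma AE_no_axes: "AE z in lborel. z \<in> no_axes"
proof -
  have "emeasure lborel ({0::complex} \<times> (UNIV :: complex set)) = 0" "emeasure lborel ((UNIV :: complex set) \<times> {0::complex}) = 0"
    by (subst emeasure_lborel_Times; simp)+
  then have "{0::complex} \<times> (UNIV :: complex set) \<in> null_sets lborel" "(UNIV :: complex set) \<times> {0::complex} \<in> null_sets lborel"
    by (auto intro!: null_setsI borel_Times)
  from AE_conjI[OF AE_not_in[OF this(1)] AE_not_in[OF this(2)]]
  show ?thesis by (rule AE_mp) (auto simp: no_axes_def)
qed

text \<open>Set to 0 off \<open>W\<close> to respect the normalisation in
  \<open>bergman_space\<close>; \<open>tmono\<close> is the untruncated counterpart with integer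
  exponents.\<close>

definition monomial :: "(complex \<times> complex) set \<Rightarrow> nat \<Rightarrow> nat \<Rightarrow> complex \<times> complex \<Rightarrow> complex" where
  "monomial W j k = (\<lambda>z. if z \<in> W then fst z ^ j * snd z ^ k else 0)"

abbreviation diag_mono :: "(complex \<times> complex) set \<Rightarrow> nat \<Rightarrow> complex \<times> complex \<Rightarrow> complex" where
  "diag_mono W k \<equiv> monomial W k k"

lemma monomial_borel:
  assumes "open W" shows "monomial W j k \<in> borel_measurable borel"
proof -
  have "(\<lambda>z. indicator W z *\<^sub>R (fst z ^ j * snd z ^ k)) \<in> borel_measurable borel"
    using assms by (intro borel_measurable_continuous_on_indicator continuous_intros) auto
  also have "(\<lambda>z. indicator W z *\<^sub>R (fst z ^ j * snd z ^ k)) = monomial W j k"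
    by (auto simp: monomial_def indicator_def)
  finally show ?thesis .
qed

lemma finite_measure_const_integrable:
  fixes W :: "(complex \<times> complex) set"
  assumes "open W" "emeasure lborel W < \<infinity>"
  shows "integrable (lebesgue_on W) (\<lambda>z. c :: real)"
proof -
  have "integrable lborel (\<lambda>z. indicator W z *\<^sub>R c)"
    using assms by (intro integrable_scaleR_left integrable_real_indicator) auto
  moreover have "integrable (lebesgue_on W) (\<lambda>z. c) \<longleftrightarrow> integrable lborel (\<lambda>z. indicator W z *\<^sub>R c)"
    by (rule integral_lebesgue_on_borel(2)) (use assms in auto)
  ultimately show ?thesis by blast
qed

lemma borel_imp_lebesgue_on_measurable:
  fixes g :: "complex \<times> complex \<Rightarrow> complex"
  assumes "g \<in> borel_measurable borel"
  shows "g \<in> borel_measurable (lebesgue_on W)"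
  using assms by (simp add: measurable_completion measurable_restrict_space1)

lemma monomial_bergman:
  assumes W: "open W" "emeasure lborel W < \<infinity>"
    and B: "\<And>z. z \<in> W \<Longrightarrow> norm (fst z ^ j * snd z ^ k) \<le> B"
  shows "monomial W j k \<in> bergman_space W"
  unfolding bergman_space_def
proof safe
  have "holomorphic2_on (tmono (int j) (int k)) W" by (rule holomorphic2_on_tmono) auto
  then show "holomorphic2_on (monomial W j k) W"
    by (rule holomorphic2_on_transform[OF _ W(1)]) (simp add: monomial_def tmono_def)
  show "monomial W j k \<in> L2_on W"
  proof (rule L2_onI_bound[OF borel_imp_lebesgue_on_measurable[OF monomial_borel[OF W(1)]]])
    show "integrable (lebesgue_on W) (\<lambda>z. B\<^sup>2)" by (rule finite_measure_const_integrable[OF W])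
    show "(norm (monomial W j k z))\<^sup>2 \<le> B\<^sup>2" if "z \<in> W" for z
      using B[OF that] that by (auto simp: monomial_def intro!: power_mono)
  qed
qed (simp add: monomial_def)

lemma diag_mono_bergman:
  assumes "open W" "emeasure lborel W < \<infinity>" and B: "\<And>z. z \<in> W \<Longrightarrow> norm (fst z * snd z) \<le> B"
  shows "diag_mono W k \<in> bergman_space W"
proof (rule monomial_bergman[OF assms(1,2)])
  show "norm (fst z ^ k * snd z ^ k) \<le> B ^ k" if "z \<in> W" for z
    using B[OF that] unfolding power_mult_distrib[symmetric] norm_power by (intro power_mono) auto
qed

lemma Omega_prod_bound: "z \<in> Omega \<Longrightarrow> norm (fst z * snd z) \<le> 16"
  using Omega_subset prod_bounded_XYZ[of "fst z" "snd z"] by auto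

text \<open>The modulus of \<open>E\<close> is constant on the torus through \<open>z\<close>, so
  there \<open>cnj (E w)\<close> equals \<open>norm (E z) ^ 2 * tmono (-k) (-k) w\<close>. The torus
  mean of \<open>f * cnj E\<close> is therefore \<open>norm (E z) ^ 2\<close> times the Laurent
  coefficient, which leaves the integral as a constant.\<close>

lemma Omega_inner_diag_mono:
  assumes f: "f \<in> bergman_space Omega"
  shows "L2_inner_on Omega f (diag_mono Omega k)
    = laurent_mean f (int k) (int k) (7/2, 7/2) * of_real ((L2_norm_on Omega (diag_mono Omega k))\<^sup>2)"
proof -
  let ?W = "Omega \<inter> no_axes"
  define c where "c = laurent_mean f (int k) (int k) (7/2, 7/2)"
  define E where "E = diag_mono Omega k"
  define F where "F = (\<lambda>z. f z * cnj (E z))"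
  have W: "open ?W" "reinhardt ?W"
    using open_Omega open_no_axes reinhardt_Omega reinhardt_no_axes by (auto intro: reinhardt_Int)
  have E: "E \<in> bergman_space Omega"
    unfolding E_def by (rule diag_mono_bergman[OF open_Omega Omega_finite Omega_prod_bound])
  have hol: "holomorphic2_on (\<lambda>z. tmono (- int k) (- int k) z * f z) ?W"
    by (intro holomorphic2_on_mult holomorphic2_on_tmono holomorphic2_on_subset[OF bergman_spaceD(1)[OF f]])
      (auto simp: no_axes_def)
  have [measurable]: "f \<in> borel_measurable borel" "E \<in> borel_measurable borel"
    using bergman_space_borel[OF open_Omega] f E by auto
  have cnj_m [measurable]: "cnj \<in> borel_measurable borel"
    by (intro borel_measurable_continuous_onI continuous_intros)
  have Fm [measurable]: "F \<in> borel_measurable borel" unfolding F_def by measurable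
  \<comment> \<open>The axes are null, so the integral may be taken where the Laurent coefficient
    makes sense.\<close>
  have ind_eq: "AE z in lborel. indicator Omega z *\<^sub>R G z = indicator ?W z *\<^sub>R G z" for G :: "_ \<Rightarrow> complex"
    using AE_no_axes by (rule AE_mp) (auto simp: indicator_def)
  have [measurable]: "Omega \<in> sets borel" "?W \<in> sets borel" using open_Omega W by auto
  have iF: "integrable (lebesgue_on Omega) F"
    unfolding F_def by (rule L2_inner_integrable[OF bergman_spaceD(2)[OF f] bergman_spaceD(2)[OF E]])
  then have "integrable lborel (\<lambda>z. indicator Omega z *\<^sub>R F z)"
    by (subst (asm) integral_lebesgue_on_borel(2)) auto
  then have "integrable lborel (\<lambda>z. indicator ?W z *\<^sub>R F z)"
    by (subst (asm) integrable_cong_AE[OF _ _ ind_eq]) auto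
  then have iFW: "integrable (lebesgue_on ?W) F"
    by (subst integral_lebesgue_on_borel(2)) auto
  have Ez: "E z = tmono (int k) (int k) z" if "z \<in> Omega" for z
    using that by (simp add: E_def monomial_def tmono_def)
  have "L2_inner_on Omega f E = (\<integral>z. indicator Omega z *\<^sub>R F z \<partial>lborel)"
    unfolding L2_inner_on_def F_def[symmetric] by (subst integral_lebesgue_on_borel(1)) auto
  also have "\<dots> = (\<integral>z. indicator ?W z *\<^sub>R F z \<partial>lborel)"
    by (rule integral_cong_AE) (use ind_eq in auto)
  also have "\<dots> = integral\<^sup>L (lebesgue_on ?W) F"
    by (subst integral_lebesgue_on_borel(1)) auto
  also have "\<dots> = (\<integral>z. indicator ?W z *\<^sub>R (of_real ((norm (E z))\<^sup>2) * c) \<partial>lborel)"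
  proof (rule reinhardt_mean[OF _ W(2) Fm iFW])
    fix z assume z: "z \<in> ?W"
    have rz: "rot u z \<in> ?W" if "u \<in> unit_torus" for u
      using W(2) z that unfolding reinhardt_def by (auto simp del: split_paired_All)
    have "continuous_on ?W f" "continuous_on ?W E"
      using holomorphic2_continuous_on[OF holomorphic2_on_subset[OF bergman_spaceD(1)]] f E by blast+
    then show "continuous_on (cbox (0, 0) (1, 1)) (\<lambda>p. F (rot (tor p) z))"
      unfolding F_def using continuous_on_rot_torus[OF W(2) _ z]
      by (intro continuous_on_tor continuous_intros)
    have "torus_mean (\<lambda>u. F (rot u z)) = torus_mean (\<lambda>u. of_real ((norm (E z))\<^sup>2) *
        (tmono (- int k) (- int k) (rot u z) * f (rot u z)))"
    proof (rule torus_mean_cong)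
      fix u assume u: "u \<in> unit_torus"
      define e where "e = tmono (int k) (int k) (rot u z)"
      have "norm e = norm (E z)"
        using z by (simp add: e_def tmono_rot norm_mult norm_tmono_torus[OF u] Ez)
      moreover have "e * tmono (- int k) (- int k) (rot u z) = 1"
        unfolding e_def using rz[OF u] by (intro tmono_cancel) auto
      moreover have "of_real ((norm e)\<^sup>2) = e * cnj e" by (rule complex_norm_square)
      ultimately have ce: "of_real ((norm (E z))\<^sup>2) * tmono (- int k) (- int k) (rot u z) = cnj e"
        by (metis mult.assoc mult.commute mult_1)
      have "E (rot u z) = e" using rz[OF u] by (simp add: Ez e_def)
      then show "F (rot u z) = of_real ((norm (E z))\<^sup>2) * (tmono (- int k) (- int k) (rot u z) * f (rot u z))"
        unfolding F_def mult.assoc[symmetric] ce by (simp only: mult.commute)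
    qed
    also have "\<dots> = of_real ((norm (E z))\<^sup>2) * laurent_mean f (int k) (int k) z"
      unfolding laurent_mean_def by (rule torus_mean_cmult)
    also have "laurent_mean f (int k) (int k) z = c"
      unfolding c_def laurent_mean_def by (rule Omega_torus_mean_const[OF hol z])
    finally show "torus_mean (\<lambda>u. F (rot u z)) = of_real ((norm (E z))\<^sup>2) * c" .
  qed auto
  also have "\<dots> = (\<integral>z. indicator Omega z *\<^sub>R (of_real ((norm (E z))\<^sup>2) * c) \<partial>lborel)"
  proof (rule integral_cong_AE)
    show "AE z in lborel. indicator ?W z *\<^sub>R (of_real ((norm (E z))\<^sup>2) * c)
        = indicator Omega z *\<^sub>R (of_real ((norm (E z))\<^sup>2) * c)"
      using AE_no_axes by (rule AE_mp) (auto simp: indicator_def)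
  qed measurable
  also have "\<dots> = (\<integral>z. of_real ((norm (E z))\<^sup>2) * c \<partial>lebesgue_on Omega)"
    by (subst integral_lebesgue_on_borel(1)) auto
  also have "\<dots> = of_real ((L2_norm_on Omega E)\<^sup>2) * c"
    unfolding L2_norm_sq by (simp flip: of_real_power)
  finally show ?thesis by (simp add: E_def c_def mult.commute)
qed

text \<open>All Laurent coefficients vanish: off the diagonal by divergence of the monomial
  integrals, for negative powers by extension to the origin, for the others by orthogonality.
  Fourier uniqueness then makes the mean of \<open>norm f ^ 2\<close> vanish on every torus off the
  axes.\<close>

lemma Omega_orthogonal_diag_mono_zero:
  assumes f: "f \<in> bergman_space Omega" and orth: "\<And>k. L2_inner_on Omega f (diag_mono Omega k) = 0"
  shows "f = (\<lambda>z. 0)"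
proof -
  let ?W = "Omega \<inter> no_axes"
  have W: "open ?W" "reinhardt ?W"
    using open_Omega open_no_axes reinhardt_Omega reinhardt_no_axes by (auto intro: reinhardt_Int)
  have fm [measurable]: "f \<in> borel_measurable borel" using bergman_space_borel[OF open_Omega f] .
  have [measurable]: "Omega \<in> sets borel" "?W \<in> sets borel" using open_Omega W by auto
  have base: "(7/2, 7/2) \<in> ?W"
    using bidisc_subset_Omega by (auto simp: bidisc_def no_axes_def)
  have diag: "laurent_mean f (int k) (int k) (7/2, 7/2) = 0" for k
  proof -
    have "L2_norm_on Omega (diag_mono Omega k) \<noteq> 0"
    proof
      assume "L2_norm_on Omega (diag_mono Omega k) = 0"
      from bergman_norm_zero[OF open_Omega diag_mono_bergman[OF open_Omega Omega_finite Omega_prod_bound] this]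
      have "diag_mono Omega k (7/2, 7/2) = 0" by simp
      then show False using base by (simp add: monomial_def)
    qed
    then show ?thesis using Omega_inner_diag_mono[OF f, of k] orth[of k] by simp
  qed
  have all: "laurent_mean f n m z = 0" if z: "z \<in> ?W" for n m z
  proof (cases "n = m")
    case False
    then show ?thesis by (rule Omega_laurent_mean_off_diagonal[OF f z])
  next
    case True
    show ?thesis
    proof (cases "n < 0")
      case True
      then show ?thesis using Omega_laurent_mean_negative[OF f z] \<open>n = m\<close> by simp
    next
      case False
      then obtain k where k: "n = int k" using nonneg_int_cases by (metis linorder_not_less)
      have "holomorphic2_on (\<lambda>z. tmono (- int k) (- int k) z * f z) ?W"
        by (intro holomorphic2_on_mult holomorphic2_on_tmono holomorphic2_on_subset[OF bergman_spaceD(1)[OF f]])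
          (auto simp: no_axes_def)
      from Omega_torus_mean_const[OF this z]
      show ?thesis using diag[of k] \<open>n = m\<close> k by (simp add: laurent_mean_def)
    qed
  qed
  have inner0: "(\<integral>\<^sup>+p. ennreal ((norm (f (rot (tor p) z)))\<^sup>2) * indicator (cbox (0,0) (1,1)) p \<partial>lborel) = 0"
    if z: "z \<in> ?W" for z
  proof -
    define F where "F = (\<lambda>u. f (rot u z))"
    have cF: "continuous_on unit_torus F"
      unfolding F_def using z
      by (intro continuous_on_rot_torus[OF W(2)] holomorphic2_continuous_on holomorphic2_on_subset[OF bergman_spaceD(1)[OF f]]) auto
    have "fourier_null F"
      unfolding fourier_null_def
    proof (intro conjI allI cF)
      fix m n
      show "torus_mean (\<lambda>u. tmono m n u * F u) = 0"
        using fourier_coefficient_laurent_mean[of z "-m" "-n" f] z all[OF z] by (simp add: F_def)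
    qed
    then have "torus_mean (\<lambda>u. cnj (F u) * F u) = 0" by (rule fourier_null_mean_square)
    moreover have c2: "continuous_on unit_torus (\<lambda>u. cnj (F u) * F u)" by (intro continuous_intros cF)
    moreover have eq: "indicator (cbox (0,0) (1,1)) p *\<^sub>R (cnj (F (tor p)) * F (tor p))
        = complex_of_real (indicator (cbox (0,0) (1,1)) p * (norm (F (tor p)))\<^sup>2)" for p
      using complex_norm_square[of "F (tor p)"] by (simp add: scaleR_conv_of_real mult.commute)
    ultimately have "(\<integral>p. complex_of_real (indicator (cbox (0,0) (1,1)) p * (norm (F (tor p)))\<^sup>2) \<partial>lborel) = 0"
      and i: "integrable lborel (\<lambda>p. complex_of_real (indicator (cbox (0,0) (1,1)) p * (norm (F (tor p)))\<^sup>2))"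
      using torus_mean_lborel[OF continuous_on_tor[OF c2]] unfolding eq by simp_all
    then have z0: "(\<integral>p. indicator (cbox (0,0) (1,1)) p * (norm (F (tor p)))\<^sup>2 \<partial>lborel) = 0"
      by (simp only: integral_complex_of_real of_real_eq_0_iff)
    have i': "integrable lborel (\<lambda>p. indicator (cbox (0,0) (1,1)) p * (norm (F (tor p)))\<^sup>2)"
      using i by (simp only: complex_of_real_integrable_eq)
    have "(\<integral>\<^sup>+p. ennreal ((norm (f (rot (tor p) z)))\<^sup>2) * indicator (cbox (0,0) (1,1)) p \<partial>lborel)
      = (\<integral>\<^sup>+p. ennreal (indicator (cbox (0,0) (1,1)) p * (norm (F (tor p)))\<^sup>2) \<partial>lborel)"
      by (intro nn_integral_cong) (auto simp: F_def indicator_def)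
    also have "\<dots> = ennreal 0"
      using nn_integral_eq_integral[OF i'] z0 by simp
    finally show ?thesis by simp
  qed
  have "(\<integral>\<^sup>+z. (\<integral>\<^sup>+p. ennreal ((norm (f (rot (tor p) z)))\<^sup>2) * indicator (cbox (0,0) (1,1)) p \<partial>lborel)
      * indicator ?W z \<partial>lborel) = (\<integral>\<^sup>+z. 0 \<partial>(lborel :: (complex \<times> complex) measure))"
  proof (rule nn_integral_cong)
    fix z
    show "(\<integral>\<^sup>+p. ennreal ((norm (f (rot (tor p) z)))\<^sup>2) * indicator (cbox (0,0) (1,1)) p \<partial>lborel) * indicator ?W z = 0"
      by (cases "z \<in> ?W") (simp_all only: inner0 mult_zero_left indicator_simps mult_zero_right not_False_eq_True)
  qed
  then have "(\<integral>\<^sup>+z. ennreal ((norm (f z))\<^sup>2) * indicator ?W z \<partial>lborel) = 0"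
    using reinhardt_nn_mean[of ?W "\<lambda>z. ennreal ((norm (f z))\<^sup>2)"] W by simp
  moreover have "(\<integral>\<^sup>+z. ennreal ((norm (f z))\<^sup>2) * indicator Omega z \<partial>lborel)
      = (\<integral>\<^sup>+z. ennreal ((norm (f z))\<^sup>2) * indicator ?W z \<partial>lborel)"
    by (rule nn_integral_cong_AE) (use AE_no_axes in \<open>rule AE_mp, auto simp: indicator_def\<close>)
  ultimately have "(\<integral>\<^sup>+z. ennreal ((norm (f z))\<^sup>2) \<partial>lebesgue_on Omega) = 0"
    by (subst nn_integral_lebesgue_on_borel) auto
  then have "L2_norm_on Omega f = 0"
    using nn_integral_L2_norm[OF bergman_spaceD(2)[OF f]] by simp
  then show ?thesis by (rule bergman_norm_zero[OF open_Omega f])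
qed

section \<open>Domains whose Bergman space is spanned by powers of the product\<close>

text \<open>Rotating the first coordinate by \<open>pi / d\<close> multiplies \<open>F\<close> by -1
  but preserves the integral.\<close>

lemma reinhardt_rot_eigenfunction_integral_zero:
  fixes F :: "complex \<times> complex \<Rightarrow> complex"
  assumes W: "open W" "reinhardt W" and F: "F \<in> borel_measurable borel"
    and eig: "\<And>\<theta> z. z \<in> W \<Longrightarrow> F (rot (cis \<theta>, 1) z) = cis (real_of_int d * \<theta>) * F z" and d: "d \<noteq> 0"
  shows "integral\<^sup>L (lebesgue_on W) F = 0"
proof -
  have [measurable]: "W \<in> sets borel" using W by simp
  define u where "u = (cis (pi / real_of_int d), 1 :: complex)"
  define I where "I = (\<integral>z. indicator W z *\<^sub>R F z \<partial>lborel)"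
  have "I = (\<integral>z. indicator W z *\<^sub>R F (rot u z) \<partial>lborel)"
    unfolding I_def by (rule integral_rot(1)[symmetric]) (use W F in \<open>auto simp: u_def\<close>)
  also have "\<dots> = (\<integral>z. - (indicator W z *\<^sub>R F z) \<partial>lborel)"
  proof (rule Bochner_Integration.integral_cong[OF refl])
    fix z
    have "cis (real_of_int d * (pi / real_of_int d)) = -1" using d by simp
    then show "indicator W z *\<^sub>R F (rot u z) = - (indicator W z *\<^sub>R F z)"
      using eig[of z "pi / real_of_int d"] by (cases "z \<in> W") (auto simp: u_def)
  qed
  also have "\<dots> = - I" unfolding I_def by simp
  finally have "I = 0" by simp
  then show ?thesis
    using integral_lebesgue_on_borel(1)[of W F] F unfolding I_def by simp
qed

text \<open>The first exponents already distinguish the members of both families used later: the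
  powers of \<open>z1 z2\<close> and the powers of \<open>z1\<close>.\<close>

lemma monomial_orthogonal:
  assumes W: "open W" "reinhardt W" and "i \<noteq> j"
  shows "L2_inner_on W (monomial W i k) (monomial W j l) = 0"
  unfolding L2_inner_on_def
proof (rule reinhardt_rot_eigenfunction_integral_zero[OF W, where d = "int i - int j"])
  note [measurable] = monomial_borel[OF W(1)]
  have [measurable]: "cnj \<in> borel_measurable borel"
    by (intro borel_measurable_continuous_onI continuous_intros)
  show "(\<lambda>z. monomial W i k z * cnj (monomial W j l z)) \<in> borel_measurable borel" by measurable
  fix \<theta> z assume z: "z \<in> W"
  have r: "rot (cis \<theta>, 1) z \<in> W" using reinhardt_rot_iff[OF W(2), of "(cis \<theta>, 1)" z] z by simp
  have rot: "monomial W a b (rot (cis \<theta>, 1) z) = cis (real a * \<theta>) * monomial W a b z" for a b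
  proof -
    have "cis \<theta> ^ a = cis (real a * \<theta>)" by (rule Complex.DeMoivre)
    then show ?thesis using r z by (simp only: monomial_def if_True) (simp add: rot_def power_mult_distrib)
  qed
  have cis: "cis (real i * \<theta>) * cnj (cis (real j * \<theta>)) = cis (real_of_int (int i - int j) * \<theta>)"
    by (simp add: cis_cnj cis_mult left_diff_distrib)
  show "monomial W i k (rot (cis \<theta>, 1) z) * cnj (monomial W j l (rot (cis \<theta>, 1) z))
      = cis (real_of_int (int i - int j) * \<theta>) * (monomial W i k z * cnj (monomial W j l z))"
    unfolding rot complex_cnj_mult cis[symmetric] by (simp only: mult.assoc mult.left_commute)
qed (use assms in simp)

lemma conj_symbol_measurable: "conj_symbol \<in> borel_measurable borel"
  unfolding conj_symbol_def case_prod_unfold by (intro borel_measurable_continuous_onI continuous_intros)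

lemma norm_conj_symbol: "norm (conj_symbol z) = norm (fst z * snd z)"
  by (simp add: conj_symbol_def case_prod_unfold norm_mult)

text \<open>Collects what \<open>Omega\<close> and its mirror image share. The point
  \<open>(1, 1)\<close> witnesses that no power of the product is the zero function;
  \<open>complete_W\<close> carries the outcome of the Laurent analysis.\<close>

locale diagonal_domain =
  fixes W :: "(complex \<times> complex) set"
  assumes open_W: "open W" and reinhardt_W: "reinhardt W" and fin_W: "emeasure lborel W < \<infinity>"
    and bound_W: "\<And>z. z \<in> W \<Longrightarrow> norm (fst z * snd z) \<le> 16"
    and one_W: "(1, 1) \<in> W"
    and complete_W: "\<And>f. f \<in> bergman_space W \<Longrightarrow> (\<And>k. L2_inner_on W f (diag_mono W k) = 0) \<Longrightarrow> f = (\<lambda>z. 0)"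
begin

abbreviation "E \<equiv> diag_mono W"

definition c :: "nat \<Rightarrow> real" where "c k = (L2_norm_on W (E k))\<^sup>2"

definition e :: "nat \<Rightarrow> complex \<times> complex \<Rightarrow> complex" where
  "e k = (\<lambda>z. of_real (1 / sqrt (c k)) * E k z)"

lemma E_bergman: "E k \<in> bergman_space W"
  by (rule diag_mono_bergman[OF open_W fin_W bound_W])

lemma E_L2: "E k \<in> L2_on W"
  using bergman_spaceD(2)[OF E_bergman] .

lemma c_pos: "c k > 0"
proof -
  have "L2_norm_on W (E k) \<noteq> 0"
  proof
    assume "L2_norm_on W (E k) = 0"
    from bergman_norm_zero[OF open_W E_bergman this] have "E k (1, 1) = 0" by simp
    then show False using one_W by (simp add: monomial_def)
  qed
  then show ?thesis unfolding c_def by simp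
qed

lemma e_bergman: "e k \<in> bergman_space W"
  unfolding e_def by (rule bergman_space_scale[OF E_bergman])

lemma e_L2: "e k \<in> L2_on W"
  using bergman_spaceD(2)[OF e_bergman] .

lemma E_inner: "L2_inner_on W (E j) (E k) = (if j = k then of_real (c k) else 0)"
  by (simp add: c_def L2_inner_self monomial_orthogonal[OF open_W reinhardt_W])

lemma e_inner: "L2_inner_on W (e j) (e k) = (if j = k then 1 else 0)"
proof -
  have "sqrt (c k) * sqrt (c k) = c k" using c_pos[of k] by simp
  then have "complex_of_real (sqrt (c k)) * complex_of_real (sqrt (c k)) = of_real (c k)"
    by (metis of_real_mult)
  then show ?thesis
    using c_pos[of k]
    unfolding e_def L2_inner_scale_left L2_inner_scale_right E_inner by (simp add: field_simps)
qed

lemma inj_e: "inj e"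
proof (rule injI)
  fix j k assume "e j = e k"
  then show "j = k" using e_inner[of j k] e_inner[of k k] by (auto split: if_splits)
qed

text \<open>Bessel makes the partial sums Cauchy, so they have a limit \<open>H\<close> in the
  space. The difference \<open>f - H\<close> is orthogonal to every \<open>e k\<close>, and
  \<open>complete_W\<close> identifies \<open>H\<close> with \<open>f\<close>.\<close>

lemma e_expansion:
  assumes f: "f \<in> bergman_space W"
  shows "(\<lambda>n. L2_norm_on W (\<lambda>z. f z - (\<Sum>k<n. L2_inner_on W f (e k) * e k z))) \<longlonglongrightarrow> 0"
proof -
  define a where "a = (\<lambda>k. L2_inner_on W f (e k))"
  define p where "p = (\<lambda>n z. \<Sum>k<n. a k * e k z)"
  have fL: "f \<in> L2_on W" using bergman_spaceD(2)[OF f] .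
  have p: "p n \<in> bergman_space W" for n
    unfolding p_def by (intro bergman_space_sum bergman_space_scale e_bergman)
  have pL: "p n \<in> L2_on W" for n using bergman_spaceD(2)[OF p] .
  have "summable (\<lambda>k. (norm (a k))\<^sup>2)"
  proof (rule summableI_nonneg_bounded)
    show "(\<Sum>k<n. (norm (a k))\<^sup>2) \<le> (L2_norm_on W f)\<^sup>2" for n
      unfolding a_def by (rule L2_Bessel) (auto simp: e_L2 fL e_inner)
  qed simp
  then have tail: "\<exists>N. \<forall>m\<ge>N. \<forall>n. norm (\<Sum>k\<in>{m..<n}. (norm (a k))\<^sup>2) < \<epsilon>" if "\<epsilon> > 0" for \<epsilon>
    using that unfolding summable_Cauchy by blast
  have pdiff: "(L2_norm_on W (\<lambda>z. p n z - p m z))\<^sup>2 = (\<Sum>k\<in>{m..<n}. (norm (a k))\<^sup>2)" if "m \<le> n" for m n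
  proof -
    have "p n z - p m z = (\<Sum>k\<in>{m..<n}. a k * e k z)" for z
      unfolding p_def using sum_diff_nat_ivl[of 0 m n "\<lambda>k. a k * e k z"] that by (simp add: atLeast0LessThan)
    then show ?thesis
      using L2_norm_orthogonal_sum_sq[of "{m..<n}" e W a] by (simp add: e_L2 e_inner)
  qed
  have "\<exists>N. \<forall>m\<ge>N. \<forall>n\<ge>N. L2_norm_on W (\<lambda>z. p m z - p n z) \<le> \<epsilon>" if "\<epsilon> > 0" for \<epsilon>
  proof -
    obtain N where N: "\<And>m n. m \<ge> N \<Longrightarrow> norm (\<Sum>k\<in>{m..<n}. (norm (a k))\<^sup>2) < \<epsilon>\<^sup>2"
      using tail[of "\<epsilon>\<^sup>2"] \<open>\<epsilon> > 0\<close> by auto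
    have *: "L2_norm_on W (\<lambda>z. p n z - p m z) \<le> \<epsilon>" if "m \<ge> N" "m \<le> n" for m n
    proof (rule power2_le_imp_le)
      show "(L2_norm_on W (\<lambda>z. p n z - p m z))\<^sup>2 \<le> \<epsilon>\<^sup>2"
        unfolding pdiff[OF that(2)] using N[OF that(1), of n] by simp
    qed (use \<open>\<epsilon> > 0\<close> in simp)
    have "L2_norm_on W (\<lambda>z. p m z - p n z) \<le> \<epsilon>" if "m \<ge> N" "n \<ge> N" for m n
      using *[of m n] *[of n m] that L2_norm_diff_commute[of W "p m" "p n"] by (cases "m \<le> n") auto
    then show ?thesis by blast
  qed
  then obtain H where H: "H \<in> bergman_space W" "(\<lambda>n. L2_norm_on W (\<lambda>z. p n z - H z)) \<longlonglongrightarrow> 0"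
    using bergman_complete[of W p, OF open_W p] by blast
  have HL: "H \<in> L2_on W" using bergman_spaceD(2)[OF H(1)] .
  have fH: "(\<lambda>z. f z - H z) \<in> bergman_space W" by (rule bergman_space_diff[OF f H(1)])
  have e0: "L2_inner_on W (\<lambda>z. f z - H z) (e k) = 0" for k
  proof -
    \<comment> \<open>Past index \<open>k\<close> the partial sum has the same coefficient as
      \<open>f\<close>, so \<open>f\<close> may be replaced by \<open>p n\<close>, whose distance to
      \<open>H\<close> tends to 0.\<close>
    have "norm (L2_inner_on W (\<lambda>z. f z - H z) (e k)) \<le> L2_norm_on W (\<lambda>z. p n z - H z)" if "n \<ge> Suc k" for n
    proof -
      have "L2_inner_on W (p n) (e k) = (\<Sum>i<n. a i * L2_inner_on W (e i) (e k))"
        unfolding p_def by (subst L2_inner_sum_left) (auto simp: L2_inner_scale_left e_L2 L2_on_scale)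
      also have "\<dots> = (\<Sum>i<n. if i = k then a i else 0)" by (intro sum.cong) (auto simp: e_inner)
      also have "\<dots> = a k" using that by simp
      finally have "L2_inner_on W (\<lambda>z. f z - H z) (e k) = L2_inner_on W (\<lambda>z. p n z - H z) (e k)"
        using fL HL pL e_L2 by (simp add: L2_inner_diff_left a_def)
      then have "norm (L2_inner_on W (\<lambda>z. f z - H z) (e k)) \<le> L2_norm_on W (\<lambda>z. p n z - H z) * L2_norm_on W (e k)"
        using L2_Cauchy_Schwarz[OF L2_on_diff[OF pL HL] e_L2, of n k] by simp
      moreover have "L2_norm_on W (e k) = 1"
      proof -
        have "complex_of_real ((L2_norm_on W (e k))\<^sup>2) = 1" using e_inner[of k k] L2_inner_self[of W "e k"] by simp
        then have "(L2_norm_on W (e k))\<^sup>2 = 1\<^sup>2" by (metis of_real_eq_1_iff one_power2)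
        then show ?thesis by (rule power2_eq_imp_eq) auto
      qed
      ultimately show ?thesis by simp
    qed
    then have "norm (L2_inner_on W (\<lambda>z. f z - H z) (e k)) \<le> 0"
      using LIMSEQ_le_const[OF H(2)] by blast
    then show ?thesis by simp
  qed
  have "(\<lambda>z. f z - H z) = (\<lambda>z. 0)"
  proof (rule complete_W[OF fH])
    fix k
    have "L2_inner_on W (\<lambda>z. f z - H z) (e k) = of_real (1 / sqrt (c k)) * L2_inner_on W (\<lambda>z. f z - H z) (E k)"
      unfolding e_def by (simp only: L2_inner_scale_right complex_cnj_complex_of_real)
    then show "L2_inner_on W (\<lambda>z. f z - H z) (E k) = 0" using e0[of k] c_pos[of k] by simp
  qed
  then have "f = H" by (metis (no_types, lifting) eq_iff_diff_eq_0 ext)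
  then show ?thesis
    using H(2) L2_norm_diff_commute[of W f] unfolding p_def a_def by simp
qed

lemma orthonormal_basis: "bergman_orthonormal_basis W (range e)"
  unfolding bergman_orthonormal_basis_def
proof (intro conjI ballI allI impI)
  show "range e \<subseteq> bergman_space W" using e_bergman by blast
  show "L2_inner_on W \<xi> \<eta> = (if \<xi> = \<eta> then 1 else 0)" if "\<xi> \<in> range e" "\<eta> \<in> range e" for \<xi> \<eta>
    using that e_inner inj_e by (auto simp: inj_eq)
  fix f \<epsilon> assume f: "f \<in> bergman_space W" and "\<epsilon> > (0::real)"
  then obtain n where n: "L2_norm_on W (\<lambda>z. f z - (\<Sum>k<n. L2_inner_on W f (e k) * e k z)) < \<epsilon>"
    using LIMSEQ_D[OF e_expansion[OF f], of \<epsilon>] by auto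
  have "(\<Sum>\<xi>\<in>e ` {..<n}. L2_inner_on W f \<xi> * \<xi> z) = (\<Sum>k<n. L2_inner_on W f (e k) * e k z)" for z
    unfolding sum.reindex[OF inj_on_subset[OF inj_e subset_UNIV]] o_def ..
  then show "\<exists>S c. finite S \<and> S \<subseteq> range e \<and> L2_norm_on W (\<lambda>z. f z - (\<Sum>\<xi>\<in>S. c \<xi> * \<xi> z)) < \<epsilon>"
    using n by (intro exI[of _ "e ` {..<n}"] exI[of _ "L2_inner_on W f"]) auto
qed

lemma conj_symbol_meas: "conj_symbol \<in> borel_measurable (lebesgue_on W)"
  by (rule borel_imp_lebesgue_on_measurable[OF conj_symbol_measurable])

lemma conj_symbol_bound: "z \<in> W \<Longrightarrow> norm (conj_symbol z) \<le> 16"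
  using bound_W by (simp add: norm_conj_symbol)

lemma conj_symbol_L2: "f \<in> L2_on W \<Longrightarrow> (\<lambda>z. conj_symbol z * f z) \<in> L2_on W"
  by (rule L2_on_mult_bounded[OF _ conj_symbol_meas conj_symbol_bound])

lemma norm_conj_symbol_E: "(L2_norm_on W (\<lambda>z. conj_symbol z * E k z))\<^sup>2 = c (Suc k)"
proof -
  have "norm (conj_symbol z * E k z) = norm (E (Suc k) z)" for z
    by (simp add: norm_mult norm_conj_symbol monomial_def norm_power mult_ac)
  then show ?thesis by (simp add: c_def L2_norm_sq)
qed

text \<open>Moving the conjugate factor over to \<open>E k\<close> turns the latter into
  \<open>E (Suc k)\<close>.\<close>

lemma inner_conj_symbol_E: "L2_inner_on W (\<lambda>z. conj_symbol z * E (Suc k) z) (E k) = of_real (c (Suc k))"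
proof -
  have "conj_symbol z * E (Suc k) z * cnj (E k z) = E (Suc k) z * cnj (E (Suc k) z)" for z
    by (simp add: conj_symbol_def case_prod_unfold monomial_def mult_ac)
  then have "L2_inner_on W (\<lambda>z. conj_symbol z * E (Suc k) z) (E k) = L2_inner_on W (E (Suc k)) (E (Suc k))"
    unfolding L2_inner_on_def by (simp only:)
  then show ?thesis by (simp add: E_inner)
qed

text \<open>Besides being a norm ratio, this is the coefficient with which
  \<open>conj_symbol * E (Suc k)\<close> projects onto the line of \<open>E k\<close>.\<close>

definition r :: "nat \<Rightarrow> real" where "r k = c (Suc k) / c k"

lemma r_bound: "r k \<le> 256"
proof -
  have "L2_norm_on W (\<lambda>z. conj_symbol z * E k z) \<le> 16 * L2_norm_on W (E k)"
    by (rule L2_norm_mult_bounded[OF E_L2 conj_symbol_meas conj_symbol_bound]) auto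
  then have "(L2_norm_on W (\<lambda>z. conj_symbol z * E k z))\<^sup>2 \<le> (16 * L2_norm_on W (E k))\<^sup>2"
    by (rule power_mono) simp
  then have "c (Suc k) \<le> 256 * c k"
    unfolding norm_conj_symbol_E by (simp add: c_def power_mult_distrib)
  then show ?thesis using c_pos[of k] by (simp add: r_def field_simps)
qed

text \<open>The Hankel image realises the distance to the Bergman space, so any \<open>h\<close>
  serves as a trial function; normalising \<open>E k\<close> produces the factor
  \<open>1 / c k\<close>.\<close>

lemma hankel_e_le:
  assumes h: "h \<in> bergman_space W"
  shows "(L2_norm_on W (hankel W conj_symbol (e k)))\<^sup>2
    \<le> (L2_norm_on W (\<lambda>z. conj_symbol z * E k z - h z))\<^sup>2 / c k"
proof -
  define s where "s = complex_of_real (1 / sqrt (c k))"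
  have "L2_norm_on W (hankel W conj_symbol (e k)) \<le> L2_norm_on W (\<lambda>z. conj_symbol z * e k z - s * h z)"
    unfolding hankel_def
    by (rule bergman_proj_dist[OF open_W conj_symbol_L2[OF e_L2] bergman_space_scale[OF h]])
  also have "(\<lambda>z. conj_symbol z * e k z - s * h z) = (\<lambda>z. s * (conj_symbol z * E k z - h z))"
    by (simp add: e_def s_def algebra_simps)
  also have "L2_norm_on W \<dots> = L2_norm_on W (\<lambda>z. conj_symbol z * E k z - h z) / sqrt (c k)"
    using c_pos[of k] by (subst L2_norm_scale) (simp add: s_def norm_divide)
  finally have "(L2_norm_on W (hankel W conj_symbol (e k)))\<^sup>2
      \<le> (L2_norm_on W (\<lambda>z. conj_symbol z * E k z - h z) / sqrt (c k))\<^sup>2"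
    by (rule power_mono) simp
  then show ?thesis using c_pos[of k] by (simp add: power_divide)
qed

text \<open>There is no lower power to subtract, so the trial function is 0.\<close>

lemma hankel_e_0: "(L2_norm_on W (hankel W conj_symbol (e 0)))\<^sup>2 \<le> r 0"
  using hankel_e_le[OF bergman_space_zero, of 0] norm_conj_symbol_E[of 0] by (simp add: r_def)

text \<open>With the trial function \<open>r k * E k\<close> the squared distance is
  \<open>c (k+2) - c (k+1)^2 / c k\<close>; division by \<open>c (k+1)\<close> leaves the difference
  of consecutive ratios.\<close>

lemma hankel_e_Suc: "(L2_norm_on W (hankel W conj_symbol (e (Suc k))))\<^sup>2 \<le> r (Suc k) - r k"
proof -
  define l where "l = complex_of_real (r k)"
  have "(L2_norm_on W (\<lambda>z. conj_symbol z * E (Suc k) z - l * E k z))\<^sup>2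
      = c (Suc (Suc k)) - 2 * Re (cnj l * of_real (c (Suc k))) + (norm l)\<^sup>2 * c k"
    using L2_norm_diff_sq[OF conj_symbol_L2[OF E_L2] L2_on_scale[OF E_L2], of "Suc k" l k]
    by (simp add: L2_inner_scale_right inner_conj_symbol_E norm_conj_symbol_E L2_norm_scale power_mult_distrib c_def)
  also have "\<dots> = c (Suc (Suc k)) - 2 * (r k * c (Suc k)) + (r k)\<^sup>2 * c k"
    by (simp add: l_def)
  also have "(r k)\<^sup>2 * c k = r k * c (Suc k)"
    using c_pos[of k] by (simp add: r_def power2_eq_square)
  finally have "(L2_norm_on W (\<lambda>z. conj_symbol z * E (Suc k) z - l * E k z))\<^sup>2
      = c (Suc (Suc k)) - r k * c (Suc k)" by simp
  then show ?thesis
    using hankel_e_le[OF bergman_space_scale[OF E_bergman], of "Suc k" l k] c_pos[of "Suc k"]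
    by (simp add: r_def[of "Suc k"] diff_divide_distrib)
qed

theorem hilbert_schmidt: "hilbert_schmidt_bergman W (hankel W conj_symbol)"
  unfolding hilbert_schmidt_bergman_def
proof (intro conjI exI[of _ "range e"])
  show "bounded_linear_bergman W (hankel W conj_symbol)"
    by (rule hankel_bounded_linear[OF open_W conj_symbol_meas conj_symbol_bound]) auto
  show "bergman_orthonormal_basis W (range e)" by (rule orthonormal_basis)
  define t where "t = (\<lambda>k. (L2_norm_on W (hankel W conj_symbol (e k)))\<^sup>2)"
  \<comment> \<open>The term at 0 is at most \<open>r 0\<close>, and the increments add up to
    \<open>r n - r 0\<close>.\<close>
  have "(\<Sum>k<Suc n. t k) \<le> r n" for n
  proof (induction n)
    case 0
    then show ?case using hankel_e_0 by (simp add: t_def)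
  next
    case (Suc n)
    then show ?case using hankel_e_Suc[of n] by (simp add: t_def)
  qed
  then have "(\<Sum>k<Suc n. t k) \<le> 256" for n using r_bound order_trans by blast
  moreover have "(\<Sum>k<n. t k) \<le> (\<Sum>k<Suc n. t k)" for n by (simp add: t_def)
  ultimately have "(\<Sum>k<n. t k) \<le> 256" for n using order_trans by blast
  then have "summable t" by (intro summableI_nonneg_bounded) (auto simp: t_def)
  then have "t summable_on UNIV"
    by (subst summable_on_UNIV_nonneg_real_iff) (auto simp: t_def)
  then show "(\<lambda>\<xi>. (L2_norm_on W (hankel W conj_symbol \<xi>))\<^sup>2) summable_on range e"
    by (subst summable_on_reindex[OF inj_e]) (simp add: t_def o_def)
qed

end

section \<open>The two domains and the exchange of coordinates\<close>

lemma diagonal_domain_Omega: "diagonal_domain Omega"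
proof
  show "(1, 1) \<in> Omega" using bidisc_subset_Omega by (auto simp: bidisc_def)
qed (use open_Omega reinhardt_Omega Omega_finite Omega_prod_bound Omega_orthogonal_diag_mono_zero in auto)

lemma linear_swap: "linear (prod.swap :: complex \<times> complex \<Rightarrow> _)"
  by (rule linearI) auto

lemma lborel_distr_swap: "distr lborel borel prod.swap = (lborel :: (complex \<times> complex) measure)"
  by (rule lborel_distr_linear_isometry[OF linear_swap]) (simp add: norm_prod_def add.commute)

lemma swap_measurable [measurable]: "prod.swap \<in> borel_measurable (borel :: (complex \<times> complex) measure)"
  by (intro borel_measurable_continuous_onI continuous_on_swap)

lemma Omega'_eq: "Omega' = prod.swap ` Omega"
proof -
  have e: "set_X' = prod.swap ` set_Y" "set_Y' = prod.swap ` set_X" "set_Z = prod.swap ` set_Z"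
    by (force simp: set_X_def set_Y_def set_X'_def set_Y'_def set_Z_def)+
  have "set_X' \<union> set_Y' \<union> set_Z = prod.swap ` (set_X \<union> set_Y \<union> set_Z)"
    using e by (auto simp: image_Un)
  then show ?thesis
    unfolding Omega'_def Omega_def
    using interior_injective_linear_image[OF linear_swap inj_swap] by simp
qed

lemma swap_in_Omega': "prod.swap z \<in> Omega' \<longleftrightarrow> z \<in> Omega"
  unfolding Omega'_eq by (rule inj_image_mem_iff[OF inj_swap])

lemma integral_swap_Omega':
  fixes F :: "complex \<times> complex \<Rightarrow> 'b::{banach, second_countable_topology}"
  assumes F [measurable]: "F \<in> borel_measurable borel" and o: "open Omega'"
  shows "integral\<^sup>L (lebesgue_on Omega') F = integral\<^sup>L (lebesgue_on Omega) (\<lambda>z. F (prod.swap z))"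
    and "integrable (lebesgue_on Omega') F \<longleftrightarrow> integrable (lebesgue_on Omega) (\<lambda>z. F (prod.swap z))"
proof -
  have b [measurable]: "Omega \<in> sets borel" "Omega' \<in> sets borel" using open_Omega o by auto
  have m [measurable]: "(\<lambda>z. indicator Omega' z *\<^sub>R F z) \<in> borel_measurable borel" by measurable
  have eq: "(\<lambda>z. indicator Omega' (prod.swap z) *\<^sub>R F (prod.swap z)) = (\<lambda>z. indicator Omega z *\<^sub>R F (prod.swap z))"
    by (simp add: indicator_def swap_in_Omega' del: swap_simp)
  show "integral\<^sup>L (lebesgue_on Omega') F = integral\<^sup>L (lebesgue_on Omega) (\<lambda>z. F (prod.swap z))"
    using integral_distr[of prod.swap lborel borel "\<lambda>z. indicator Omega' z *\<^sub>R F z"] lborel_distr_swap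
    unfolding eq by (simp add: integral_lebesgue_on_borel)
  show "integrable (lebesgue_on Omega') F \<longleftrightarrow> integrable (lebesgue_on Omega) (\<lambda>z. F (prod.swap z))"
    using integrable_distr_eq[of prod.swap lborel borel "\<lambda>z. indicator Omega' z *\<^sub>R F z"] lborel_distr_swap
    unfolding eq by (simp add: integral_lebesgue_on_borel)
qed

lemma bergman_space_swap:
  assumes o: "open Omega'" and f: "f \<in> bergman_space Omega'"
  shows "(\<lambda>z. f (prod.swap z)) \<in> bergman_space Omega"
  unfolding bergman_space_def
proof safe
  have fm [measurable]: "f \<in> borel_measurable borel" using bergman_space_borel[OF o f] .
  show "holomorphic2_on (\<lambda>z. f (prod.swap z)) Omega"
    unfolding holomorphic2_on_def
  proof
    fix z assume "z \<in> Omega"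
    then obtain a b where "(f has_derivative (\<lambda>h. a * fst h + b * snd h)) (at (prod.swap z))"
      using bergman_spaceD(1)[OF f] swap_in_Omega' unfolding holomorphic2_on_def by blast
    from has_derivative_compose[OF linear_imp_has_derivative[OF linear_swap] this]
    have "((\<lambda>z. f (prod.swap z)) has_derivative (\<lambda>h. b * fst h + a * snd h)) (at z)"
      by (simp add: add.commute)
    then show "\<exists>a b. ((\<lambda>z. f (prod.swap z)) has_derivative (\<lambda>h. a * fst h + b * snd h)) (at z)" by blast
  qed
  have m: "(\<lambda>z. f (prod.swap z)) \<in> borel_measurable borel" by measurable
  have i: "integrable (lebesgue_on Omega) (\<lambda>z. (norm (f (prod.swap z)))\<^sup>2)"
    using integral_swap_Omega'(2)[of "\<lambda>z. (norm (f z))\<^sup>2", OF _ o] L2_onD(2)[OF bergman_spaceD(2)[OF f]] by simp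
  show "(\<lambda>z. f (prod.swap z)) \<in> L2_on Omega"
    unfolding L2_on_def using borel_imp_lebesgue_on_measurable[OF m] i by blast
  show "f (prod.swap (a, b)) = 0" if "(a, b) \<notin> Omega" for a b
    using bergman_spaceD(3)[OF f] that swap_in_Omega'[of "(a, b)"] by blast
qed

lemma diagonal_domain_Omega': "diagonal_domain Omega'"
proof
  show o: "open Omega'" by (simp add: Omega'_def)
  have Omega_swap: "z \<in> Omega' \<longleftrightarrow> prod.swap z \<in> Omega" for z using swap_in_Omega'[of "prod.swap z"] by simp
  show "reinhardt Omega'"
    unfolding reinhardt_def
  proof (intro allI impI)
    fix u z :: "complex \<times> complex" assume *: "z \<in> Omega'" "norm (fst u) = 1" "norm (snd u) = 1"
    have "rot (prod.swap u) (prod.swap z) \<in> Omega"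
      using reinhardt_Omega * unfolding reinhardt_def Omega_swap by (simp del: split_paired_All)
    then show "rot u z \<in> Omega'" unfolding Omega_swap by (simp add: rot_def)
  qed
  have "emeasure lborel Omega' = emeasure (distr lborel borel prod.swap) Omega'" by (simp only: lborel_distr_swap)
  also have "\<dots> = emeasure lborel (prod.swap -` Omega')" using o by (subst emeasure_distr) auto
  also have "prod.swap -` Omega' = Omega" using swap_in_Omega' by blast
  finally show "emeasure lborel Omega' < \<infinity>" using Omega_finite by simp
  show "norm (fst z * snd z) \<le> 16" if "z \<in> Omega'" for z
    using Omega_prod_bound[of "prod.swap z"] that by (simp add: Omega_swap mult.commute)
  show "(1, 1) \<in> Omega'" unfolding Omega_swap using bidisc_subset_Omega by (auto simp: bidisc_def)
  fix f assume f: "f \<in> bergman_space Omega'" and orth: "\<And>k. L2_inner_on Omega' f (diag_mono Omega' k) = 0"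
  have [measurable]: "f \<in> borel_measurable borel" using bergman_space_borel[OF o f] .
  have cnj_m [measurable]: "cnj \<in> borel_measurable borel"
    by (intro borel_measurable_continuous_onI continuous_intros)
  have "(\<lambda>z. f (prod.swap z)) = (\<lambda>z. 0)"
  proof (rule Omega_orthogonal_diag_mono_zero[OF bergman_space_swap[OF o f]])
    fix k
    note [measurable] = monomial_borel[OF o]
    \<comment> \<open>Powers of the product are symmetric in the coordinates, so completeness of the
      same family carries over.\<close>
    have "diag_mono Omega' k (prod.swap z) = diag_mono Omega k z" for z
      by (simp add: monomial_def swap_in_Omega' mult.commute del: swap_simp)
    then have "L2_inner_on Omega' f (diag_mono Omega' k) = L2_inner_on Omega (\<lambda>z. f (prod.swap z)) (diag_mono Omega k)"
      unfolding L2_inner_on_def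
      by (subst integral_swap_Omega'(1)[OF _ o]) (auto, measurable)
    then show "L2_inner_on Omega (\<lambda>z. f (prod.swap z)) (diag_mono Omega k) = 0" using orth by simp
  qed
  then show "f = (\<lambda>z. 0)" by (metis swap_swap)
qed

section \<open>The bidisc\<close>

context
  fixes W :: "(complex \<times> complex) set" and \<phi> :: "complex \<times> complex \<Rightarrow> complex" and C :: real
  assumes W: "open W" and \<phi>: "\<phi> \<in> borel_measurable (lebesgue_on W)"
    and C: "\<And>z. z \<in> W \<Longrightarrow> norm (\<phi> z) \<le> C" "C \<ge> 0"
begin

text \<open>Outside the finite set \<open>S\<close>, Cauchy-Schwarz pairs Bessel's bound for the
  coefficients of \<open>f\<close> with the assumed bound for the images; in effect the operator is
  within \<open>\<delta>\<close> of one of finite rank. The basis only approximates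
  \<open>f\<close>, so an error \<open>\<epsilon>\<close> is carried along and sent to 0.\<close>

lemma hankel_norm_le_tail:
  assumes B: "bergman_orthonormal_basis W B"
    and S: "finite S" "S \<subseteq> B" and f: "f \<in> bergman_space W" and \<delta>: "\<delta> \<ge> 0"
    and tail: "\<And>F. finite F \<Longrightarrow> F \<subseteq> B - S \<Longrightarrow> (\<Sum>\<xi>\<in>F. (L2_norm_on W (hankel W \<phi> \<xi>))\<^sup>2) \<le> \<delta>\<^sup>2"
  shows "L2_norm_on W (hankel W \<phi> f)
    \<le> (\<Sum>\<xi>\<in>S. norm (L2_inner_on W f \<xi>) * L2_norm_on W (hankel W \<phi> \<xi>)) + \<delta> * L2_norm_on W f"
proof (rule field_le_epsilon)
  fix \<epsilon> :: real assume \<epsilon>: "\<epsilon> > 0"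
  define T where "T = hankel W \<phi>"
  define a where "a = L2_inner_on W f"
  have Tprops: "f \<in> bergman_space W \<Longrightarrow> hankel W \<phi> f \<in> L2_on W"
    "f \<in> bergman_space W \<Longrightarrow> L2_norm_on W (hankel W \<phi> f) \<le> C * L2_norm_on W f"
    "f \<in> bergman_space W \<Longrightarrow> g \<in> bergman_space W \<Longrightarrow>
      hankel W \<phi> (\<lambda>w. f w + g w) z = hankel W \<phi> f z + hankel W \<phi> g z"
    "finite S \<Longrightarrow> S \<subseteq> bergman_space W \<Longrightarrow>
      hankel W \<phi> (\<lambda>w. \<Sum>\<xi>\<in>S. c \<xi> * \<xi> w) z = (\<Sum>\<xi>\<in>S. c \<xi> * hankel W \<phi> \<xi> z)" for f g z S c
    using W \<phi> C by (blast intro: hankel_L2 hankel_norm_le hankel_add hankel_sum)+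
  have BW: "B \<subseteq> bergman_space W"
    and orth: "\<And>\<xi> \<eta>. \<xi> \<in> B \<Longrightarrow> \<eta> \<in> B \<Longrightarrow> L2_inner_on W \<xi> \<eta> = (if \<xi> = \<eta> then 1 else 0)"
    and dense: "\<And>f \<epsilon>. f \<in> bergman_space W \<Longrightarrow> \<epsilon> > 0 \<Longrightarrow> \<exists>S c. finite S \<and> S \<subseteq> B \<and>
      L2_norm_on W (\<lambda>z. f z - (\<Sum>\<xi>\<in>S. c \<xi> * \<xi> z)) < \<epsilon>"
    using B unfolding bergman_orthonormal_basis_def by blast+
  have L: "\<xi> \<in> L2_on W" if "\<xi> \<in> B" for \<xi> using BW that bergman_spaceD(2) by blast
  have fL: "f \<in> L2_on W" using bergman_spaceD(2)[OF f] .
  \<comment> \<open>The remainder of \<open>f\<close>, of norm at most \<open>\<eta>\<close>, then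
    has an image of norm at most \<open>\<epsilon>\<close>; \<open>C + 1\<close> covers
    \<open>C = 0\<close>.\<close>
  define \<eta> where "\<eta> = \<epsilon> / (C + 1)"
  have \<eta>: "\<eta> > 0" using \<epsilon> C(2) by (simp add: \<eta>_def add_nonneg_pos)
  obtain S0 c0 where S0: "finite S0" "S0 \<subseteq> B" "L2_norm_on W (\<lambda>z. f z - (\<Sum>\<xi>\<in>S0. c0 \<xi> * \<xi> z)) < \<eta>"
    using dense[OF f \<eta>] by blast
  define S' where "S' = S0 \<union> S"
  \<comment> \<open>Zero extension of \<open>c0\<close>, so that the given approximant can be
    compared with the Fourier sum over the larger set.\<close>
  define c' where "c' = (\<lambda>\<xi>. if \<xi> \<in> S0 then c0 \<xi> else 0)"
  have S': "finite S'" "S' \<subseteq> B" using S S0 by (auto simp: S'_def)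
  have sum_c': "(\<Sum>\<xi>\<in>S'. c' \<xi> * \<xi> z) = (\<Sum>\<xi>\<in>S0. c0 \<xi> * \<xi> z)" for z
    by (rule sum.mono_neutral_cong_right) (use S' in \<open>auto simp: c'_def S'_def\<close>)
  define p where "p = (\<lambda>z. \<Sum>\<xi>\<in>S'. a \<xi> * \<xi> z)"
  define g where "g = (\<lambda>z. f z - p z)"
  have p: "p \<in> bergman_space W"
    unfolding p_def using S' BW by (intro bergman_space_sum bergman_space_scale) auto
  have g: "g \<in> bergman_space W" unfolding g_def by (rule bergman_space_diff[OF f p])
  have res: "(L2_norm_on W (\<lambda>z. f z - (\<Sum>\<xi>\<in>S'. d \<xi> * \<xi> z)))\<^sup>2
      = (L2_norm_on W f)\<^sup>2 - (\<Sum>\<xi>\<in>S'. (norm (a \<xi>))\<^sup>2) + (\<Sum>\<xi>\<in>S'. (norm (a \<xi> - d \<xi>))\<^sup>2)" for d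
    unfolding a_def
  proof (rule L2_orthonormal_residual_sq[OF S'(1) _ fL])
    show "\<xi> \<in> L2_on W" if "\<xi> \<in> S'" for \<xi> using that S'(2) L by blast
    show "L2_inner_on W \<xi> \<eta> = (if \<xi> = \<eta> then 1 else 0)" if "\<xi> \<in> S'" "\<eta> \<in> S'" for \<xi> \<eta>
      by (rule orth) (use that S'(2) in blast)+
  qed
  have g_sq: "(L2_norm_on W g)\<^sup>2 = (L2_norm_on W f)\<^sup>2 - (\<Sum>\<xi>\<in>S'. (norm (a \<xi>))\<^sup>2)"
    using res[of a] by (simp add: g_def p_def)
  have "(L2_norm_on W g)\<^sup>2 \<le> (L2_norm_on W (\<lambda>z. f z - (\<Sum>\<xi>\<in>S'. c' \<xi> * \<xi> z)))\<^sup>2"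
    unfolding g_sq res[of c'] by (simp add: sum_nonneg)
  then have "(L2_norm_on W g)\<^sup>2 \<le> (L2_norm_on W (\<lambda>z. f z - (\<Sum>\<xi>\<in>S0. c0 \<xi> * \<xi> z)))\<^sup>2"
    by (simp only: sum_c')
  then have "L2_norm_on W g \<le> L2_norm_on W (\<lambda>z. f z - (\<Sum>\<xi>\<in>S0. c0 \<xi> * \<xi> z))"
    by (rule power2_le_imp_le) simp
  with S0(3) have g_small: "L2_norm_on W g \<le> \<eta>" by linarith
  have a_le: "(\<Sum>\<xi>\<in>S'. (norm (a \<xi>))\<^sup>2) \<le> (L2_norm_on W f)\<^sup>2"
    using g_sq zero_le_power2[of "L2_norm_on W g"] by linarith
  have Tf: "T f z = T g z + T p z" for z
    using Tprops(3)[OF g p, of z] by (simp add: T_def g_def)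
  have Tp: "T p z = (\<Sum>\<xi>\<in>S'. a \<xi> * T \<xi> z)" for z
    unfolding T_def p_def by (rule Tprops(4)) (use S' BW in auto)
  have TL: "T \<xi> \<in> L2_on W" if "\<xi> \<in> bergman_space W" for \<xi> unfolding T_def by (rule Tprops(1)[OF that])
  have "L2_norm_on W (T f) \<le> L2_norm_on W (T g) + L2_norm_on W (T p)"
    using L2_norm_triangle[OF TL[OF g] TL[OF p]] by (simp only: Tf[symmetric])
  also have "L2_norm_on W (T g) \<le> \<epsilon>"
  proof -
    have "L2_norm_on W (T g) \<le> C * L2_norm_on W g" unfolding T_def by (rule Tprops(2)[OF g])
    also have "\<dots> \<le> (C + 1) * \<eta>" using g_small C(2) \<eta> by (intro mult_mono) auto
    also have "\<dots> = \<epsilon>" using C(2) by (simp add: \<eta>_def)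
    finally show ?thesis .
  qed
  also have "L2_norm_on W (T p) \<le> (\<Sum>\<xi>\<in>S'. norm (a \<xi>) * L2_norm_on W (T \<xi>))"
  proof -
    have "L2_norm_on W (T p) = L2_norm_on W (\<lambda>z. \<Sum>\<xi>\<in>S'. a \<xi> * T \<xi> z)" by (rule L2_norm_cong) (rule Tp)
    also have "\<dots> \<le> (\<Sum>\<xi>\<in>S'. L2_norm_on W (\<lambda>z. a \<xi> * T \<xi> z))"
      by (rule L2_norm_sum_le) (use S'(2) BW TL L2_on_scale in blast)
    finally show ?thesis by (simp add: L2_norm_scale)
  qed
  also have "(\<Sum>\<xi>\<in>S'. norm (a \<xi>) * L2_norm_on W (T \<xi>))
      = (\<Sum>\<xi>\<in>S. norm (a \<xi>) * L2_norm_on W (T \<xi>)) + (\<Sum>\<xi>\<in>S' - S. norm (a \<xi>) * L2_norm_on W (T \<xi>))"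
    using S'(1) by (subst sum.subset_diff[of S S']) (auto simp: S'_def)
  also have "(\<Sum>\<xi>\<in>S' - S. norm (a \<xi>) * L2_norm_on W (T \<xi>)) \<le> \<delta> * L2_norm_on W f"
  proof (rule power2_le_imp_le)
    have "(\<Sum>\<xi>\<in>S' - S. norm (a \<xi>) * L2_norm_on W (T \<xi>))\<^sup>2
        \<le> (\<Sum>\<xi>\<in>S' - S. (norm (a \<xi>))\<^sup>2) * (\<Sum>\<xi>\<in>S' - S. (L2_norm_on W (T \<xi>))\<^sup>2)"
      by (rule Cauchy_Schwarz_ineq_sum)
    also have "\<dots> \<le> (L2_norm_on W f)\<^sup>2 * \<delta>\<^sup>2"
    proof (rule mult_mono)
      have "(\<Sum>\<xi>\<in>S' - S. (norm (a \<xi>))\<^sup>2) \<le> (\<Sum>\<xi>\<in>S'. (norm (a \<xi>))\<^sup>2)"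
        by (rule sum_mono2) (use S'(1) in auto)
      then show "(\<Sum>\<xi>\<in>S' - S. (norm (a \<xi>))\<^sup>2) \<le> (L2_norm_on W f)\<^sup>2" using a_le by linarith
      show "(\<Sum>\<xi>\<in>S' - S. (L2_norm_on W (T \<xi>))\<^sup>2) \<le> \<delta>\<^sup>2"
        unfolding T_def by (rule tail) (use S' in auto)
    qed (auto intro!: sum_nonneg)
    also have "\<dots> = (\<delta> * L2_norm_on W f)\<^sup>2" by (simp add: power_mult_distrib mult.commute)
    finally show "(\<Sum>\<xi>\<in>S' - S. norm (a \<xi>) * L2_norm_on W (T \<xi>))\<^sup>2 \<le> (\<delta> * L2_norm_on W f)\<^sup>2" .
  qed (use \<delta> in simp)
  finally show "L2_norm_on W (hankel W \<phi> f)
    \<le> (\<Sum>\<xi>\<in>S. norm (L2_inner_on W f \<xi>) * L2_norm_on W (hankel W \<phi> \<xi>)) + \<delta> * L2_norm_on W f + \<epsilon>"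
    by (simp add: T_def a_def)
qed

text \<open>A Hilbert-Schmidt operator is compact, hence maps an orthonormal sequence to a null sequence.\<close>

lemma not_hilbert_schmidt_hankel:
  assumes v: "\<And>n::nat. v n \<in> bergman_space W"
    and v_orth: "\<And>m n. L2_inner_on W (v m) (v n) = (if m = n then 1 else 0)"
    and v_large: "\<And>n. L2_norm_on W (hankel W \<phi> (v n)) \<ge> 1"
  shows "\<not> hilbert_schmidt_bergman W (hankel W \<phi>)"
proof
  assume "hilbert_schmidt_bergman W (hankel W \<phi>)"
  then obtain B where B: "bergman_orthonormal_basis W B"
    and sum: "(\<lambda>\<xi>. (L2_norm_on W (hankel W \<phi> \<xi>))\<^sup>2) summable_on B"
    unfolding hilbert_schmidt_bergman_def by blast
  define t where "t = (\<lambda>\<xi>. (L2_norm_on W (hankel W \<phi> \<xi>))\<^sup>2)"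
  \<comment> \<open>\<open>1/4\<close> is the square of \<open>1/2\<close>: the tail then accounts
    for at most half of a norm that is at least 1.\<close>
  obtain S where S: "finite S" "S \<subseteq> B" "dist (sum t S) (infsum t B) \<le> 1/4"
    using infsum_finite_approximation[OF sum, of "1/4"] unfolding t_def by auto
  have tail: "(\<Sum>\<xi>\<in>F. t \<xi>) \<le> (1/2)\<^sup>2" if F: "finite F" "F \<subseteq> B - S" for F
  proof -
    have "sum t (S \<union> F) \<le> infsum t B"
      by (rule finite_sum_le_infsum) (use sum F S in \<open>auto simp: t_def\<close>)
    moreover have "sum t (S \<union> F) = sum t S + sum t F"
      by (rule sum.union_disjoint) (use F S in auto)
    ultimately show ?thesis using S(3) unfolding dist_real_def power2_eq_square by linarith
  qed
  have vL: "v n \<in> L2_on W" for n using bergman_spaceD(2)[OF v] .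
  have v1: "L2_norm_on W (v n) = 1" for n
  proof -
    have "complex_of_real ((L2_norm_on W (v n))\<^sup>2) = 1" using v_orth[of n n] L2_inner_self[of W "v n"] by simp
    then have "(L2_norm_on W (v n))\<^sup>2 = 1\<^sup>2" by (metis of_real_eq_1_iff one_power2)
    then show ?thesis by (rule power2_eq_imp_eq) auto
  qed
  have lim: "(\<lambda>n. norm (L2_inner_on W (v n) \<xi>)) \<longlonglongrightarrow> 0" if \<xi>: "\<xi> \<in> B" for \<xi>
  proof -
    have \<xi>L: "\<xi> \<in> L2_on W"
      using B \<xi> bergman_spaceD(2) unfolding bergman_orthonormal_basis_def by blast
    \<comment> \<open>Bessel with the roles exchanged: the coefficients of the fixed
      \<open>\<xi>\<close> along the orthonormal sequence \<open>v\<close> are square summable, so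
      \<open>v\<close> tends to 0 weakly.\<close>
    have "summable (\<lambda>n. (norm (L2_inner_on W \<xi> (v n)))\<^sup>2)"
    proof (rule summableI_nonneg_bounded)
      show "(\<Sum>k<n. (norm (L2_inner_on W \<xi> (v k)))\<^sup>2) \<le> (L2_norm_on W \<xi>)\<^sup>2" for n
        by (rule L2_Bessel) (auto simp: vL \<xi>L v_orth)
    qed simp
    then have "(\<lambda>n. (norm (L2_inner_on W \<xi> (v n)))\<^sup>2) \<longlonglongrightarrow> 0" by (rule summable_LIMSEQ_zero)
    then have "(\<lambda>n. sqrt ((norm (L2_inner_on W \<xi> (v n)))\<^sup>2)) \<longlonglongrightarrow> sqrt 0" by (rule tendsto_real_sqrt)
    moreover have "norm (L2_inner_on W \<xi> (v n)) = norm (L2_inner_on W (v n) \<xi>)" for n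
      by (subst L2_inner_cnj) simp
    ultimately show ?thesis by simp
  qed
  have le: "1 \<le> (\<Sum>\<xi>\<in>S. norm (L2_inner_on W (v n) \<xi>) * L2_norm_on W (hankel W \<phi> \<xi>)) + 1 / 2" for n
    using hankel_norm_le_tail[OF B S(1,2) v[of n], of "1/2"] tail v1[of n] v_large[of n]
    unfolding t_def by fastforce
  have "(\<lambda>n. (\<Sum>\<xi>\<in>S. norm (L2_inner_on W (v n) \<xi>) * L2_norm_on W (hankel W \<phi> \<xi>)) + 1 / 2)
      \<longlonglongrightarrow> (\<Sum>\<xi>\<in>S. 0 * L2_norm_on W (hankel W \<phi> \<xi>)) + 1 / 2"
    by (intro tendsto_intros lim) (use S(2) in blast)
  then have "1 \<le> (\<Sum>\<xi>\<in>S. 0 * L2_norm_on W (hankel W \<phi> \<xi>)) + 1 / 2"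
    by (rule LIMSEQ_le_const) (use le in blast)
  then show False by simp
qed

end

text \<open>Tails in the same direction are separated by the product: \<open>norm (z1 * z2)\<close>
  is below \<open>1/2\<close> on \<open>set_X\<close> and \<open>set_Y'\<close>, and above
  \<open>1/2\<close> on \<open>set_X'\<close> and \<open>set_Y\<close>. All other pairs are
  separated by which coordinates exceed 4 in modulus, and interiors commute with the
  intersection.\<close>

lemma Omega_Int_Omega': "Omega \<inter> Omega' = bidisc"
proof -
  have X: "norm a > 4 \<and> norm (a * b) < 1 / 2 \<and> norm b \<le> 4" if "(a, b) \<in> set_X" for a b
  proof -
    have *: "norm a > 4" "norm b * (2 * norm a * log 4 (norm a)) < 1" using that by (auto simp: set_X_iff)
    have "norm b * (2 * norm a * 1) \<le> norm b * (2 * norm a * log 4 (norm a))"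
      using log4_gt_1[OF *(1)] by (intro mult_left_mono) auto
    then have "norm b * (2 * norm a * 1) < 1" using * by linarith
    then have ab: "norm a * norm b < 1 / 2" by (simp add: mult.commute mult.left_commute)
    have "4 * norm b \<le> norm a * norm b" using * by (intro mult_right_mono) auto
    then have "norm b \<le> 4" using ab by linarith
    then show ?thesis using * ab by (simp add: norm_mult)
  qed
  have Y: "norm b > 4 \<and> norm (a * b) > 1 / 2 \<and> norm a \<le> 4" if "(a, b) \<in> set_Y" for a b
  proof -
    have *: "norm b > 4" "\<bar>norm a - 1 / norm b\<bar> < 1 / norm b ^ 3" using that by (auto simp: set_Y_def)
    have "1 / norm b \<le> 1 / 4" by (rule frac_le) (use * in auto)
    moreover have "1 / norm b ^ 3 \<le> 1 / 4 ^ 3" by (intro frac_le power_mono) (use * in auto)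
    ultimately have a4: "norm a \<le> 4" using * by simp
    have "(1 / norm b - 1 / norm b ^ 3) * norm b \<le> norm a * norm b"
      using * by (intro mult_right_mono) auto
    moreover have "(1 / norm b - 1 / norm b ^ 3) * norm b = 1 - 1 / (norm b)\<^sup>2"
    proof -
      have "b \<noteq> 0" using * by auto
      then show ?thesis by (simp add: field_simps power2_eq_square power3_eq_cube)
    qed
    moreover have "1 / (norm b)\<^sup>2 \<le> 1 / 4\<^sup>2" using * by (intro frac_le power_mono) auto
    ultimately have "norm a * norm b > 1 / 2" by simp
    then show ?thesis using * a4 by (simp add: norm_mult)
  qed
  have X': "norm a > 4 \<and> norm (a * b) > 1 / 2 \<and> norm b \<le> 4" if "(a, b) \<in> set_X'" for a b
    using Y[of b a] that by (auto simp: set_X'_def set_Y_def mult.commute)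
  have Y': "norm b > 4 \<and> norm (a * b) < 1 / 2 \<and> norm a \<le> 4" if "(a, b) \<in> set_Y'" for a b
    using X[of b a] that by (auto simp: set_Y'_def set_X_def mult.commute)
  have Z: "norm a \<le> 4 \<and> norm b \<le> 4" if "(a, b) \<in> set_Z" for a b using that by (simp add: set_Z_def)
  have "(set_X \<union> set_Y \<union> set_Z) \<inter> (set_X' \<union> set_Y' \<union> set_Z) = set_Z"
    using X Y X' Y' Z by (auto, fastforce+)
  then have "Omega \<inter> Omega' = interior set_Z"
    unfolding Omega_def Omega'_def interior_Int[symmetric] by simp
  also have "set_Z = cball 0 4 \<times> cball 0 4" by (auto simp: set_Z_def)
  also have "interior (cball 0 4 \<times> cball 0 4 :: (complex \<times> complex) set) = bidisc"
    by (simp add: interior_Times bidisc_def)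
  finally show ?thesis .
qed

lemma open_bidisc: "open bidisc" by (simp add: bidisc_def open_Times)

lemma reinhardt_bidisc: "reinhardt bidisc"
  by (auto simp: reinhardt_def rot_def bidisc_def norm_mult)

lemma bidisc_finite: "emeasure lborel bidisc < \<infinity>"
  by (intro emeasure_bounded_finite) (simp add: bidisc_def bounded_Times)

lemma bidisc_conj_symbol_bound: "z \<in> bidisc \<Longrightarrow> norm (conj_symbol z) \<le> 16"
proof -
  assume "z \<in> bidisc"
  then have "norm (fst z) * norm (snd z) \<le> 4 * 4" by (intro mult_mono) (auto simp: bidisc_def)
  then show ?thesis by (simp add: norm_conj_symbol norm_mult)
qed

abbreviation zpow :: "nat \<Rightarrow> complex \<times> complex \<Rightarrow> complex" where
  "zpow n \<equiv> monomial bidisc n 0"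

lemma zpow_bergman: "zpow n \<in> bergman_space bidisc"
  by (rule monomial_bergman[OF open_bidisc bidisc_finite, where B = "4 ^ n"])
    (auto simp: bidisc_def norm_power intro!: power_mono)

lemmas zpow_orthogonal = monomial_orthogonal[OF open_bidisc reinhardt_bidisc]

text \<open>The function \<open>cnj z1 * cnj z2 * z1 ^ n\<close> has no holomorphic part because of the factor \<open>cnj z2\<close>.\<close>

lemma conj_symbol_zpow_orthogonal:
  assumes k: "k \<in> bergman_space bidisc"
  shows "L2_inner_on bidisc (\<lambda>z. conj_symbol z * zpow n z) k = 0"
proof -
  \<comment> \<open>The null set \<open>fst z = 0\<close> is removed because \<open>G\<close>
    contains the power \<open>1 - n\<close> of \<open>z1\<close>, which may be negative.\<close>
  define V where "V = {z \<in> bidisc. fst z \<noteq> 0}"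
  define F where "F = (\<lambda>z. conj_symbol z * zpow n z * cnj (k z))"
  \<comment> \<open>Since \<open>cnj z1 * z1^n = norm z1 ^ (2 * n) * cnj (z1^(1 - n))\<close>, on
    each torus \<open>F\<close> is a constant times \<open>cnj G\<close>, and \<open>G\<close> is
    holomorphic in \<open>z2\<close> with a zero at \<open>z2 = 0\<close>.\<close>
  define G where "G = (\<lambda>z. tmono (1 - int n) 1 z * k z)"
  have Ve: "V = bidisc \<inter> (- {0}) \<times> UNIV" by (auto simp: V_def)
  have V: "open V" unfolding Ve using open_bidisc by (intro open_Int open_Times open_Compl) auto
  have Vr: "reinhardt V"
    using reinhardt_bidisc by (auto simp: reinhardt_def V_def rot_def)
  have [measurable]: "V \<in> sets borel" "bidisc \<in> sets borel" using V open_bidisc by auto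
  have [measurable]: "zpow n \<in> borel_measurable borel" "k \<in> borel_measurable borel" "cnj \<in> borel_measurable borel"
    using bergman_space_borel[OF open_bidisc] zpow_bergman k by (auto intro!: borel_measurable_continuous_onI continuous_intros)
  note [measurable] = conj_symbol_measurable
  have Fm [measurable]: "F \<in> borel_measurable borel" unfolding F_def by measurable
  have hk: "holomorphic2_on k V"
    using bergman_spaceD(1)[OF k] by (rule holomorphic2_on_subset) (auto simp: V_def)
  have hG: "holomorphic2_on G V"
    unfolding G_def by (intro holomorphic2_on_mult holomorphic2_on_tmono hk) (auto simp: V_def)
  have ae: "AE z in lborel. indicator bidisc z *\<^sub>R F z = indicator V z *\<^sub>R F z"
    using AE_no_axes by (rule AE_mp) (auto simp: indicator_def V_def no_axes_def)
  have "(\<lambda>z. conj_symbol z * zpow n z) \<in> L2_on bidisc"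
    by (rule L2_on_mult_bounded[OF bergman_spaceD(2)[OF zpow_bergman]
        borel_imp_lebesgue_on_measurable[OF conj_symbol_measurable] bidisc_conj_symbol_bound])
  then have "integrable (lebesgue_on bidisc) F"
    unfolding F_def by (rule L2_inner_integrable[OF _ bergman_spaceD(2)[OF k]])
  then have "integrable lborel (\<lambda>z. indicator bidisc z *\<^sub>R F z)"
    by (subst (asm) integral_lebesgue_on_borel(2)) auto
  then have "integrable lborel (\<lambda>z. indicator V z *\<^sub>R F z)"
    by (subst (asm) integrable_cong_AE[OF _ _ ae]) auto
  then have iV: "integrable (lebesgue_on V) F"
    by (subst integral_lebesgue_on_borel(2)) auto
  have "L2_inner_on bidisc (\<lambda>z. conj_symbol z * zpow n z) k = (\<integral>z. indicator bidisc z *\<^sub>R F z \<partial>lborel)"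
    unfolding L2_inner_on_def F_def[symmetric] by (subst integral_lebesgue_on_borel(1)) auto
  also have "\<dots> = (\<integral>z. indicator V z *\<^sub>R F z \<partial>lborel)"
    by (rule integral_cong_AE) (use ae in auto)
  also have "\<dots> = integral\<^sup>L (lebesgue_on V) F"
    by (subst integral_lebesgue_on_borel(1)) auto
  also have "\<dots> = (\<integral>z. indicator V z *\<^sub>R (0 :: complex) \<partial>lborel)"
  proof (rule reinhardt_mean[OF _ Vr Fm iV])
    fix z assume z: "z \<in> V"
    obtain z1 z2 where zz: "z = (z1, z2)" by (cases z)
    have rz: "rot u z \<in> V" if "u \<in> unit_torus" for u
      using Vr z that unfolding reinhardt_def by (auto simp del: split_paired_All)
    have Feq: "F (rot u z) = of_real (norm z1 ^ (2 * n)) * cnj (G (rot u z))" if u: "u \<in> unit_torus" for u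
    proof -
      define w where "w = fst u * z1"
      have w: "w \<noteq> 0" "norm w = norm z1"
        using rz[OF u] u by (auto simp: V_def rot_def zz w_def norm_mult)
      have "complex_of_real (norm z1 ^ (2 * n)) = (w * cnj w) ^ n"
        unfolding complex_norm_square[symmetric] w(2) by (simp add: power_mult)
      then have r: "of_real (norm z1 ^ (2 * n)) = w ^ n * cnj w ^ n" by (simp only: power_mult_distrib)
      have key: "cnj w ^ n * cnj (w powi (1 - int n)) = cnj w"
      proof -
        have "w ^ n * w powi (1 - int n) = w"
          using w(1) power_int_add[of w "int n" "1 - int n"] by simp
        then show ?thesis by (metis complex_cnj_mult complex_cnj_power)
      qed
      define v where "v = snd u * z2"
      define \<kappa> where "\<kappa> = k (rot u z)"
      have "F (rot u z) = cnj w * cnj v * w ^ n * cnj \<kappa>"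
        using rz[OF u] by (simp add: F_def conj_symbol_def monomial_def V_def rot_def zz w_def v_def \<kappa>_def)
      also have "\<dots> = w ^ n * (cnj w ^ n * cnj (w powi (1 - int n))) * cnj v * cnj \<kappa>"
        unfolding key by (simp only: mult_ac)
      also have "\<dots> = of_real (norm z1 ^ (2 * n)) * cnj (w powi (1 - int n) * v * \<kappa>)"
        unfolding r complex_cnj_mult by (simp only: mult_ac)
      also have "w powi (1 - int n) * v * \<kappa> = G (rot u z)"
        by (simp add: G_def tmono_def rot_def zz w_def v_def \<kappa>_def)
      finally show ?thesis .
    qed
    have cG: "continuous_on unit_torus (\<lambda>u. G (rot u z))"
      by (rule continuous_on_rot_torus[OF Vr holomorphic2_continuous_on[OF hG] z])
    have "continuous_on unit_torus (\<lambda>u. of_real (norm z1 ^ (2 * n)) * cnj (G (rot u z)))"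
      by (intro continuous_intros cG)
    then have "continuous_on unit_torus (\<lambda>u. F (rot u z))"
      using Feq continuous_on_cong by (metis (no_types, lifting))
    then show "continuous_on (cbox (0, 0) (1, 1)) (\<lambda>p. F (rot (tor p) z))"
      by (rule continuous_on_tor)
    \<comment> \<open>The second radius can be shrunk to 0 within \<open>V\<close>, and there the
      factor \<open>z2\<close> makes \<open>G\<close> vanish.\<close>
    have "torus_mean (\<lambda>u. G (rot u (z1, z2))) = torus_mean (\<lambda>u. G (rot u (z1, 0)))"
      by (rule torus_mean_slice2[OF V Vr hG, of "ball 0 4"]) (use z in \<open>auto simp: V_def bidisc_def zz\<close>)
    also have "\<dots> = 0" by (simp add: G_def tmono_def rot_def torus_mean_constant)
    finally have G0: "torus_mean (\<lambda>u. G (rot u z)) = 0" by (simp add: zz)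
    have "torus_mean (\<lambda>u. F (rot u z)) = torus_mean (\<lambda>u. of_real (norm z1 ^ (2 * n)) * cnj (G (rot u z)))"
      by (rule torus_mean_cong) (rule Feq)
    also have "\<dots> = of_real (norm z1 ^ (2 * n)) * torus_mean (\<lambda>u. cnj (G (rot u z)))"
      by (rule torus_mean_cmult)
    also have "torus_mean (\<lambda>u. cnj (G (rot u z))) = cnj (torus_mean (\<lambda>u. G (rot u z)))"
      unfolding torus_mean_def by (rule Henstock_Kurzweil_Integration.integral_cnj[symmetric])
    finally show "torus_mean (\<lambda>u. F (rot u z)) = 0" using G0 by simp
  qed auto
  also have "\<dots> = 0" by simp
  finally show ?thesis .
qed

lemma hankel_zpow: "hankel bidisc conj_symbol (zpow n) = (\<lambda>z. conj_symbol z * zpow n z)"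
proof -
  have "(\<lambda>z. conj_symbol z * zpow n z) \<in> L2_on bidisc"
    by (rule L2_on_mult_bounded[OF bergman_spaceD(2)[OF zpow_bergman]
        borel_imp_lebesgue_on_measurable[OF conj_symbol_measurable] bidisc_conj_symbol_bound])
  from bergman_proj_eqI[OF open_bidisc this bergman_space_zero]
  have "bergman_proj bidisc (\<lambda>z. conj_symbol z * zpow n z) = (\<lambda>z. 0)"
    using conj_symbol_zpow_orthogonal by simp
  then show ?thesis by (simp add: hankel_def)
qed

text \<open>Squared norm of the power with exponent \<open>n\<close> on the disc of radius 4; on the
  bidisc, squared norms of monomials are products of two such moments.\<close>

definition disc_moment :: "nat \<Rightarrow> ennreal" where
  "disc_moment n = (\<integral>\<^sup>+z. ennreal (norm z ^ (2 * n)) * indicator (ball (0::complex) 4) z \<partial>lborel)"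

lemma bidisc_moment:
  "(\<integral>\<^sup>+z. ennreal (norm (fst z) ^ (2 * m) * norm (snd z) ^ (2 * n)) * indicator bidisc z \<partial>lborel)
    = disc_moment m * disc_moment n"
proof -
  have [measurable]: "ball (0::complex) 4 \<in> sets borel" by simp
  let ?f = "\<lambda>m z. ennreal (norm z ^ (2 * m)) * indicator (ball (0::complex) 4) z"
  have [measurable]: "?f m \<in> borel_measurable borel" for m by measurable
  have "(\<integral>\<^sup>+z. ennreal (norm (fst z) ^ (2 * m) * norm (snd z) ^ (2 * n)) * indicator bidisc z \<partial>lborel)
      = (\<integral>\<^sup>+z. ?f m (fst z) * ?f n (snd z) \<partial>(lborel \<Otimes>\<^sub>M lborel))"
    unfolding lborel_prod by (intro nn_integral_cong) (auto simp: bidisc_def indicator_def ennreal_mult)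
  also have "\<dots> = (\<integral>\<^sup>+x. \<integral>\<^sup>+y. ?f m x * ?f n y \<partial>lborel \<partial>lborel)"
    by (subst lborel.nn_integral_fst[symmetric]) auto
  also have "\<dots> = (\<integral>\<^sup>+x. ?f m x * disc_moment n \<partial>lborel)"
    unfolding disc_moment_def by (intro nn_integral_cong nn_integral_cmult) measurable
  also have "\<dots> = disc_moment m * disc_moment n"
    unfolding disc_moment_def by (rule nn_integral_multc) measurable
  finally show ?thesis .
qed

lemma disc_moment_0: "disc_moment 0 = ennreal (16 * pi)"
  unfolding disc_moment_def by (simp add: emeasure_complex_ball mult.commute)

text \<open>The annulus with moduli from 2 to 4 alone contributes at least
  \<open>4 * 12 * pi\<close>, already more than \<open>16 * pi\<close>.\<close>

lemma disc_moment_1_ge: "disc_moment 0 \<le> disc_moment 1"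
proof -
  let ?A = "{z::complex. 2 \<le> norm z \<and> norm z < 4}"
  have "disc_moment 0 \<le> ennreal 4 * ennreal (pi * (4\<^sup>2 - 2\<^sup>2))"
    unfolding disc_moment_0 by (subst ennreal_mult[symmetric]) (auto intro!: ennreal_leI)
  also have "\<dots> = ennreal 4 * emeasure lborel ?A" by (subst emeasure_annulus(2)) auto
  also have "\<dots> = (\<integral>\<^sup>+z. ennreal 4 * indicator ?A z \<partial>lborel)"
    by (rule nn_integral_cmult_indicator[symmetric]) measurable
  also have "\<dots> \<le> disc_moment 1"
    unfolding disc_moment_def
  proof (rule nn_integral_mono)
    fix z :: complex
    have "4 \<le> (norm z)\<^sup>2" if "2 \<le> norm z" using power_mono[OF that, of 2] by simp
    then show "ennreal 4 * indicator ?A z \<le> ennreal (norm z ^ (2 * 1)) * indicator (ball 0 4) z"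
      by (auto simp: indicator_def intro!: ennreal_leI)
  qed
  finally show ?thesis .
qed

text \<open>Integrating \<open>(x - 1) * (x^n - 1) \<ge> 0\<close> with
  \<open>x = norm z ^ 2\<close> gives \<open>disc_moment n + disc_moment 1 \<le> disc_moment (Suc n)
  + disc_moment 0\<close>; the comparison of the first two moments then finishes.\<close>

lemma disc_moment_Suc_ge: "disc_moment n \<le> disc_moment (Suc n)"
proof -
  have [measurable]: "ball (0::complex) 4 \<in> sets borel" by simp
  have m [measurable]: "(\<lambda>z. ennreal (norm z ^ (2 * k)) * indicator (ball (0::complex) 4) z) \<in> borel_measurable borel" for k
    by measurable
  have pt: "norm z ^ (2 * n) + norm z ^ (2 * 1) \<le> norm z ^ (2 * Suc n) + norm z ^ (2 * 0)" for z :: complex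
  proof -
    define x where "x = (norm z)\<^sup>2"
    have "0 \<le> (x - 1) * (x ^ n - 1)"
    proof (cases "x \<ge> 1")
      case True
      then show ?thesis by simp
    next
      case False
      then have "x ^ n \<le> 1" by (intro power_le_one) (auto simp: x_def)
      then show ?thesis using False by (intro mult_nonpos_nonpos) auto
    qed
    then show ?thesis unfolding power_mult x_def[symmetric] by (simp add: algebra_simps)
  qed
  have "disc_moment n + disc_moment 1 = (\<integral>\<^sup>+z. ennreal (norm z ^ (2 * n)) * indicator (ball (0::complex) 4) z
      + ennreal (norm z ^ (2 * 1)) * indicator (ball 0 4) z \<partial>lborel)"
    unfolding disc_moment_def by (rule nn_integral_add[symmetric]) measurable
  also have "\<dots> \<le> (\<integral>\<^sup>+z. ennreal (norm z ^ (2 * Suc n)) * indicator (ball (0::complex) 4) z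
      + ennreal (norm z ^ (2 * 0)) * indicator (ball 0 4) z \<partial>lborel)"
  proof (rule nn_integral_mono)
    fix z :: complex
    show "ennreal (norm z ^ (2 * n)) * indicator (ball (0::complex) 4) z + ennreal (norm z ^ (2 * 1)) * indicator (ball 0 4) z
      \<le> ennreal (norm z ^ (2 * Suc n)) * indicator (ball (0::complex) 4) z + ennreal (norm z ^ (2 * 0)) * indicator (ball 0 4) z"
      using ennreal_leI[OF pt[of z]] by (simp add: indicator_def ennreal_plus del: power_Suc)
  qed
  also have "\<dots> = disc_moment (Suc n) + disc_moment 0"
    unfolding disc_moment_def by (rule nn_integral_add) measurable
  finally have "disc_moment n + disc_moment 1 \<le> disc_moment (Suc n) + disc_moment 0" .
  then have "disc_moment n + disc_moment 0 \<le> disc_moment (Suc n) + disc_moment 0"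
    using add_left_mono[OF disc_moment_1_ge, of "disc_moment n"] by (rule order_trans[rotated])
  \<comment> \<open>Cancellation in \<open>ennreal\<close> rests on \<open>disc_moment 0\<close>
    being finite.\<close>
  then show ?thesis by (simp add: disc_moment_0)
qed

text \<open>Both squared norms factor into disc moments. The modulus of the symbol raises each
  exponent by 1, and the moments do not decrease with the exponent.\<close>

lemma norm_zpow_le: "L2_norm_on bidisc (zpow n) \<le> L2_norm_on bidisc (\<lambda>z. conj_symbol z * zpow n z)"
proof (rule power2_le_imp_le)
  have b: "bidisc \<in> sets borel" using open_bidisc by simp
  have [measurable]: "zpow n \<in> borel_measurable borel" using bergman_space_borel[OF open_bidisc zpow_bergman] .
  note [measurable] = conj_symbol_measurable
  have L: "(\<lambda>z. conj_symbol z * zpow n z) \<in> L2_on bidisc"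
    by (rule L2_on_mult_bounded[OF bergman_spaceD(2)[OF zpow_bergman]
        borel_imp_lebesgue_on_measurable[OF conj_symbol_measurable] bidisc_conj_symbol_bound])
  have "ennreal ((L2_norm_on bidisc (zpow n))\<^sup>2)
      = (\<integral>\<^sup>+z. ennreal ((norm (zpow n z))\<^sup>2) * indicator bidisc z \<partial>lborel)"
    unfolding nn_integral_L2_norm[OF bergman_spaceD(2)[OF zpow_bergman], symmetric]
    by (rule nn_integral_lebesgue_on_borel[OF b]) measurable
  also have "\<dots> = (\<integral>\<^sup>+z. ennreal (norm (fst z) ^ (2 * n) * norm (snd z) ^ (2 * 0)) * indicator bidisc z \<partial>lborel)"
    by (intro nn_integral_cong) (simp add: indicator_def monomial_def norm_power power_mult[symmetric] mult.commute)
  also have "\<dots> = disc_moment n * disc_moment 0" by (rule bidisc_moment)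
  also have "\<dots> \<le> disc_moment (Suc n) * disc_moment 1"
    by (intro mult_mono disc_moment_Suc_ge disc_moment_1_ge) auto
  also have "\<dots> = (\<integral>\<^sup>+z. ennreal (norm (fst z) ^ (2 * Suc n) * norm (snd z) ^ (2 * 1)) * indicator bidisc z \<partial>lborel)"
    by (rule bidisc_moment[symmetric])
  also have "\<dots> = (\<integral>\<^sup>+z. ennreal ((norm (conj_symbol z * zpow n z))\<^sup>2) * indicator bidisc z \<partial>lborel)"
  proof -
    have "x ^ (2 * Suc n) * y ^ (2 * 1) = (x * y * x ^ n)\<^sup>2" for x y :: real
      unfolding power_even_eq by (simp add: power_mult_distrib mult_ac)
    then show ?thesis
      by (intro nn_integral_cong) (simp add: indicator_def monomial_def norm_mult norm_conj_symbol norm_power del: power_Suc)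
  qed
  also have "\<dots> = ennreal ((L2_norm_on bidisc (\<lambda>z. conj_symbol z * zpow n z))\<^sup>2)"
    unfolding nn_integral_L2_norm[OF L, symmetric]
    by (rule nn_integral_lebesgue_on_borel[OF b, symmetric]) measurable
  finally show "(L2_norm_on bidisc (zpow n))\<^sup>2 \<le> (L2_norm_on bidisc (\<lambda>z. conj_symbol z * zpow n z))\<^sup>2"
    by simp
qed simp

lemma norm_zpow_pos: "L2_norm_on bidisc (zpow n) > 0"
proof -
  have "L2_norm_on bidisc (zpow n) \<noteq> 0"
  proof
    assume "L2_norm_on bidisc (zpow n) = 0"
    from bergman_norm_zero[OF open_bidisc zpow_bergman this] have "zpow n (1, 1) = 0" by simp
    then show False by (simp add: monomial_def bidisc_def)
  qed
  then show ?thesis using L2_norm_nonneg[of bidisc "zpow n"] by linarith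
qed

lemma bidisc_not_hilbert_schmidt: "\<not> hilbert_schmidt_bergman bidisc (hankel bidisc conj_symbol)"
proof -
  note meas = borel_imp_lebesgue_on_measurable[OF conj_symbol_measurable, of bidisc]
  define s where "s = (\<lambda>n. complex_of_real (1 / L2_norm_on bidisc (zpow n)))"
  have s: "norm (s n) * L2_norm_on bidisc (zpow n) = 1" for n
    using norm_zpow_pos[of n] by (simp add: s_def norm_divide)
  show ?thesis
  proof (rule not_hilbert_schmidt_hankel[OF open_bidisc meas bidisc_conj_symbol_bound, of "\<lambda>n z. s n * zpow n z"])
    show "(\<lambda>z. s n * zpow n z) \<in> bergman_space bidisc" for n by (rule bergman_space_scale[OF zpow_bergman])
    show "L2_inner_on bidisc (\<lambda>z. s m * zpow m z) (\<lambda>z. s n * zpow n z) = (if m = n then 1 else 0)" for m n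
    proof (cases "m = n")
      case True
      have "L2_inner_on bidisc (\<lambda>z. s n * zpow n z) (\<lambda>z. s n * zpow n z)
          = of_real ((norm (s n) * L2_norm_on bidisc (zpow n))\<^sup>2)"
        unfolding L2_inner_self L2_norm_scale ..
      then show ?thesis using True s[of n] by simp
    next
      case False
      then show ?thesis by (simp add: L2_inner_scale_left L2_inner_scale_right zpow_orthogonal)
    qed
    show "1 \<le> L2_norm_on bidisc (hankel bidisc conj_symbol (\<lambda>z. s n * zpow n z))" for n
    proof -
      have "L2_norm_on bidisc (hankel bidisc conj_symbol (\<lambda>z. s n * zpow n z))
          = L2_norm_on bidisc (\<lambda>z. s n * hankel bidisc conj_symbol (zpow n) z)"
        by (rule L2_norm_cong) (rule hankel_scale[OF open_bidisc meas bidisc_conj_symbol_bound _ zpow_bergman], auto)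
      also have "\<dots> = norm (s n) * L2_norm_on bidisc (\<lambda>z. conj_symbol z * zpow n z)"
        by (simp add: L2_norm_scale hankel_zpow)
      also have "\<dots> \<ge> norm (s n) * L2_norm_on bidisc (zpow n)"
        by (intro mult_left_mono norm_zpow_le) simp
      finally show ?thesis using s[of n] by simp
    qed
  qed auto
qed

theorem theorem2:
  "hilbert_schmidt_bergman Omega (hankel Omega conj_symbol) \<and>
   hilbert_schmidt_bergman Omega' (hankel Omega' conj_symbol) \<and>
   bounded_linear_bergman (Omega \<inter> Omega') (hankel (Omega \<inter> Omega') conj_symbol) \<and>
   \<not> hilbert_schmidt_bergman (Omega \<inter> Omega') (hankel (Omega \<inter> Omega') conj_symbol)"
proof -
  have "bounded_linear_bergman bidisc (hankel bidisc conj_symbol)"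
    by (rule hankel_bounded_linear[OF open_bidisc
        borel_imp_lebesgue_on_measurable[OF conj_symbol_measurable] bidisc_conj_symbol_bound]) auto
  then show ?thesis
    unfolding Omega_Int_Omega'
    using diagonal_domain.hilbert_schmidt[OF diagonal_domain_Omega]
      diagonal_domain.hilbert_schmidt[OF diagonal_domain_Omega'] bidisc_not_hilbert_schmidt by blast
qed

end
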